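(* Let $\mathcal{X}$ be a finite set, $\mathcal{H}$ a finite-dimensional Hilbert space, $W:\mathcal{X}\to\mathcal{S}(\mathcal{H})$ a classical-quantum channel, and $p\in\mathcal{P}(\mathcal{X})$. Then for every $\epsilon\in(0,1)$, \[ R(p,W)=R_\epsilon(p,W)=\inf_{q\in\mathcal{P}(\mathcal{X}):\,W(q)=W(p)} I(X;B)_{W\times q}. \] Moreover, for every $R<R(p,W)$, $\varepsilon(p^{\otimes n},W^{\otimes n},\lfloor 2^{nR}\rfloor)\to 1$ exponentially as $n\to\infty$.
   Context: $\mathcal{S}(\mathcal{H})$ is the set of density matrices on $\mathcal{H}$ and $\mathcal{P}(\mathcal{X})$ the set of probability distributions on $\mathcal{X}$. For $q\in\mathcal{P}(\mathcal{X})$, $W(q):=\sum_x q(x)W_x$ and $I(X;B)_{W\times q}:=\sum_x q(x)D(W_x\|W(q))$ with $D(\rho\|\sigma)=\mathrm{Tr}\,\rho(\log\rho-\log\sigma)$; logarithms are base 2. For $x^n\in\mathcal{X}^n$, $W^{\otimes n}_{x^n}:=W_{x_1}\otimes\cdots\otimes W_{x_n}$, and for a distribution $p^n$ on $\mathcal{X}^n$, $W^{\otimes n}(p^n):=\sum_{x^n}p^n(x^n)W^{\otimes n}_{x^n}$; $p^{\otimes n}$ is the i.i.d. product distribution. For a positive integer $M$, $\mathcal{P}_M(\mathcal{X}^n)$ is the set of distributions $q$ on $\mathcal{X}^n$ with $Mq(x^n)\in\mathbb{Z}$ for all $x^n$ (equivalently, empirical distributions of codebooks of $M$ codewords). Define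 \[ \varepsilon(p^{\otimes n},W^{\otimes n},M):=\inf_{q^n\in\mathcal{P}_M(\mathcal{X}^n)}\tfrac12\|W^{\otimes n}(p^{\otimes n})-W^{\otimes n}(q^n)\|_1, \] $R(p,W):=\inf\{R>0:\ \forall\gamma>0,\ \liminf_{n\to\infty}\varepsilon(p^{\otimes n},W^{\otimes n},\lfloor 2^{n(R+\gamma)}\rfloor)=0\}$, and for $\epsilon\in(0,1)$, $M_\epsilon(p^{\otimes n},W^{\otimes n}):=\min\{M\in\mathbb{N}_+:\varepsilon(p^{\otimes n},W^{\otimes n},M)\le\epsilon\}$ and $R_\epsilon(p,W):=\liminf_{n\to\infty}\frac1n\log M_\epsilon(p^{\otimes n},W^{\otimes n})$.
   Formalization: The exponential strong converse is stated for 0 ≤ R < R(p,W); for R < 0 the codebook size ⌊2^{nR}⌋ is 0, for which P_M and hence ε are undefined. *)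

theory Defs
  imports "Jordan_Normal_Form.Matrix" "HOL-Library.Extended_Real" "HOL-Library.Liminf_Limsup"
begin

definition ctrace :: "complex mat \<Rightarrow> complex" where
  "ctrace A = (\<Sum>i<dim_row A. A $$ (i,i))"

definition adj :: "complex mat \<Rightarrow> complex mat" where
  "adj A = mat (dim_col A) (dim_row A) (\<lambda>(i,j). cnj (A $$ (j,i)))"

definition hermitian :: "complex mat \<Rightarrow> bool" where
  "hermitian A \<longleftrightarrow> dim_row A = dim_col A \<and> adj A = A"

definition unitary :: "nat \<Rightarrow> complex mat \<Rightarrow> bool" where
  "unitary d U \<longleftrightarrow> U \<in> carrier_mat d d \<and> U * adj U = 1\<^sub>m d \<and> adj U * U = 1\<^sub>m d"

definition spec_decomp :: "complex mat \<Rightarrow> complex mat \<Rightarrow> (nat \<Rightarrow> real) \<Rightarrow> bool" where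
  "spec_decomp A U lam \<longleftrightarrow> unitary (dim_row A) U \<and>
     A = U * mat_diag (dim_row A) (\<lambda>i. complex_of_real (lam i)) * adj U"

text \<open>functional calculus f(A) for a Hermitian matrix A (well defined, independent of the
  chosen spectral decomposition)\<close>
definition mat_fun :: "(real \<Rightarrow> real) \<Rightarrow> complex mat \<Rightarrow> complex mat" where
  "mat_fun f A = (let (U, lam) = (SOME (U, lam). spec_decomp A U lam)
                  in U * mat_diag (dim_row A) (\<lambda>i. complex_of_real (f (lam i))) * adj U)"

definition mat_log :: "complex mat \<Rightarrow> complex mat" where
  "mat_log A = mat_fun (\<lambda>t. if t > 0 then log 2 t else 0) A"

definition trace_norm :: "complex mat \<Rightarrow> real" where
  "trace_norm A = Re (ctrace (mat_fun sqrt (adj A * A)))"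

definition psd :: "complex mat \<Rightarrow> bool" where
  "psd A \<longleftrightarrow> hermitian A \<and>
     (\<forall>v \<in> carrier_vec (dim_row A).
        0 \<le> Re (\<Sum>i<dim_row A. \<Sum>j<dim_row A. cnj (v $ i) * A $$ (i,j) * v $ j))"

definition density :: "nat \<Rightarrow> complex mat \<Rightarrow> bool" where
  "density d \<rho> \<longleftrightarrow> \<rho> \<in> carrier_mat d d \<and> psd \<rho> \<and> ctrace \<rho> = 1"

text \<open>supp rho \<subseteq> supp sigma, i.e. ker sigma \<subseteq> ker rho\<close>
definition supp_le :: "complex mat \<Rightarrow> complex mat \<Rightarrow> bool" where
  "supp_le \<rho> \<sigma> \<longleftrightarrow> (\<forall>v \<in> carrier_vec (dim_col \<sigma>).
      \<sigma> *\<^sub>v v = 0\<^sub>v (dim_row \<sigma>) \<longrightarrow> \<rho> *\<^sub>v v = 0\<^sub>v (dim_row \<rho>))"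

definition rel_ent :: "complex mat \<Rightarrow> complex mat \<Rightarrow> ereal" where
  "rel_ent \<rho> \<sigma> = (if supp_le \<rho> \<sigma>
      then ereal (Re (ctrace (\<rho> * (mat_log \<rho> - mat_log \<sigma>)))) else \<infinity>)"

definition kron :: "complex mat \<Rightarrow> complex mat \<Rightarrow> complex mat" where
  "kron A B = mat (dim_row A * dim_row B) (dim_col A * dim_col B)
     (\<lambda>(i,j). A $$ (i div dim_row B, j div dim_col B) * B $$ (i mod dim_row B, j mod dim_col B))"

definition prob_dist :: "('x::finite \<Rightarrow> real) \<Rightarrow> bool" where
  "prob_dist q \<longleftrightarrow> (\<forall>x. 0 \<le> q x) \<and> (\<Sum>x\<in>UNIV. q x) = 1"

text \<open>X^n is represented by the words (lists) of length n\<close>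
definition words :: "nat \<Rightarrow> 'x list set" where
  "words n = {xs. length xs = n}"

definition prob_dist_n :: "nat \<Rightarrow> ('x::finite list \<Rightarrow> real) \<Rightarrow> bool" where
  "prob_dist_n n q \<longleftrightarrow> (\<forall>xs. 0 \<le> q xs) \<and> (\<forall>xs. xs \<notin> words n \<longrightarrow> q xs = 0)
      \<and> (\<Sum>xs\<in>words n. q xs) = 1"

definition iid :: "('x \<Rightarrow> real) \<Rightarrow> nat \<Rightarrow> 'x list \<Rightarrow> real" where
  "iid p n xs = (if length xs = n then prod_list (map p xs) else 0)"

definition types_M :: "nat \<Rightarrow> nat \<Rightarrow> ('x::finite list \<Rightarrow> real) set" where
  "types_M n M = {q. prob_dist_n n q \<and> (\<forall>xs. real M * q xs \<in> \<int>)}"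

definition cq_channel :: "nat \<Rightarrow> ('x \<Rightarrow> complex mat) \<Rightarrow> bool" where
  "cq_channel d W \<longleftrightarrow> (\<forall>x. density d (W x))"

definition avg_state :: "nat \<Rightarrow> ('x::finite \<Rightarrow> complex mat) \<Rightarrow> ('x \<Rightarrow> real) \<Rightarrow> complex mat" where
  "avg_state d W q = mat d d (\<lambda>(i,j). \<Sum>x\<in>UNIV. complex_of_real (q x) * W x $$ (i,j))"

definition tensor_word :: "('x \<Rightarrow> complex mat) \<Rightarrow> 'x list \<Rightarrow> complex mat" where
  "tensor_word W xs = foldr (\<lambda>x M. kron (W x) M) xs (1\<^sub>m 1)"

definition avg_state_n :: "nat \<Rightarrow> nat \<Rightarrow> ('x::finite \<Rightarrow> complex mat) \<Rightarrow> ('x list \<Rightarrow> real) \<Rightarrow> complex mat" where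
  "avg_state_n d n W q = mat (d^n) (d^n)
     (\<lambda>(i,j). \<Sum>xs\<in>words n. complex_of_real (q xs) * tensor_word W xs $$ (i,j))"

definition mutual_info :: "nat \<Rightarrow> ('x::finite \<Rightarrow> complex mat) \<Rightarrow> ('x \<Rightarrow> real) \<Rightarrow> ereal" where
  "mutual_info d W q = (\<Sum>x\<in>UNIV. ereal (q x) * rel_ent (W x) (avg_state d W q))"

definition eps_cov :: "nat \<Rightarrow> ('x::finite \<Rightarrow> complex mat) \<Rightarrow> ('x \<Rightarrow> real) \<Rightarrow> nat \<Rightarrow> nat \<Rightarrow> real" where
  "eps_cov d W p n M = Inf ((\<lambda>q. trace_norm (avg_state_n d n W (iid p n) - avg_state_n d n W q) / 2)
                            ` types_M n M)"

definition rate_R :: "nat \<Rightarrow> ('x::finite \<Rightarrow> complex mat) \<Rightarrow> ('x \<Rightarrow> real) \<Rightarrow> real" where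
  "rate_R d W p = Inf {R. R > 0 \<and> (\<forall>\<gamma>>0.
      liminf (\<lambda>n. ereal (eps_cov d W p n (nat \<lfloor>2 powr (real n * (R + \<gamma>))\<rfloor>))) = 0)}"

definition M_eps :: "nat \<Rightarrow> ('x::finite \<Rightarrow> complex mat) \<Rightarrow> ('x \<Rightarrow> real) \<Rightarrow> real \<Rightarrow> nat \<Rightarrow> nat" where
  "M_eps d W p \<epsilon> n = (LEAST M. M \<ge> 1 \<and> eps_cov d W p n M \<le> \<epsilon>)"

definition rate_R_eps :: "nat \<Rightarrow> ('x::finite \<Rightarrow> complex mat) \<Rightarrow> ('x \<Rightarrow> real) \<Rightarrow> real \<Rightarrow> ereal" where
  "rate_R_eps d W p \<epsilon> = liminf (\<lambda>n. ereal (log 2 (real (M_eps d W p \<epsilon> n)) / real n))"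

end

theory Submission
  imports Defs "Jordan_Normal_Form.Spectral_Radius" "HOL-Analysis.Function_Topology"
begin

text \<open>
  Write \<open>\<rho> = W(p)\<close> and \<open>H\<close> for the von Neumann entropy. On the feasible set \<open>W(q) = \<rho>\<close> the
  mutual information \<open>H(\<rho>) - \<Sum>\<^sub>x q(x) H(W\<^sub>x)\<close> is affine in \<open>q\<close>, so its infimum \<open>R\<^sup>*\<close> is the value of a
  linear program.

  Converse: linear programming duality yields, up to an arbitrarily small error, a Hermitian \<open>A\<close> with
  \<open>H(W\<^sub>x) + Tr (A W\<^sub>x) \<le> 0\<close> for all \<open>x\<close> and \<open>H(\<rho>) + Tr (A \<rho>) = R\<^sup>*\<close>. If a codeword has
  \<open>\<Sum>\<^sub>i H(W\<^sub>x\<^sub>i)\<close> noticeably above \<open>- n Tr (A \<rho>)\<close>, then measuring \<open>\<Sum>\<^sub>i A\<^sub>i\<close> tells its output from \<open>\<rho>\<^sup>n\<close>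
  with exponentially small error. The typical eigenvectors of the at most \<open>2^(nR)\<close> other codewords span
  only about \<open>2^(nR) 2^(n(H(\<rho>) - R\<^sup>*))\<close> dimensions, which carry an exponentially small part of \<open>\<rho>\<^sup>n\<close>.
  This bounds every codebook with at most \<open>2^(nR)\<close> words.

  Achievability: for feasible \<open>q\<close> an i.i.d. codebook drawn from \<open>q\<close> approximates \<open>\<rho>\<^sup>n\<close> in Hilbert-Schmidt
  norm after truncation to typical eigenvalues, and on the typical subspace of \<open>\<rho>\<^sup>n\<close> the
  Hilbert-Schmidt norm controls the trace norm.
\<close>

subsection \<open>Matrices and the spectral theorem\<close>

text \<open>The codebook in the converse is arbitrary: its words may have any composition and need
  not satisfy W(q) = W(p), not even approximately. The dual multiplier copes with this without
  sorting words by composition: one threshold on one additive observable either exposes a word or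
  bounds its entropy sum. The multiplier is obtained only up to a gap, since it is extracted from a
  penalised problem by compactness; one more \<open>\<delta>\<close> in the exponent absorbs the
  gap. The converse is proved for all codebook sizes up to 2^(nR) at once. The sets
  \<open>types_M n M\<close> are not nested in \<open>M\<close>, so the size floor(2^(nR)) alone
  would say nothing about the minimal size \<open>M_eps\<close>. Both directions reduce to classical
  sums of independent terms, because a product state seen in a product basis is a product
  distribution; Chernoff estimates with a fixed bound per site then give every exponent. Lower
  bounds on the trace norm come from a single projector, upper bounds from the sign of the
  difference.\<close>

lemma adj_carrier[simp]: "A \<in> carrier_mat n m \<Longrightarrow> adj A \<in> carrier_mat m n"
  by (auto simp: adj_def)

lemma adj_dim[simp]: "dim_row (adj A) = dim_col A" "dim_col (adj A) = dim_row A"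
  by (auto simp: adj_def)

lemma adj_index[simp]:
  "i < dim_col A \<Longrightarrow> j < dim_row A \<Longrightarrow> adj A $$ (i,j) = cnj (A $$ (j,i))"
  by (auto simp: adj_def)

lemma adj_adj[simp]: "adj (adj A) = A"
  by (rule eq_matI) auto

lemma mult_mat_index:
  "A \<in> carrier_mat n m \<Longrightarrow> B \<in> carrier_mat m k \<Longrightarrow> i < n \<Longrightarrow> j < k \<Longrightarrow>
    (A * B) $$ (i,j) = (\<Sum>l<m. A $$ (i,l) * B $$ (l,j))"
  by (auto simp: scalar_prod_def atLeast0LessThan intro!: sum.cong)

lemma adj_mult:
  assumes "A \<in> carrier_mat n m" "B \<in> carrier_mat m k"
  shows "adj (A * B) = adj B * adj A"
proof (rule eq_matI)
  fix i j assume "i < dim_row (adj B * adj A)" "j < dim_col (adj B * adj A)"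
  hence i: "i < k" and j: "j < n" using assms by auto
  have "adj (A * B) $$ (i,j) = cnj ((A * B) $$ (j,i))" using assms i j by (subst adj_index) auto
  also have "\<dots> = (\<Sum>l<m. cnj (A $$ (j,l)) * cnj (B $$ (l,i)))"
    by (subst mult_mat_index[OF assms j i]) simp
  also have "\<dots> = (\<Sum>l<m. adj B $$ (i,l) * adj A $$ (l,j))"
    using assms i j by (intro sum.cong) auto
  also have "\<dots> = (adj B * adj A) $$ (i,j)"
    by (subst mult_mat_index[of _ k m _ n]) (use assms i j in auto)
  finally show "adj (A * B) $$ (i,j) = (adj B * adj A) $$ (i,j)" .
qed (use assms in auto)

lemma adj_add: "A \<in> carrier_mat n m \<Longrightarrow> B \<in> carrier_mat n m \<Longrightarrow> adj (A + B) = adj A + adj B"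
  by (rule eq_matI) auto

lemma adj_minus: "A \<in> carrier_mat n m \<Longrightarrow> B \<in> carrier_mat n m \<Longrightarrow> adj (A - B) = adj A - adj B"
  by (rule eq_matI) (auto simp: index_minus_mat)

lemma adj_smult: "adj (c \<cdot>\<^sub>m A) = cnj c \<cdot>\<^sub>m adj A"
  by (rule eq_matI) auto

lemma adj_one[simp]: "adj (1\<^sub>m n) = 1\<^sub>m n"
  by (rule eq_matI) auto

lemma adj_mat_diag: "adj (mat_diag n f) = mat_diag n (\<lambda>i. cnj (f i))"
  by (rule eq_matI) (auto simp: mat_diag_def)

lemma dim_mat_diag[simp]: "dim_row (mat_diag n f) = n" "dim_col (mat_diag n f) = n"
  by (auto simp: mat_diag_def)

lemma ctrace_comm:
  assumes "A \<in> carrier_mat n m" "B \<in> carrier_mat m n"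
  shows "ctrace (A * B) = ctrace (B * A)"
proof -
  have "ctrace (A * B) = (\<Sum>i<n. \<Sum>l<m. A $$ (i,l) * B $$ (l,i))"
    unfolding ctrace_def using assms mult_mat_index[OF assms] by (auto intro!: sum.cong)
  also have "\<dots> = (\<Sum>l<m. \<Sum>i<n. B $$ (l,i) * A $$ (i,l))"
    by (subst sum.swap) (simp add: mult.commute)
  also have "\<dots> = ctrace (B * A)"
    unfolding ctrace_def using assms mult_mat_index[OF assms(2,1)] by (auto intro!: sum.cong)
  finally show ?thesis .
qed

lemma ctrace_mult_entries:
  assumes "A \<in> carrier_mat n m" "B \<in> carrier_mat m n"
  shows "ctrace (A * B) = (\<Sum>i<n. \<Sum>j<m. A $$ (i,j) * B $$ (j,i))"
  unfolding ctrace_def using assms mult_mat_index[OF assms] by (auto intro!: sum.cong)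

lemma ctrace_add: "A \<in> carrier_mat n n \<Longrightarrow> B \<in> carrier_mat n n \<Longrightarrow> ctrace (A + B) = ctrace A + ctrace B"
  by (auto simp: ctrace_def sum.distrib)

lemma ctrace_minus: "A \<in> carrier_mat n n \<Longrightarrow> B \<in> carrier_mat n n \<Longrightarrow> ctrace (A - B) = ctrace A - ctrace B"
  by (auto simp: ctrace_def sum_subtractf)

lemma ctrace_smult: "A \<in> carrier_mat n n \<Longrightarrow> ctrace (c \<cdot>\<^sub>m A) = c * ctrace A"
  by (auto simp: ctrace_def sum_distrib_left)

lemma hermitianI: "A \<in> carrier_mat n n \<Longrightarrow> adj A = A \<Longrightarrow> hermitian A"
  by (auto simp: hermitian_def)

lemma hermitianD: "hermitian A \<Longrightarrow> adj A = A"
  by (auto simp: hermitian_def)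

lemma hermitian_entry:
  "hermitian A \<Longrightarrow> A \<in> carrier_mat n n \<Longrightarrow> i < n \<Longrightarrow> j < n \<Longrightarrow> A $$ (i,j) = cnj (A $$ (j,i))"
  by (metis adj_index carrier_matD(1) carrier_matD(2) hermitian_def)

lemma unitaryD:
  "unitary n U \<Longrightarrow> U \<in> carrier_mat n n" "unitary n U \<Longrightarrow> U * adj U = 1\<^sub>m n"
  "unitary n U \<Longrightarrow> adj U * U = 1\<^sub>m n"
  by (auto simp: unitary_def)

lemma unitaryI:
  assumes "U \<in> carrier_mat n n" "adj U * U = 1\<^sub>m n"
  shows "unitary n U"
  using assms mat_mult_left_right_inverse[of "adj U" n U] by (auto simp: unitary_def)

lemma mat_assoc:
  fixes A B C :: "complex mat"
  shows "dim_col A = dim_row B \<Longrightarrow> dim_col B = dim_row C \<Longrightarrow> A * B * C = A * (B * C)"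
  using assoc_mult_mat[of A "dim_row A" "dim_row B" B "dim_row C" C "dim_col C"]
  by (metis carrier_mat_triv)

lemma adj_mult_dim: "dim_col A = dim_row B \<Longrightarrow> adj (A * B) = adj B * adj A"
  by (rule adj_mult[of A "dim_row A" "dim_row B" B "dim_col B"]) auto

lemma mult_minus_dim:
  fixes A B C :: "complex mat"
  shows "dim_row B = dim_row C \<Longrightarrow> dim_col B = dim_col C \<Longrightarrow> dim_col A = dim_row B \<Longrightarrow>
    A * (B - C) = A * B - A * C"
  by (rule mult_minus_distrib_mat[of A "dim_row A" "dim_row B" B "dim_col B"]) auto

lemma minus_mult_dim:
  fixes A B C :: "complex mat"
  shows "dim_row A = dim_row B \<Longrightarrow> dim_col A = dim_col B \<Longrightarrow> dim_col B = dim_row C \<Longrightarrow>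
    (A - B) * C = A * C - B * C"
  by (rule minus_mult_distrib_mat[of A "dim_row A" "dim_row C" B C "dim_col C"]) auto

lemma unitary_cancel:
  assumes "unitary n U" "dim_row X = n"
  shows "adj U * (U * X) = X" "U * (adj U * X) = X"
  using assms carrier_matD[OF unitaryD(1)[OF assms(1)]]
  by (simp_all add: mat_assoc[symmetric] unitaryD left_mult_one_mat')

lemma unitary_dim: "unitary n U \<Longrightarrow> dim_row U = n" "unitary n U \<Longrightarrow> dim_col U = n"
  by (auto simp: unitary_def)

lemma unitary_mult:
  assumes U: "unitary n U" and V: "unitary n V"
  shows "unitary n (U * V)"
proof (rule unitaryI)
  note c = unitaryD(1)[OF U] unitaryD(1)[OF V]
  show "U * V \<in> carrier_mat n n" using c by auto
  show "adj (U * V) * (U * V) = 1\<^sub>m n"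
    by (simp add: adj_mult[OF c] mat_assoc unitary_dim[OF U] unitary_dim[OF V] unitary_cancel[OF U]
      unitaryD(3)[OF V])
qed

section \<open>Spectral decompositions, functional calculus and the trace norm\<close>

lemma conj_mat_diag_index:
  assumes "U \<in> carrier_mat n n" "i < n" "j < n"
  shows "(U * mat_diag n f * adj U) $$ (i,j) = (\<Sum>k<n. f k * U $$ (i,k) * cnj (U $$ (j,k)))"
proof -
  have "(U * mat_diag n f * adj U) $$ (i,j)
      = (\<Sum>k<n. (U * mat_diag n f) $$ (i,k) * adj U $$ (k,j))"
    by (rule mult_mat_index) (use assms in auto)
  also have "\<dots> = (\<Sum>k<n. f k * U $$ (i,k) * cnj (U $$ (j,k)))"
    using assms by (intro sum.cong) (auto simp: mat_diag_mult_right[OF assms(1)])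
  finally show ?thesis .
qed

lemma spec_decomp_iff:
  assumes "A \<in> carrier_mat n n"
  shows "spec_decomp A U lam \<longleftrightarrow> unitary n U \<and>
    A = U * mat_diag n (\<lambda>i. complex_of_real (lam i)) * adj U"
  using assms by (simp add: spec_decomp_def)

lemma spec_decomp_entry:
  assumes "A \<in> carrier_mat n n" "spec_decomp A U lam" "i < n" "j < n"
  shows "A $$ (i,j) = (\<Sum>k<n. complex_of_real (lam k) * U $$ (i,k) * cnj (U $$ (j,k)))"
  using assms conj_mat_diag_index[OF unitaryD(1), of n U i j] by (auto simp: spec_decomp_iff)

lemma spec_decompI:
  assumes "A \<in> carrier_mat n n" "unitary n U"
    and "\<And>i j. i < n \<Longrightarrow> j < n \<Longrightarrow>
      A $$ (i,j) = (\<Sum>k<n. complex_of_real (lam k) * U $$ (i,k) * cnj (U $$ (j,k)))"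
  shows "spec_decomp A U lam"
  unfolding spec_decomp_iff[OF assms(1)]
proof (intro conjI assms(2) eq_matI)
  note U = unitaryD(1)[OF assms(2)]
  let ?D = "mat_diag n (\<lambda>i. complex_of_real (lam i))"
  show "A $$ (i,j) = (U * ?D * adj U) $$ (i,j)"
    if "i < dim_row (U * ?D * adj U)" "j < dim_col (U * ?D * adj U)" for i j
  proof -
    have ij: "i < n" "j < n" using that U by auto
    show ?thesis unfolding conj_mat_diag_index[OF U ij] by (rule assms(3)[OF ij])
  qed
qed (use assms(1) unitaryD(1)[OF assms(2)] in auto)

lemma spec_decomp_hermitian:
  assumes "A \<in> carrier_mat n n" "spec_decomp A U lam"
  shows "hermitian A"
proof (rule hermitianI[OF assms(1)], rule eq_matI)
  show "adj A $$ (i,j) = A $$ (i,j)" if "i < dim_row A" "j < dim_col A" for i j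
    using that assms spec_decomp_entry[OF assms, of i j] spec_decomp_entry[OF assms, of j i]
    by (auto simp: mult_ac intro!: sum.cong)
qed (use assms(1) in auto)

lemma ctrace_spec_decomp:
  assumes "A \<in> carrier_mat n n" "E \<in> carrier_mat n n" "spec_decomp A U lam"
  shows "ctrace (E * A) = (\<Sum>k<n. complex_of_real (lam k) * (adj U * E * U) $$ (k,k))"
proof -
  let ?D = "mat_diag n (\<lambda>i. complex_of_real (lam i))"
  have U: "unitary n U" and A: "A = U * ?D * adj U" using assms by (auto simp: spec_decomp_iff)
  note c = unitaryD(1)[OF U] assms(2)
  have B: "adj U * E * U \<in> carrier_mat n n" using c by auto
  have "ctrace (E * A) = ctrace ((E * U * ?D) * adj U)"
    unfolding A using c by (simp add: mat_assoc)
  also have "\<dots> = ctrace (adj U * (E * U * ?D))" by (rule ctrace_comm) (use c in auto)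
  also have "adj U * (E * U * ?D) = (adj U * E * U) * ?D"
    using c by (simp add: mat_assoc)
  also have "ctrace \<dots> = (\<Sum>k<n. complex_of_real (lam k) * (adj U * E * U) $$ (k,k))"
    unfolding ctrace_def mat_diag_mult_right[OF B] using c by (auto intro!: sum.cong)
  finally show ?thesis .
qed

lemma ctrace_eq_sum_spec:
  assumes "A \<in> carrier_mat n n" "spec_decomp A U lam"
  shows "ctrace A = complex_of_real (\<Sum>k<n. lam k)"
proof -
  have U: "unitary n U" using assms by (auto simp: spec_decomp_iff)
  have "ctrace A = ctrace (1\<^sub>m n * A)" using assms by simp
  also have "\<dots> = (\<Sum>k<n. complex_of_real (lam k) * (adj U * 1\<^sub>m n * U) $$ (k,k))"
    by (rule ctrace_spec_decomp[OF assms(1) _ assms(2)]) simp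
  also have "adj U * 1\<^sub>m n * U = 1\<^sub>m n" using unitaryD[OF U] by simp
  finally show ?thesis by simp
qed

text \<open>With \<open>Z = adj V * U\<close> the hypothesis reads Z D_a = D_b Z, that is Z_ij (a_j
  - b_i) = 0 for all entries. Where Z_ij is nonzero, a_j = b_i and hence f(a_j) = f(b_i), for any
  function f. This is the well-definedness of \<open>mat_fun\<close>.\<close>

lemma diag_conj_fun_unique:
  fixes a b :: "nat \<Rightarrow> real"
  assumes U: "unitary n U" and V: "unitary n V"
    and eq: "U * mat_diag n (\<lambda>i. complex_of_real (a i)) * adj U
           = V * mat_diag n (\<lambda>i. complex_of_real (b i)) * adj V"
  shows "U * mat_diag n (\<lambda>i. complex_of_real (f (a i))) * adj U
       = V * mat_diag n (\<lambda>i. complex_of_real (f (b i))) * adj V"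
proof -
  note c = unitaryD(1)[OF U] unitaryD(1)[OF V]
  define Z where "Z = adj V * U"
  have Z: "Z \<in> carrier_mat n n" using c by (auto simp: Z_def)
  let ?D = "\<lambda>a. mat_diag n (\<lambda>i. complex_of_real (a i))"
  note dims = unitary_dim[OF U] unitary_dim[OF V] unitary_cancel[OF U] unitary_cancel[OF V]
  have ZD: "Z * ?D g = adj V * (U * ?D g * adj U) * U" for g
    by (simp add: Z_def mat_assoc dims unitaryD[OF U] right_mult_one_mat')
  have DZ: "?D g * Z = adj V * (V * ?D g * adj V) * U" for g
    by (simp add: Z_def mat_assoc dims)
  have "Z * ?D a = ?D b * Z" unfolding ZD DZ eq ..
  hence e: "Z $$ (i,j) * complex_of_real (a j) = complex_of_real (b i) * Z $$ (i,j)" if "i < n" "j < n" for i j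
    using that unfolding mat_diag_mult_right[OF Z] mat_diag_mult_left[OF Z]
    by (metis (no_types, lifting) case_prod_conv index_mat(1))
  have "Z * ?D (f \<circ> a) = ?D (f \<circ> b) * Z"
    unfolding mat_diag_mult_right[OF Z] mat_diag_mult_left[OF Z]
  proof (rule eq_matI)
    fix i j assume *: "i < dim_row (mat n n (\<lambda>(i, j). complex_of_real ((f \<circ> b) i) * Z $$ (i, j)))"
     "j < dim_col (mat n n (\<lambda>(i, j). complex_of_real ((f \<circ> b) i) * Z $$ (i, j)))"
    show "mat n n (\<lambda>(i, j). Z $$ (i, j) * complex_of_real ((f \<circ> a) j)) $$ (i,j) =
      mat n n (\<lambda>(i, j). complex_of_real ((f \<circ> b) i) * Z $$ (i, j)) $$ (i,j)"
      using * e[of i j] by (cases "Z $$ (i,j) = 0") auto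
  qed auto
  hence "V * (Z * ?D (f \<circ> a)) * adj U = V * (?D (f \<circ> b) * Z) * adj U" by simp
  thus ?thesis
    by (simp add: Z_def mat_assoc dims unitaryD[OF U] unitaryD[OF V] right_mult_one_mat')
qed

text \<open>Removes the \<open>SOME\<close> from \<open>mat_fun\<close>: from here on, whichever
  spectral decomposition is at hand computes the matrix function.\<close>

lemma mat_fun_spec:
  assumes A: "A \<in> carrier_mat n n" and sd: "spec_decomp A U lam"
  shows "mat_fun f A = U * mat_diag n (\<lambda>i. complex_of_real (f (lam i))) * adj U"
proof -
  obtain V b where s: "(SOME (U, lam). spec_decomp A U lam) = (V, b)" by (metis surj_pair)
  have "spec_decomp A V b"
    using someI[of "\<lambda>(U, lam). spec_decomp A U lam" "(U,lam)"] sd unfolding s by simp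
  hence V: "unitary n V" "A = V * mat_diag n (\<lambda>i. complex_of_real (b i)) * adj V"
    using A by (auto simp: spec_decomp_iff)
  have U: "unitary n U" "A = U * mat_diag n (\<lambda>i. complex_of_real (lam i)) * adj U"
    using A sd by (auto simp: spec_decomp_iff)
  have "V * mat_diag n (\<lambda>i. complex_of_real (f (b i))) * adj V
      = U * mat_diag n (\<lambda>i. complex_of_real (f (lam i))) * adj U"
    by (rule diag_conj_fun_unique[OF V(1) U(1)]) (use U(2) V(2) in simp)
  thus ?thesis unfolding mat_fun_def s using A by simp
qed

lemma trace_norm_spec:
  assumes A: "A \<in> carrier_mat n n" and sd: "spec_decomp A U a"
  shows "trace_norm A = (\<Sum>k<n. \<bar>a k\<bar>)"
proof -
  have U: "unitary n U" and Aeq: "A = U * mat_diag n (\<lambda>i. complex_of_real (a i)) * adj U"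
    using A sd by (auto simp: spec_decomp_iff)
  note c = unitaryD(1)[OF U]
  let ?D = "\<lambda>a. mat_diag n (\<lambda>i. complex_of_real (a i))"
  have "adj A * A = A * A" using spec_decomp_hermitian[OF A sd] by (simp add: hermitianD)
  also have "\<dots> = U * (?D a * ?D a) * adj U"
    unfolding Aeq by (simp add: mat_assoc unitary_dim[OF U] unitary_cancel[OF U] del: mat_diag_diag)
  also have "?D a * ?D a = ?D (\<lambda>i. (a i)^2)" by (simp add: power2_eq_square)
  finally have e: "adj A * A = U * ?D (\<lambda>i. (a i)^2) * adj U" .
  have AA: "adj A * A \<in> carrier_mat n n" using A by auto
  have "spec_decomp (adj A * A) U (\<lambda>i. (a i)^2)"
    unfolding spec_decomp_iff[OF AA] using U e by simp
  from mat_fun_spec[OF AA this, of sqrt]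
  have m: "mat_fun sqrt (adj A * A) = U * ?D (\<lambda>i. \<bar>a i\<bar>) * adj U" by simp
  have "spec_decomp (mat_fun sqrt (adj A * A)) U (\<lambda>i. \<bar>a i\<bar>)"
    using m U c by (subst spec_decomp_iff[of _ n]) auto
  hence "ctrace (mat_fun sqrt (adj A * A)) = complex_of_real (\<Sum>k<n. \<bar>a k\<bar>)"
    by (intro ctrace_eq_sum_spec) (use m c in auto)
  thus ?thesis unfolding trace_norm_def by simp
qed

section \<open>Existence of a spectral decomposition\<close>

text \<open>Householder reflection U = 1 - (2/s) w adj(w) with w = v - e_0 and s = |w|^2 = 2 - 2t;
  it exchanges e_0 and the unit vector v. A reflection can do this only if the inner product of e_0
  and v is real, hence the assumption on \<open>v 0\<close>. For s = 0 the vector v is e_0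
  itself.\<close>

lemma unitary_with_first_column:
  fixes v :: "nat \<Rightarrow> complex"
  assumes "0 < n" and one: "(\<Sum>i<n. cnj (v i) * v i) = 1" and re: "v 0 = complex_of_real t"
  shows "\<exists>U. unitary n U \<and> (\<forall>i<n. U $$ (i,0) = v i)"
proof -
  define w where "w = mat n 1 (\<lambda>(i,j). v i - (if i = 0 then 1 else 0))"
  have w: "w \<in> carrier_mat n 1" by (auto simp: w_def)
  have wi: "w $$ (i,0) = v i - (if i = 0 then 1 else 0)" if "i < n" for i using that by (auto simp: w_def)
  define s where "s = 2 - 2 * t"
  have "(\<Sum>i<n. cnj (w $$ (i,0)) * w $$ (i,0))
     = (\<Sum>i<n. cnj (v i) * v i - (if i = 0 then v 0 + cnj (v 0) - 1 else 0))"
    by (intro sum.cong) (auto simp: wi algebra_simps)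
  also have "\<dots> = 1 - (v 0 + cnj (v 0) - 1)"
    using \<open>0 < n\<close> by (simp add: sum_subtractf one)
  finally have ws: "(\<Sum>i<n. cnj (w $$ (i,0)) * w $$ (i,0)) = complex_of_real s"
    by (simp add: re s_def)
  show ?thesis
  proof (cases "s = 0")
    case True
    have "complex_of_real (\<Sum>i<n. (cmod (w $$ (i,0)))^2) = 0"
      using ws True by (simp add: complex_norm_square mult.commute flip: of_real_power)
    hence "(\<Sum>i<n. (cmod (w $$ (i,0)))^2) = 0" by (simp only: of_real_eq_0_iff)
    hence "\<forall>i\<in>{..<n}. (cmod (w $$ (i,0)))^2 = 0" by (subst (asm) sum_nonneg_eq_0_iff) auto
    hence "\<forall>i<n. v i = (if i = 0 then 1 else 0)" using wi by auto
    hence "unitary n (1\<^sub>m n) \<and> (\<forall>i<n. 1\<^sub>m n $$ (i,0) = v i)" using \<open>0 < n\<close>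
      by (auto simp: unitary_def)
    thus ?thesis by blast
  next
    case False
    define c where "c = complex_of_real (-2 / s)"
    define K where "K = w * adj w"
    have K: "K \<in> carrier_mat n n" using w by (auto simp: K_def)
    have aK: "adj K = K" using w by (simp add: K_def adj_mult[OF w adj_carrier[OF w]])
    have "adj w * w = complex_of_real s \<cdot>\<^sub>m 1\<^sub>m 1"
    proof (rule eq_matI)
      fix i j assume "i < dim_row (complex_of_real s \<cdot>\<^sub>m 1\<^sub>m 1)" "j < dim_col (complex_of_real s \<cdot>\<^sub>m 1\<^sub>m 1)"
      hence "i = 0" "j = 0" by auto
      thus "(adj w * w) $$ (i,j) = (complex_of_real s \<cdot>\<^sub>m 1\<^sub>m 1) $$ (i,j)"
        using w ws by (subst mult_mat_index[of _ 1 n _ 1]) auto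
    qed (use w in auto)
    hence KK: "K * K = complex_of_real s \<cdot>\<^sub>m K"
    proof -
      assume e: "adj w * w = complex_of_real s \<cdot>\<^sub>m 1\<^sub>m 1"
      have "K * K = w * (adj w * w) * adj w" unfolding K_def
        using w by (simp add: mat_assoc)
      also have "\<dots> = complex_of_real s \<cdot>\<^sub>m K" unfolding e K_def using w
        by (simp add: mult_smult_distrib[of _ n 1 _ 1] mult_smult_assoc_mat[of _ n 1 _ n])
      finally show ?thesis .
    qed
    define U where "U = 1\<^sub>m n + c \<cdot>\<^sub>m K"
    have U: "U \<in> carrier_mat n n" using K by (auto simp: U_def)
    have aU: "adj U = U" unfolding U_def
      using K by (subst adj_add[of _ n n]) (auto simp: adj_smult aK c_def)
    have cs: "c + (c + c * (c * complex_of_real s)) = 0" using False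
      unfolding c_def of_real_mult[symmetric] of_real_add[symmetric] by (simp add: field_simps)
    have "U * U = 1\<^sub>m n * 1\<^sub>m n + 1\<^sub>m n * (c \<cdot>\<^sub>m K) + ((c \<cdot>\<^sub>m K) * 1\<^sub>m n + (c \<cdot>\<^sub>m K) * (c \<cdot>\<^sub>m K))"
      unfolding U_def using K
      by (simp add: add_mult_distrib_mat[of _ n n _ _ n] mult_add_distrib_mat[of _ n n _ n])
    also have "(c \<cdot>\<^sub>m K) * (c \<cdot>\<^sub>m K) = (c * (c * complex_of_real s)) \<cdot>\<^sub>m K"
      using K by (simp add: mult_smult_distrib[of _ n n _ n] mult_smult_assoc_mat[of _ n n _ n] KK)
         (rule eq_matI; simp)
    also have "1\<^sub>m n * 1\<^sub>m n + 1\<^sub>m n * (c \<cdot>\<^sub>m K) + ((c \<cdot>\<^sub>m K) * 1\<^sub>m n + (c * (c * complex_of_real s)) \<cdot>\<^sub>m K) = 1\<^sub>m n"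
    proof (rule eq_matI)
      fix i j assume "i < dim_row (1\<^sub>m n :: complex mat)" "j < dim_col (1\<^sub>m n :: complex mat)"
      hence ij: "i < n" "j < n" by auto
      have "(1\<^sub>m n * 1\<^sub>m n + 1\<^sub>m n * (c \<cdot>\<^sub>m K) + ((c \<cdot>\<^sub>m K) * 1\<^sub>m n + (c * (c * complex_of_real s)) \<cdot>\<^sub>m K)) $$ (i,j)
        = 1\<^sub>m n $$ (i,j) + (c + (c + c * (c * complex_of_real s))) * K $$ (i,j)"
        using ij K by (simp add: algebra_simps)
      thus "(1\<^sub>m n * 1\<^sub>m n + 1\<^sub>m n * (c \<cdot>\<^sub>m K) + ((c \<cdot>\<^sub>m K) * 1\<^sub>m n + (c * (c * complex_of_real s)) \<cdot>\<^sub>m K)) $$ (i,j)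
        = 1\<^sub>m n $$ (i,j)" by (simp add: cs)
    qed (use K in auto)
    finally have "unitary n U" by (intro unitaryI U) (simp add: aU)
    moreover have "U $$ (i,0) = v i" if i: "i < n" for i
    proof -
      have "K $$ (i,0) = w $$ (i,0) * cnj (w $$ (0,0))"
        unfolding K_def using w i \<open>0 < n\<close> by (subst mult_mat_index[of _ n 1 _ n]) auto
      hence "U $$ (i,0) = (if i = 0 then 1 else 0) + c * (v 0 - 1) * w $$ (i,0)"
        using i \<open>0 < n\<close> K by (simp add: U_def wi re)
      also have "c * (v 0 - 1) = complex_of_real ((-2 / s) * (t - 1))" by (simp add: c_def re)
      also have "(-2 / s) * (t - 1) = 1" using False by (simp add: s_def divide_simps)
      finally show ?thesis using i wi by simp
    qed
    ultimately show ?thesis by blast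
  qed
qed

text \<open>The free phase of an eigenvector is spent on making its first entry real, as
  \<open>unitary_with_first_column\<close> demands.\<close>

lemma unit_eigenvector_exists:
  assumes A: "A \<in> carrier_mat n n" and n: "0 < n"
  shows "\<exists>v k t. (\<Sum>i<n. cnj (v i) * v i) = 1 \<and> v 0 = complex_of_real t \<and>
    (\<forall>i<n. (\<Sum>j<n. A $$ (i,j) * v j) = k * v i)"
proof -
  obtain k where "eigenvalue A k" using spectrum_non_empty[OF A n] by (auto simp: spectrum_def)
  then obtain x where x: "x \<in> carrier_vec n" "x \<noteq> 0\<^sub>v n" "A *\<^sub>v x = k \<cdot>\<^sub>v x"
    using A by (auto simp: eigenvalue_def eigenvector_def)
  define r where "r = sqrt (\<Sum>i<n. (cmod (x $ i))^2)"
  obtain i0 where i0: "i0 < n" "x $ i0 \<noteq> 0" using x(1,2) by (metis eq_vecI carrier_vecD index_zero_vec)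
  have "(\<Sum>i<n. (cmod (x $ i))^2) > 0"
    by (rule sum_pos2[of _ i0]) (use i0 in auto)
  hence r: "r > 0" "r^2 = (\<Sum>i<n. (cmod (x $ i))^2)" by (auto simp: r_def)
  define ph where "ph = (if x $ 0 = 0 then 1 else cnj (sgn (x $ 0)))"
  have ph: "cmod ph = 1" by (auto simp: ph_def norm_sgn)
  define v where "v i = ph * x $ i / complex_of_real r" for i
  have cv: "(cmod (v i))^2 = (cmod (x $ i))^2 / r^2" for i
    using ph r by (simp add: v_def norm_mult norm_divide power_divide)
  have "(\<Sum>i<n. cnj (v i) * v i) = complex_of_real (\<Sum>i<n. (cmod (v i))^2)"
    by (simp add: complex_norm_square mult.commute flip: of_real_power)
  also have "(\<Sum>i<n. (cmod (v i))^2) = r^2 / r^2" unfolding cv sum_divide_distrib[symmetric] r(2)[symmetric] ..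
  also have "r^2 / r^2 = 1" using r(1) by simp
  finally have 1: "(\<Sum>i<n. cnj (v i) * v i) = 1" by simp
  have "ph * x $ 0 = complex_of_real (cmod (x $ 0))"
  proof (cases "x $ 0 = 0")
    case False
    have "cnj (sgn (x $ 0)) * x $ 0 = x $ 0 * cnj (x $ 0) / complex_of_real (cmod (x $ 0))"
      by (simp add: sgn_eq)
    also have "\<dots> = complex_of_real (cmod (x $ 0))"
      using False by (simp add: complex_norm_square[symmetric] power2_eq_square)
    finally have "cnj (sgn (x $ 0)) * x $ 0 = complex_of_real (cmod (x $ 0))" .
    thus ?thesis using False by (simp add: ph_def)
  qed simp
  hence 2: "v 0 = complex_of_real (cmod (x $ 0) / r)" by (simp add: v_def)
  have 3: "(\<Sum>j<n. A $$ (i,j) * v j) = k * v i" if "i < n" for i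
  proof -
    have "(\<Sum>j<n. A $$ (i,j) * x $ j) = (A *\<^sub>v x) $ i" using that A x(1)
      by (auto simp: mult_mat_vec_def scalar_prod_def atLeast0LessThan intro!: sum.cong)
    also have "\<dots> = k * x $ i" using x that by simp
    finally have e: "(\<Sum>j<n. A $$ (i,j) * x $ j) = k * x $ i" .
    have "(\<Sum>j<n. A $$ (i,j) * v j) = ph / complex_of_real r * (\<Sum>j<n. A $$ (i,j) * x $ j)"
      by (simp add: v_def sum_distrib_left mult_ac)
    thus ?thesis unfolding e by (simp add: v_def)
  qed
  show ?thesis using 1 2 3 by blast
qed


text \<open>Deflation: in a unitary basis that starts with an eigenvector, the first column of the
  matrix is k e_0; being Hermitian forces k to be real and the first row to vanish off the diagonal.
  The induction hypothesis applies to the remaining block.\<close>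

theorem hermitian_spec_decomp_exists:
  assumes "A \<in> carrier_mat n n" "hermitian A"
  shows "\<exists>U lam. spec_decomp A U lam"
  using assms
proof (induction n arbitrary: A)
  case 0
  have "unitary 0 (1\<^sub>m 0)" by (auto simp: unitary_def)
  moreover have "A = 1\<^sub>m 0 * mat_diag 0 (\<lambda>i. complex_of_real 0) * adj (1\<^sub>m 0)"
    using 0 by (intro eq_matI) auto
  ultimately have "spec_decomp A (1\<^sub>m 0) (\<lambda>i. 0)" unfolding spec_decomp_iff[OF 0(1)] by blast
  thus ?case by blast
next
  case (Suc m)
  let ?n = "Suc m"
  note A = Suc.prems(1)
  obtain v k t where v: "(\<Sum>i<?n. cnj (v i) * v i) = 1" "v 0 = complex_of_real t"
    and ev: "\<And>i. i < ?n \<Longrightarrow> (\<Sum>j<?n. A $$ (i,j) * v j) = k * v i"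
    using unit_eigenvector_exists[OF A] by auto
  obtain U where U: "unitary ?n U" and U0: "\<And>i. i < ?n \<Longrightarrow> U $$ (i,0) = v i"
    using unitary_with_first_column[OF _ v] by auto
  note cU = unitaryD(1)[OF U]
  define B where "B = adj U * A * U"
  have B: "B \<in> carrier_mat ?n ?n" using A cU by (auto simp: B_def)
  have aB: "adj B = B" using A cU hermitianD[OF Suc.prems(2)] unfolding B_def
    by (simp add: adj_mult[of _ ?n ?n _ ?n] mat_assoc)
  have AU: "(A * U) $$ (i,0) = k * U $$ (i,0)" if "i < ?n" for i
    using that ev[OF that] U0 by (subst mult_mat_index[OF A cU]) (auto intro!: sum.cong)
  have B0: "B $$ (i,0) = (if i = 0 then k else 0)" if i: "i < ?n" for i
  proof -
    have "B = adj U * (A * U)" unfolding B_def using A cU by (simp add: mat_assoc)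
    hence "B $$ (i,0) = (\<Sum>l<?n. adj U $$ (i,l) * (A * U) $$ (l,0))"
      using i A cU by (simp only:) (rule mult_mat_index; auto)
    also have "\<dots> = k * (\<Sum>l<?n. adj U $$ (i,l) * U $$ (l,0))"
      unfolding sum_distrib_left by (intro sum.cong) (auto simp: AU simp del: adj_index)
    also have "(\<Sum>l<?n. adj U $$ (i,l) * U $$ (l,0)) = (adj U * U) $$ (i,0)"
      by (rule mult_mat_index[symmetric]) (use i cU in auto)
    finally show ?thesis using i by (simp add: unitaryD(3)[OF U])
  qed
  have kr: "cnj k = k" using hermitian_entry[of B ?n 0 0] B0[of 0] B hermitianI[OF B aB] by auto
  hence kr: "k = complex_of_real (Re k)" by (simp add: complex_eq_iff)
  have B0': "B $$ (0,i) = (if i = 0 then k else 0)" if i: "i < ?n" for i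
    using hermitian_entry[OF hermitianI[OF B aB] B _ i, of 0] B0[OF i] kr by (auto simp: complex_eq_iff)
  define B' where "B' = mat m m (\<lambda>(i,j). B $$ (Suc i, Suc j))"
  have B': "B' \<in> carrier_mat m m" by (auto simp: B'_def)
  have "hermitian B'"
    by (rule hermitianI[OF B'], rule eq_matI)
      (auto simp: B'_def hermitian_entry[OF hermitianI[OF B aB] B, symmetric])
  from Suc.IH[OF B' this] obtain U' lam' where sd': "spec_decomp B' U' lam'" by blast
  hence U': "unitary m U'" using spec_decomp_iff[OF B'] by blast
  note cU' = unitaryD(1)[OF U']
  \<comment> \<open>Block diagonal with blocks 1 and \<open>U'\<close>, so that the eigenvector
    already found stays in place.\<close>
  define V where "V = mat ?n ?n (\<lambda>(i,j). case i of 0 \<Rightarrow> (if j = 0 then 1 else 0)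
     | Suc i' \<Rightarrow> (case j of 0 \<Rightarrow> 0 | Suc j' \<Rightarrow> U' $$ (i',j')))"
  define lam where "lam i = (case i of 0 \<Rightarrow> Re k | Suc i' \<Rightarrow> lam' i')" for i
  have V: "V \<in> carrier_mat ?n ?n" by (auto simp: V_def)
  have uV: "unitary ?n V"
  proof (rule unitaryI[OF V], rule eq_matI)
    fix i j assume "i < dim_row (1\<^sub>m ?n :: complex mat)" "j < dim_col (1\<^sub>m ?n :: complex mat)"
    hence ij: "i < ?n" "j < ?n" by auto
    have *: "(\<Sum>l<m. cnj (U' $$ (l,i')) * U' $$ (l,j')) = (if i' = j' then 1 else 0)"
      if "i' < m" "j' < m" for i' j'
    proof -
      have "(\<Sum>l<m. cnj (U' $$ (l,i')) * U' $$ (l,j')) = (\<Sum>l<m. adj U' $$ (i',l) * U' $$ (l,j'))"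
        using that cU' by (intro sum.cong) auto
      also have "\<dots> = (adj U' * U') $$ (i',j')"
        by (rule mult_mat_index[symmetric]) (use that cU' in auto)
      finally show ?thesis using that by (simp add: unitaryD(3)[OF U'])
    qed
    have "(adj V * V) $$ (i,j) = (\<Sum>l<?n. cnj (V $$ (l,i)) * V $$ (l,j))"
      using ij V by (subst mult_mat_index[of _ ?n ?n _ ?n]) auto
    also have "\<dots> = (if i = j then 1 else 0)"
      using ij * unfolding sum.lessThan_Suc_shift V_def by (cases i; cases j) auto
    finally show "(adj V * V) $$ (i,j) = 1\<^sub>m ?n $$ (i,j)" using ij by simp
  qed (use V in auto)
  have "spec_decomp B V lam"
  proof (rule spec_decompI[OF B uV])
    fix i j assume ij: "i < ?n" "j < ?n"
    have "B $$ (Suc i', Suc j') = (\<Sum>l<m. complex_of_real (lam' l) * U' $$ (i',l) * cnj (U' $$ (j',l)))"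
      if "i' < m" "j' < m" for i' j'
      using spec_decomp_entry[OF B' sd' that] that by (simp add: B'_def)
    thus "B $$ (i,j) = (\<Sum>l<?n. complex_of_real (lam l) * V $$ (i,l) * cnj (V $$ (j,l)))"
      using ij B0[of i] B0'[of j] kr
      unfolding sum.lessThan_Suc_shift V_def lam_def by (auto split: nat.splits)
  qed
  hence Beq: "B = V * mat_diag ?n (\<lambda>i. complex_of_real (lam i)) * adj V"
    by (simp add: spec_decomp_iff[OF B])
  have "A = U * B * adj U" unfolding B_def
    using A by (simp add: mat_assoc unitary_dim[OF U] unitary_cancel[OF U] unitaryD[OF U] right_mult_one_mat')
  also have "\<dots> = (U * V) * mat_diag ?n (\<lambda>i. complex_of_real (lam i)) * adj (U * V)"
    unfolding Beq by (simp add: adj_mult[OF cU V] mat_assoc unitary_dim[OF U] unitary_dim[OF uV])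
  finally have "A = (U * V) * mat_diag ?n (\<lambda>i. complex_of_real (lam i)) * adj (U * V)" .
  thus ?case unfolding spec_decomp_iff[OF A] using unitary_mult[OF U uV] by blast
qed

subsection \<open>Projectors as tests\<close>

definition projector :: "nat \<Rightarrow> complex mat \<Rightarrow> bool" where
  "projector n P \<longleftrightarrow> P \<in> carrier_mat n n \<and> adj P = P \<and> P * P = P"

lemma projectorD:
  "projector n P \<Longrightarrow> P \<in> carrier_mat n n" "projector n P \<Longrightarrow> adj P = P" "projector n P \<Longrightarrow> P * P = P"
  by (auto simp: projector_def)

lemma projector_compl:
  assumes "projector n P"
  shows "projector n (1\<^sub>m n - P)"
proof -
  note P = projectorD[OF assms]
  have "(1\<^sub>m n - P) * (1\<^sub>m n - P) = (1\<^sub>m n - P) * 1\<^sub>m n - (1\<^sub>m n - P) * P"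
    by (rule mult_minus_distrib_mat[of _ n n _ n]) (use P in auto)
  also have "(1\<^sub>m n - P) * P = 1\<^sub>m n * P - P * P"
    by (rule minus_mult_distrib_mat[of _ n n _ _ n]) (use P in auto)
  also have "1\<^sub>m n * P - P * P = 0\<^sub>m n n" using P by auto
  finally have "(1\<^sub>m n - P) * (1\<^sub>m n - P) = 1\<^sub>m n - P" using P
    by (simp add: right_mult_one_mat[of _ n n]) (rule eq_matI; auto)
  moreover have "adj (1\<^sub>m n - P) = 1\<^sub>m n - P" using P by (simp add: adj_minus[of _ n n])
  ultimately show ?thesis using P by (auto simp: projector_def)
qed

lemma projector_mat_diag_conj:
  assumes U: "unitary n U"
  shows "projector n (U * mat_diag n (\<lambda>i. if K i then 1 else 0) * adj U)"
proof -
  note c = unitaryD(1)[OF U]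
  let ?D = "mat_diag n (\<lambda>i. if K i then 1 else (0::complex))"
  have "?D * ?D = ?D" by (simp add: if_distrib cong: if_cong)
  hence DD: "?D * (?D * X) = ?D * X" if "dim_row X = n" for X
    using that by (simp add: mat_assoc[symmetric])
  have aD: "adj ?D = ?D" by (simp add: adj_mat_diag if_distrib cong: if_cong)
  have "adj (U * ?D * adj U) = U * ?D * adj U"
    using c by (simp add: adj_mult_dim aD mat_assoc)
  moreover have "(U * ?D * adj U) * (U * ?D * adj U) = U * ?D * adj U"
    by (simp add: mat_assoc unitary_dim[OF U] unitary_cancel[OF U] DD)
  ultimately show ?thesis using c by (auto simp: projector_def)
qed

text \<open>Because P = adj P * P, the entry is the squared length of P applied to column k of U.
  Applied to 1 - P as well, this confines such entries to [0,1], so they act as test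
  probabilities.\<close>

lemma projector_conj_diag:
  assumes P: "projector n P" and U: "unitary n U" and k: "k < n"
  shows "(adj U * P * U) $$ (k,k) = complex_of_real (\<Sum>i<n. (cmod ((P * U) $$ (i,k)))\<^sup>2)"
proof -
  note c = unitaryD(1)[OF U] projectorD[OF P]
  have PU: "P * U \<in> carrier_mat n n" using c by auto
  have "adj U * P * U = adj (P * U) * (P * U)"
    using c by (simp add: adj_mult[of P n n U n] mat_assoc) (simp add: mat_assoc[symmetric])
  hence "(adj U * P * U) $$ (k,k) = (\<Sum>i<n. adj (P * U) $$ (k,i) * (P * U) $$ (i,k))"
    using k PU by (simp only:) (rule mult_mat_index; simp)
  also have "\<dots> = (\<Sum>i<n. complex_of_real ((cmod ((P * U) $$ (i,k)))\<^sup>2))"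
    using k PU by (intro sum.cong) (auto simp: complex_norm_square mult.commute simp del: of_real_power index_mult_mat)
  finally show ?thesis by simp
qed

lemma projector_conj_diag_bounds:
  assumes P: "projector n P" and U: "unitary n U" and k: "k < n"
  shows "0 \<le> Re ((adj U * P * U) $$ (k,k))" "Re ((adj U * P * U) $$ (k,k)) \<le> 1"
    "Im ((adj U * P * U) $$ (k,k)) = 0"
proof -
  note c = unitaryD(1)[OF U] projectorD[OF P]
  show "0 \<le> Re ((adj U * P * U) $$ (k,k))" "Im ((adj U * P * U) $$ (k,k)) = 0"
    unfolding projector_conj_diag[OF assms] by (auto intro: sum_nonneg)
  have "adj U * (1\<^sub>m n - P) * U = adj U * U - adj U * P * U"
    using c by (simp add: mult_minus_dim minus_mult_dim right_mult_one_mat')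
  hence "(adj U * (1\<^sub>m n - P) * U) $$ (k,k) = 1 - (adj U * P * U) $$ (k,k)"
    using c k by (simp add: unitaryD(3)[OF U] del: index_mult_mat(1))
  moreover have "0 \<le> Re ((adj U * (1\<^sub>m n - P) * U) $$ (k,k))"
    unfolding projector_conj_diag[OF projector_compl[OF P] U k] by (auto intro: sum_nonneg)
  ultimately show "Re ((adj U * P * U) $$ (k,k)) \<le> 1" by simp
qed

lemma Re_ctrace_spec_decomp:
  assumes "A \<in> carrier_mat n n" "E \<in> carrier_mat n n" "spec_decomp A U lam"
  shows "Re (ctrace (E * A)) = (\<Sum>k<n. lam k * Re ((adj U * E * U) $$ (k,k)))"
  unfolding ctrace_spec_decomp[OF assms] by simp

lemma sum_conj_diag:
  assumes U: "unitary n U" and P: "P \<in> carrier_mat n n"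
  shows "(\<Sum>k<n. (adj U * P * U) $$ (k,k)) = ctrace P"
proof -
  note c = unitaryD(1)[OF U]
  have "(\<Sum>k<n. (adj U * P * U) $$ (k,k)) = ctrace (adj U * P * U)"
    using c by (simp add: ctrace_def)
  also have "\<dots> = ctrace (adj U * (P * U))" using c P by (simp add: mat_assoc)
  also have "ctrace (adj U * (P * U)) = ctrace ((P * U) * adj U)"
    by (rule ctrace_comm) (use c P in auto)
  also have "(P * U) * adj U = P"
    using P by (simp add: mat_assoc unitary_dim[OF U] unitaryD[OF U] right_mult_one_mat')
  finally show ?thesis .
qed

text \<open>In the eigenbasis of X the test accepts eigenvector k with probability q_k in [0,1]. The
  eigenvalues a_k sum to 0, so 2 Tr(EX) = sum_k a_k (2 q_k - 1), and |2 q_k - 1| is at most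
  1.\<close>

lemma trace_norm_ge_test:
  assumes X: "X \<in> carrier_mat n n" "hermitian X" and tr: "Re (ctrace X) = 0" and E: "projector n E"
  shows "2 * Re (ctrace (E * X)) \<le> trace_norm X"
proof -
  obtain U a where sd: "spec_decomp X U a" using hermitian_spec_decomp_exists[OF X] by blast
  hence U: "unitary n U" using spec_decomp_iff[OF X(1)] by blast
  have s0: "(\<Sum>k<n. a k) = 0" using ctrace_eq_sum_spec[OF X(1) sd] tr by simp
  define q where "q k = Re ((adj U * E * U) $$ (k,k))" for k
  have q: "0 \<le> q k" "q k \<le> 1" if "k < n" for k
    using projector_conj_diag_bounds[OF E U that] by (auto simp: q_def)
  have "2 * Re (ctrace (E * X)) = (\<Sum>k<n. 2 * (a k * q k) - a k)"
    unfolding Re_ctrace_spec_decomp[OF X(1) projectorD(1)[OF E] sd] q_def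
    by (simp add: sum_subtractf s0 sum_distrib_left)
  also have "\<dots> \<le> (\<Sum>k<n. \<bar>a k\<bar>)"
  proof (rule sum_mono)
    fix k assume "k \<in> {..<n}"
    hence "\<bar>2 * q k - 1\<bar> \<le> 1" using q[of k] by auto
    hence "\<bar>a k * (2 * q k - 1)\<bar> \<le> \<bar>a k\<bar> * 1" unfolding abs_mult by (intro mult_left_mono) auto
    thus "2 * (a k * q k) - a k \<le> \<bar>a k\<bar>" by (simp add: algebra_simps)
  qed
  finally show ?thesis using trace_norm_spec[OF X(1) sd] by simp
qed

lemma trace_norm_nonneg:
  assumes X: "X \<in> carrier_mat n n" "hermitian X"
  shows "0 \<le> trace_norm X"
  using hermitian_spec_decomp_exists[OF X] trace_norm_spec[OF X(1)] by (auto intro: sum_nonneg)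

text \<open>A projector of small rank catches little of a spread-out state: eigenvalues above
  \<open>lam\<close> are given away in full, and the others cost at most \<open>lam\<close> for each
  of the at most \<open>D\<close> dimensions, since the weights q_k sum to the trace of P.\<close>

lemma projector_ctrace_le:
  assumes A: "A \<in> carrier_mat n n" "spec_decomp A U r" and r: "\<And>k. k < n \<Longrightarrow> 0 \<le> r k"
    and P: "projector n P" and D: "Re (ctrace P) \<le> D" and lam: "0 \<le> lam"
  shows "Re (ctrace (P * A)) \<le> (\<Sum>k\<in>{k. k < n \<and> r k > lam}. r k) + lam * D"
proof -
  have U: "unitary n U" using spec_decomp_iff[OF A(1)] A(2) by blast
  define q where "q k = Re ((adj U * P * U) $$ (k,k))" for k
  have q: "0 \<le> q k" "q k \<le> 1" if "k < n" for k
    using projector_conj_diag_bounds[OF P U that] by (auto simp: q_def)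
  have sq: "(\<Sum>k<n. q k) = Re (ctrace P)"
    using sum_conj_diag[OF U projectorD(1)[OF P]] unfolding q_def by (metis Re_sum)
  have "Re (ctrace (P * A)) = (\<Sum>k<n. r k * q k)"
    unfolding Re_ctrace_spec_decomp[OF A(1) projectorD(1)[OF P] A(2)] q_def ..
  also have "\<dots> \<le> (\<Sum>k<n. (if r k > lam then r k else 0) + lam * q k)"
  proof (rule sum_mono)
    fix k assume "k \<in> {..<n}"
    hence k: "k < n" by simp
    have "r k * q k \<le> r k" using q[OF k] r[OF k] by (simp add: mult_left_le)
    moreover have "0 \<le> lam * q k" using q[OF k] lam by simp
    moreover have "r k * q k \<le> lam * q k" if "\<not> r k > lam" using that q[OF k] by (intro mult_right_mono) auto
    ultimately show "r k * q k \<le> (if r k > lam then r k else 0) + lam * q k" by auto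
  qed
  also have "\<dots> = (\<Sum>k<n. if r k > lam then r k else 0) + lam * Re (ctrace P)"
    by (simp add: sum.distrib sum_distrib_left[symmetric] sq)
  also have "(\<Sum>k<n. if r k > lam then r k else 0) = (\<Sum>k\<in>{k. k < n \<and> r k > lam}. r k)"
    by (subst sum.inter_filter[symmetric]) (auto intro!: sum.cong)
  also have "lam * Re (ctrace P) \<le> lam * D" using D lam by (intro mult_left_mono)
  finally show ?thesis by simp
qed

text \<open>One Gram-Schmidt step: P' = P + r adj(r) / |r|^2, where r is the part of w orthogonal to
  the range of P. The clause on \<open>Q\<close> records that nothing outside the span of that range
  and w is added.\<close>

lemma projector_extend:
  assumes P: "projector n P" and w: "w \<in> carrier_mat n 1"
  shows "\<exists>P'. projector n P' \<and> Re (ctrace P') \<le> Re (ctrace P) + 1 \<and> P' * w = w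
     \<and> (\<forall>x \<in> carrier_mat n 1. P * x = x \<longrightarrow> P' * x = x)
     \<and> (\<forall>Q \<in> carrier_mat n n. Q * P = P \<longrightarrow> Q * w = w \<longrightarrow> Q * P' = P')"
proof -
  note Pc = projectorD[OF P]
  define r where "r = w - P * w"
  have r: "r \<in> carrier_mat n 1" using w Pc by (auto simp: r_def)
  define s where "s = (\<Sum>i<n. (cmod (r $$ (i,0)))\<^sup>2)"
  show ?thesis
  proof (cases "s = 0")
    \<comment> \<open>A zero residual means that w already lies in the range of P.\<close>
    case True
    hence "\<forall>i\<in>{..<n}. (cmod (r $$ (i,0)))\<^sup>2 = 0" unfolding s_def by (subst (asm) sum_nonneg_eq_0_iff) auto
    hence r0: "\<forall>i<n. r $$ (i,0) = 0" by auto
    have "P * w = w"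
    proof (rule eq_matI)
      fix i j assume "i < dim_row w" "j < dim_col w"
      hence ij: "i < n" "j = 0" using w by auto
      have "r $$ (i,0) = w $$ (i,0) - (P * w) $$ (i,0)" unfolding r_def
        by (rule index_minus_mat(1)) (use ij w Pc in auto)
      thus "(P * w) $$ (i,j) = w $$ (i,j)" using r0 ij by (simp del: index_mult_mat(1))
    qed (use w Pc in auto)
    thus ?thesis using P by (intro exI[of _ P]) auto
  next
    case False
    define c where "c = complex_of_real (1 / s)"
    define K where "K = r * adj r"
    have K: "K \<in> carrier_mat n n" using r by (auto simp: K_def)
    note dm = carrier_matD[OF r] carrier_matD[OF w] carrier_matD[OF Pc(1)]
    have "P * r = P * w - P * (P * w)" unfolding r_def
      by (rule mult_minus_distrib_mat) (use w Pc in auto)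
    also have "P * (P * w) = P * w" by (simp add: mat_assoc[symmetric] dm Pc)
    finally have Pr: "P * r = 0\<^sub>m n 1" using w Pc by auto
    have rP: "adj r * P = 0\<^sub>m 1 n"
    proof -
      have "adj r * P = adj (P * r)" using Pc r by (simp add: adj_mult[of P n n r 1])
      thus ?thesis unfolding Pr by (simp) (rule eq_matI; auto)
    qed
    have rr: "adj r * r = complex_of_real s \<cdot>\<^sub>m 1\<^sub>m 1"
    proof (rule eq_matI)
      fix i j assume "i < dim_row (complex_of_real s \<cdot>\<^sub>m 1\<^sub>m 1)" "j < dim_col (complex_of_real s \<cdot>\<^sub>m 1\<^sub>m 1)"
      hence ij: "i = 0" "j = 0" by auto
      have "(adj r * r) $$ (0,0) = (\<Sum>l<n. adj r $$ (0,l) * r $$ (l,0))"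
        by (rule mult_mat_index[of _ 1 n _ 1]) (use r in auto)
      also have "\<dots> = (\<Sum>l<n. complex_of_real ((cmod (r $$ (l,0)))\<^sup>2))"
        using r by (intro sum.cong) (auto simp: complex_norm_square mult.commute simp del: of_real_power)
      finally show "(adj r * r) $$ (i,j) = (complex_of_real s \<cdot>\<^sub>m 1\<^sub>m 1) $$ (i,j)"
        using ij by (simp add: s_def)
    qed (use r in auto)
    have Krx: "K * x = r * (adj r * x)" if "x \<in> carrier_mat n m" for x m
      using that r by (simp add: K_def mat_assoc)
    have aK: "adj K = K" using r by (simp add: K_def adj_mult[OF r adj_carrier[OF r]])
    have PK: "P * K = 0\<^sub>m n n" unfolding K_def using Pr r Pc by (simp add: mat_assoc[symmetric] dm)
    have KP: "K * P = 0\<^sub>m n n" unfolding K_def using rP r Pc by (simp add: mat_assoc dm)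
    have Kr: "K * r = complex_of_real s \<cdot>\<^sub>m r"
      unfolding Krx[OF r] rr using r by (simp add: mult_smult_distrib[of _ n 1 _ 1])
    have "K * K = K * r * adj r" using K r unfolding K_def by (simp add: mat_assoc)
    hence KK: "K * K = complex_of_real s \<cdot>\<^sub>m K"
      unfolding Kr using r by (simp add: mult_smult_assoc_mat[of _ n 1 _ n] K_def)
    define P' where "P' = P + c \<cdot>\<^sub>m K"
    have P': "P' \<in> carrier_mat n n" using K Pc by (auto simp: P'_def)
    have cK: "c \<cdot>\<^sub>m K \<in> carrier_mat n n" using K by auto
    have cc: "c * (c * complex_of_real s) = c" using False by (simp add: c_def)
    have P'x: "P' * x = P * x + c \<cdot>\<^sub>m (K * x)" if "x \<in> carrier_mat n m" for x m
      unfolding P'_def using that K Pc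
      by (simp add: add_mult_distrib_mat[of _ n n _ _ m] mult_smult_assoc_mat[of _ n n _ m])
    have "P' * P' = P * P' + c \<cdot>\<^sub>m (K * P')" by (rule P'x[OF P'])
    also have "P * P' = P" unfolding P'_def using Pc K PK
      by (simp add: mult_add_distrib_mat[of _ n n _ n] mult_smult_distrib[of _ n n _ n])
    also have "K * P' = c \<cdot>\<^sub>m (complex_of_real s \<cdot>\<^sub>m K)" unfolding P'_def using Pc K KP KK
      by (simp add: mult_add_distrib_mat[of _ n n _ n] mult_smult_distrib[of _ n n _ n])
    also have "c \<cdot>\<^sub>m (c \<cdot>\<^sub>m (complex_of_real s \<cdot>\<^sub>m K)) = c \<cdot>\<^sub>m K"
      by (rule eq_matI) (auto simp: cc[unfolded mult.assoc[symmetric]] mult.assoc[symmetric])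
    finally have "P' * P' = P'" unfolding P'_def .
    moreover have "adj P' = P'" unfolding P'_def
      by (subst adj_add[OF Pc(1) cK]) (simp add: Pc adj_smult aK c_def)
    ultimately have pr: "projector n P'" using P' by (auto simp: projector_def)
    have "ctrace K = ctrace (adj r * r)" unfolding K_def by (rule ctrace_comm) (use r in auto)
    hence "ctrace K = complex_of_real s" unfolding rr by (simp add: ctrace_def)
    hence "ctrace P' = ctrace P + 1" unfolding P'_def ctrace_add[OF Pc(1) cK] ctrace_smult[OF K]
      using False by (simp add: c_def)
    hence tr: "Re (ctrace P') \<le> Re (ctrace P) + 1" by simp
    have old: "P' * x = x" if x: "x \<in> carrier_mat n 1" "P * x = x" for x
    proof -
      have "adj r * x = adj r * (P * x)" using x by simp
      also have "\<dots> = (adj r * P) * x" using x by (simp add: mat_assoc dm)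
      also have "\<dots> = 0\<^sub>m 1 1" unfolding rP using x by simp
      finally have "K * x = 0\<^sub>m n 1" unfolding Krx[OF x(1)] using r by simp
      thus ?thesis unfolding P'x[OF x(1)] x(2) using x by auto
    qed
    have wdec: "w = P * w + r" using w Pc unfolding r_def
      by (intro eq_matI) (auto simp del: index_mult_mat(1) simp: index_mult_mat(2,3))
    have "P' * (P * w) = P * w" by (rule old) (use w Pc in \<open>auto simp: mat_assoc[symmetric] dm\<close>)
    moreover have "P' * r = r"
      unfolding P'x[OF r] Pr Kr using r False by (intro eq_matI) (auto simp: c_def)
    moreover have "P' * (P * w + r) = P' * (P * w) + P' * r"
      by (rule mult_add_distrib_mat) (use P' Pc w r in auto)
    ultimately have neww: "P' * w = w" using wdec by metis
    have "Q * P' = P'" if Q: "Q \<in> carrier_mat n n" "Q * P = P" "Q * w = w" for Q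
    proof -
      have "Q * r = Q * w - Q * (P * w)" unfolding r_def
        by (rule mult_minus_distrib_mat) (use w Pc Q in auto)
      also have "Q * (P * w) = P * w" using Q by (simp add: mat_assoc[symmetric] dm)
      finally have "Q * r = r" using Q by (simp add: r_def)
      hence "Q * K = K" unfolding K_def using Q by (simp add: mat_assoc[symmetric] dm)
      thus ?thesis unfolding P'_def using Q K Pc
        by (simp add: mult_add_distrib_mat[of _ n n _ n] mult_smult_distrib[of _ n n _ n])
    qed
    thus ?thesis using pr tr neww old by blast
  qed
qed

text \<open>The trace bound is the dimension count. The last clause expresses minimality: any matrix
  that fixes all of \<open>S\<close> fixes the range of P. In the converse it yields P <= Q for a
  projector Q fixing \<open>S\<close>.\<close>

lemma span_projector_exists:
  assumes "finite S" "S \<subseteq> carrier_mat n 1"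
  shows "\<exists>P. projector n P \<and> Re (ctrace P) \<le> real (card S) \<and> (\<forall>w\<in>S. P * w = w)
     \<and> (\<forall>Q \<in> carrier_mat n n. (\<forall>w\<in>S. Q * w = w) \<longrightarrow> Q * P = P)"
  using assms
proof (induction S)
  case empty
  have "adj (0\<^sub>m n n) = 0\<^sub>m n n" by (rule eq_matI) auto
  thus ?case by (intro exI[of _ "0\<^sub>m n n"]) (auto simp: projector_def ctrace_def)
next
  case (insert w S)
  then obtain P where P: "projector n P" "Re (ctrace P) \<le> real (card S)" "\<forall>w\<in>S. P * w = w"
    "\<forall>Q \<in> carrier_mat n n. (\<forall>w\<in>S. Q * w = w) \<longrightarrow> Q * P = P" by blast
  obtain P' where P': "projector n P'" "Re (ctrace P') \<le> Re (ctrace P) + 1" "P' * w = w"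
     "\<forall>x \<in> carrier_mat n 1. P * x = x \<longrightarrow> P' * x = x"
     "\<forall>Q \<in> carrier_mat n n. Q * P = P \<longrightarrow> Q * w = w \<longrightarrow> Q * P' = P'"
    using projector_extend[OF P(1), of w] insert.prems by auto
  show ?case
    by (rule exI[of _ P']) (use P P' insert in auto)
qed

text \<open>Taking adjoints in Q P = P gives P Q = P as well, and the square of Q - P
  collapses.\<close>

lemma projector_minus:
  assumes Q: "projector n Q" and P: "projector n P" and QP: "Q * P = P"
  shows "projector n (Q - P)"
proof -
  note c = projectorD[OF Q] projectorD[OF P]
  have "adj (Q * P) = adj P" using QP by simp
  hence PQ: "P * Q = P" using c by (simp add: adj_mult[of Q n n P n])
  have "(Q - P) * (Q - P) = (Q * Q - P * Q) - (Q * P - P * P)"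
    using c by (simp add: mult_minus_dim minus_mult_dim right_mult_one_mat')
  also have "\<dots> = Q - P" unfolding QP PQ c using c by (intro eq_matI) auto
  finally show ?thesis using c by (auto simp: projector_def adj_minus[of _ n n])
qed

subsection \<open>Tensor powers and large deviations\<close>

lemma sum_div_mod:
  fixes f :: "nat \<Rightarrow> nat \<Rightarrow> 'a::comm_monoid_add"
  shows "(\<Sum>i<a * b. f (i div b) (i mod b)) = (\<Sum>i<a. \<Sum>j<b. f i j)"
proof -
  have "(\<Sum>i<a * b. f (i div b) (i mod b)) = (\<Sum>m<a. \<Sum>i\<in>{m*b..<m*b+b}. f (i div b) (i mod b))"
    by (rule sum.nat_group[symmetric])
  also have "\<dots> = (\<Sum>m<a. \<Sum>j<b. f m j)"
  proof (rule sum.cong[OF refl])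
    fix m
    have "(\<Sum>i\<in>{m*b..<m*b+b}. f (i div b) (i mod b)) = (\<Sum>j\<in>{0..<b}. f ((j + m*b) div b) ((j + m*b) mod b))"
      using sum.shift_bounds_nat_ivl[of "\<lambda>i. f (i div b) (i mod b)" 0 "m*b" b] by (simp add: add.commute)
    also have "\<dots> = (\<Sum>j<b. f m j)" by (auto simp: atLeast0LessThan intro!: sum.cong)
    finally show "(\<Sum>i\<in>{m*b..<m*b+b}. f (i div b) (i mod b)) = (\<Sum>j<b. f m j)" .
  qed
  finally show ?thesis .
qed

lemma kron_dim[simp]: "dim_row (kron A B) = dim_row A * dim_row B" "dim_col (kron A B) = dim_col A * dim_col B"
  by (auto simp: kron_def)

lemma kron_carrier[simp]:
  "A \<in> carrier_mat a b \<Longrightarrow> B \<in> carrier_mat c e \<Longrightarrow> kron A B \<in> carrier_mat (a * c) (b * e)"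
  by (auto simp: kron_def)

lemma kron_index:
  "A \<in> carrier_mat a b \<Longrightarrow> B \<in> carrier_mat c e \<Longrightarrow> i < a * c \<Longrightarrow> j < b * e \<Longrightarrow>
   kron A B $$ (i,j) = A $$ (i div c, j div e) * B $$ (i mod c, j mod e)"
  by (auto simp: kron_def)

lemma div_mod_less:
  assumes "(i::nat) < a * c"
  shows "i div c < a" "i mod c < c"
  using assms by (auto simp: less_mult_imp_div_less intro!: mod_less_divisor gr0I)

lemma kron_mult:
  assumes A: "A \<in> carrier_mat a b" and B: "B \<in> carrier_mat c e"
    and C: "C \<in> carrier_mat b f" and D: "D \<in> carrier_mat e g"
  shows "kron A B * kron C D = kron (A * C) (B * D)"
proof (rule eq_matI)
  fix i j assume "i < dim_row (kron (A * C) (B * D))" "j < dim_col (kron (A * C) (B * D))"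
  hence i: "i < a * c" and j: "j < f * g" using assms by auto
  note i' = div_mod_less[OF i] and j' = div_mod_less[OF j]
  have "(kron A B * kron C D) $$ (i,j) = (\<Sum>l<b * e. kron A B $$ (i,l) * kron C D $$ (l,j))"
    by (rule mult_mat_index) (use assms i j in auto)
  also have "\<dots> = (\<Sum>l<b * e. (A $$ (i div c, l div e) * B $$ (i mod c, l mod e)) *
      (C $$ (l div e, j div g) * D $$ (l mod e, j mod g)))"
    using i j by (intro sum.cong refl) (simp add: kron_index[OF A B] kron_index[OF C D])
  also have "\<dots> = (\<Sum>l<b. \<Sum>m<e. (A $$ (i div c, l) * B $$ (i mod c, m)) *
      (C $$ (l, j div g) * D $$ (m, j mod g)))"
    by (rule sum_div_mod)
  also have "\<dots> = (\<Sum>l<b. A $$ (i div c, l) * C $$ (l, j div g)) * (\<Sum>m<e. B $$ (i mod c, m) * D $$ (m, j mod g))"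
    by (simp add: sum_product mult_ac)
  also have "\<dots> = (A * C) $$ (i div c, j div g) * (B * D) $$ (i mod c, j mod g)"
    by (simp only: mult_mat_index[OF A C i'(1) j'(1)] mult_mat_index[OF B D i'(2) j'(2)])
  also have "\<dots> = kron (A * C) (B * D) $$ (i,j)"
    by (rule kron_index[symmetric, of _ a f _ c g]) (use assms i j in auto)
  finally show "(kron A B * kron C D) $$ (i,j) = kron (A * C) (B * D) $$ (i,j)" .
qed (use assms in auto)

lemma adj_kron: "adj (kron A B) = kron (adj A) (adj B)"
proof (rule eq_matI)
  fix i j assume "i < dim_row (kron (adj A) (adj B))" "j < dim_col (kron (adj A) (adj B))"
  hence i: "i < dim_col A * dim_col B" and j: "j < dim_row A * dim_row B" by auto
  show "adj (kron A B) $$ (i,j) = kron (adj A) (adj B) $$ (i,j)"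
    using i j div_mod_less[OF i] div_mod_less[OF j] by (simp add: kron_def)
qed auto

lemma kron_mat_diag:
  "kron (mat_diag a f) (mat_diag b g) = mat_diag (a * b) (\<lambda>i. f (i div b) * g (i mod b))"
proof (rule eq_matI)
  fix i j assume "i < dim_row (mat_diag (a * b) (\<lambda>i. f (i div b) * g (i mod b)))"
    "j < dim_col (mat_diag (a * b) (\<lambda>i. f (i div b) * g (i mod b)))"
  hence i: "i < a * b" and j: "j < a * b" by auto
  have "i = j" if "i div b = j div b" "i mod b = j mod b" using that by (metis div_mult_mod_eq)
  thus "kron (mat_diag a f) (mat_diag b g) $$ (i,j) = mat_diag (a * b) (\<lambda>i. f (i div b) * g (i mod b)) $$ (i,j)"
    using i j div_mod_less[OF i] div_mod_less[OF j] by (auto simp: kron_def mat_diag_def)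
qed auto

lemma kron_one: "kron (1\<^sub>m a) (1\<^sub>m b) = 1\<^sub>m (a * b)"
  using kron_mat_diag[of a "\<lambda>_. 1" b "\<lambda>_. 1"] by simp

lemma tensor_word_Nil[simp]: "tensor_word W [] = 1\<^sub>m 1"
  by (simp add: tensor_word_def)

lemma tensor_word_Cons[simp]: "tensor_word W (x # xs) = kron (W x) (tensor_word W xs)"
  by (simp add: tensor_word_def)

lemma tensor_word_carrier[simp]:
  "(\<And>x. W x \<in> carrier_mat d d) \<Longrightarrow> tensor_word W xs \<in> carrier_mat (d ^ length xs) (d ^ length xs)"
  by (induction xs) auto

lemma tensor_word_mult:
  assumes "\<And>x. A x \<in> carrier_mat d d" "\<And>x. B x \<in> carrier_mat d d"
  shows "tensor_word A xs * tensor_word B xs = tensor_word (\<lambda>x. A x * B x) xs"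
proof (induction xs)
  case (Cons x xs)
  show ?case using assms tensor_word_carrier[of A d xs] tensor_word_carrier[of B d xs]
    by (simp add: kron_mult[of _ d d _ "d ^ length xs" "d ^ length xs" _ d _ "d ^ length xs"] Cons)
qed simp

lemma tensor_word_adj: "adj (tensor_word A xs) = tensor_word (\<lambda>x. adj (A x)) xs"
  by (induction xs) (auto simp: adj_kron)

lemma tensor_word_one: "tensor_word (\<lambda>x. 1\<^sub>m d) xs = 1\<^sub>m (d ^ length xs)"
  by (induction xs) (auto simp: kron_one)

text \<open>A number below \<open>d ^ length xs\<close> is read as the word of its base-\<open>d\<close> digits, most significant
  first, matching the index convention of \<^const>\<open>kron\<close>.\<close>

fun tprod :: "nat \<Rightarrow> ('x \<Rightarrow> nat \<Rightarrow> 'a::comm_monoid_mult) \<Rightarrow> 'x list \<Rightarrow> nat \<Rightarrow> 'a" where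
  "tprod d f [] i = 1"
| "tprod d f (x # xs) i = f x (i div d ^ length xs) * tprod d f xs (i mod d ^ length xs)"

text \<open>The eigenvalues of a sum of one-site observables in a product basis. For positive
  factors it is the logarithm of a \<open>tprod\<close>, so one tail bound serves both additive
  observables and eigenvalue sizes.\<close>

fun tsum :: "nat \<Rightarrow> ('x \<Rightarrow> nat \<Rightarrow> real) \<Rightarrow> 'x list \<Rightarrow> nat \<Rightarrow> real" where
  "tsum d f [] i = 0"
| "tsum d f (x # xs) i = f x (i div d ^ length xs) + tsum d f xs (i mod d ^ length xs)"

lemma of_real_tprod: "complex_of_real (tprod d f xs i) = tprod d (\<lambda>x i. complex_of_real (f x i)) xs i"
  by (induction xs arbitrary: i) auto

lemma tensor_word_mat_diag:
  "tensor_word (\<lambda>x. mat_diag d (f x)) xs = mat_diag (d ^ length xs) (tprod d f xs)"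
  by (induction xs) (auto simp: kron_mat_diag)

lemma unitary_tensor_word:
  assumes "\<And>x. unitary d (U x)"
  shows "unitary (d ^ length xs) (tensor_word U xs)"
proof (rule unitaryI)
  have c: "U x \<in> carrier_mat d d" for x using unitaryD(1)[OF assms] .
  show "tensor_word U xs \<in> carrier_mat (d ^ length xs) (d ^ length xs)" using c by simp
  show "adj (tensor_word U xs) * tensor_word U xs = 1\<^sub>m (d ^ length xs)"
    unfolding tensor_word_adj using c
    by (simp add: tensor_word_mult[of _ d] unitaryD(3)[OF assms] tensor_word_one)
qed

lemma spec_decomp_tensor_word:
  assumes c: "\<And>x. W x \<in> carrier_mat d d" and sd: "\<And>x. spec_decomp (W x) (U x) (mu x)"
  shows "spec_decomp (tensor_word W xs) (tensor_word U xs) (tprod d mu xs)"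
proof -
  have U: "unitary d (U x)" and W: "W x = U x * mat_diag d (\<lambda>i. complex_of_real (mu x i)) * adj (U x)" for x
    using sd[of x] spec_decomp_iff[OF c] by auto
  note cU = unitaryD(1)[OF U]
  have UD: "U x * mat_diag d (\<lambda>i. complex_of_real (mu x i)) \<in> carrier_mat d d" for x
    using cU[of x] by auto
  have "tensor_word W xs = tensor_word (\<lambda>x. U x * mat_diag d (\<lambda>i. complex_of_real (mu x i)) * adj (U x)) xs"
    using W by presburger
  also have "\<dots> = tensor_word U xs * mat_diag (d ^ length xs) (tprod d (\<lambda>x i. complex_of_real (mu x i)) xs)
      * adj (tensor_word U xs)"
    unfolding tensor_word_adj tensor_word_mat_diag[symmetric]
    using cU UD by (simp add: tensor_word_mult[of _ d])
  finally show ?thesis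
    unfolding spec_decomp_iff[OF tensor_word_carrier[OF c]]
    using unitary_tensor_word[OF U] by (simp add: of_real_tprod)
qed

text \<open>Diagonal entries of a Kronecker product involve only diagonal entries of the factors, so
  \<open>A\<close> itself need not be diagonal. Measuring a product state in a product basis
  therefore gives a product distribution.\<close>

lemma tensor_word_diag:
  assumes "\<And>x. A x \<in> carrier_mat d d"
    and "\<And>x i. i < d \<Longrightarrow> A x $$ (i,i) = complex_of_real (a x i)" and "k < d ^ length xs"
  shows "tensor_word A xs $$ (k,k) = complex_of_real (tprod d a xs k)"
  using assms(3)
proof (induction xs arbitrary: k)
  case (Cons x xs)
  hence k: "k < d * d ^ length xs" by simp
  show ?case using assms(1) k div_mod_less[OF k]
    by (simp add: kron_index[of _ d d _ "d ^ length xs" "d ^ length xs"] assms(2) Cons.IH)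
qed simp

lemma sum_tprod:
  fixes f :: "'x \<Rightarrow> nat \<Rightarrow> 'a::comm_semiring_1"
  shows "(\<Sum>k<d ^ length xs. tprod d f xs k) = (\<Prod>x\<leftarrow>xs. \<Sum>i<d. f x i)"
proof (induction xs)
  case (Cons x xs)
  have "(\<Sum>k<d ^ length (x # xs). tprod d f (x # xs) k)
    = (\<Sum>k<d * d ^ length xs. f x (k div d ^ length xs) * tprod d f xs (k mod d ^ length xs))" by simp
  also have "\<dots> = (\<Sum>i<d. \<Sum>j<d ^ length xs. f x i * tprod d f xs j)"
    by (rule sum_div_mod[of "\<lambda>i j. f x i * tprod d f xs j"])
  also have "\<dots> = (\<Sum>i<d. f x i) * (\<Sum>j<d ^ length xs. tprod d f xs j)" by (simp add: sum_product)
  finally show ?case using Cons by simp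
qed simp

lemma tprod_nonneg:
  fixes f :: "'x \<Rightarrow> nat \<Rightarrow> real"
  assumes "\<And>x i. i < d \<Longrightarrow> 0 \<le> f x i" "k < d ^ length xs"
  shows "0 \<le> tprod d f xs k"
  using assms(2)
proof (induction xs arbitrary: k)
  case (Cons x xs)
  hence k: "k < d * d ^ length xs" by simp
  show ?case using div_mod_less[OF k] assms(1) Cons.IH by simp
qed simp

lemma tprod_mult_exp:
  "tprod d p xs k * exp (s * tsum d al xs k) = tprod d (\<lambda>x i. p x i * exp (s * al x i)) xs k"
  by (induction xs arbitrary: k) (auto simp: distrib_left exp_add mult_ac)

lemma tsum_uminus: "tsum d (\<lambda>x i. - f x i) xs k = - tsum d f xs k"
  by (induction xs arbitrary: k) auto

lemma log_tprod:
  assumes "\<And>x i. i < d \<Longrightarrow> 0 \<le> f x i" "k < d ^ length xs" "tprod d f xs k > 0"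
  shows "log 2 (tprod d f xs k) = tsum d (\<lambda>x i. log 2 (f x i)) xs k"
  using assms(2,3)
proof (induction xs arbitrary: k)
  case (Cons x xs)
  hence k: "k < d * d ^ length xs" by simp
  note k' = div_mod_less[OF k]
  have "f x (k div d ^ length xs) > 0 \<and> tprod d f xs (k mod d ^ length xs) > 0"
    using Cons.prems(2) assms(1)[OF k'(1), of x] by (auto simp: zero_less_mult_iff)
  thus ?case using Cons.IH[OF k'(2)] by (simp add: log_mult)
qed simp

section \<open>Exponential moments and Chernoff bounds\<close>

text \<open>For |y| <= 1 one has e^y <= 1 + y + y^2; averaging this over p and using 1 + u <= e^u
  turns the second-order bound back into an exponential.\<close>

lemma exp_moment_le:
  fixes p al :: "'a \<Rightarrow> real"
  assumes "finite S" "\<And>i. i \<in> S \<Longrightarrow> 0 \<le> p i" "(\<Sum>i\<in>S. p i) = 1"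
    and "\<And>i. i \<in> S \<Longrightarrow> \<bar>al i\<bar> \<le> B" "0 \<le> s" "s * B \<le> 1"
  shows "(\<Sum>i\<in>S. p i * exp (s * al i)) \<le> exp (s * (\<Sum>i\<in>S. p i * al i) + s\<^sup>2 * B\<^sup>2)"
proof -
  have "p i * exp (s * al i) \<le> p i * (1 + s * al i + s\<^sup>2 * B\<^sup>2)" if "i \<in> S" for i
  proof (rule mult_left_mono)
    have "\<bar>s * al i\<bar> \<le> s * B" unfolding abs_mult using assms(4)[OF that] assms(5) by (simp add: mult_left_mono)
    hence le1: "\<bar>s * al i\<bar> \<le> 1" and "\<bar>s * al i\<bar>\<^sup>2 \<le> (s * B)\<^sup>2"
      using assms(6) power_mono[of "\<bar>s * al i\<bar>" "s * B" 2] by auto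
    hence sq: "(s * al i)\<^sup>2 \<le> s\<^sup>2 * B\<^sup>2" by (simp add: power_mult_distrib)
    have "exp (s * al i) \<le> 1 + s * al i + (s * al i)\<^sup>2"
    proof (cases "0 \<le> s * al i")
      case True
      thus ?thesis using exp_bound[of "s * al i"] le1 by auto
    next
      case False
      \<comment> \<open>A negative exponent is handled by inversion: e^y >= 1 + y + y^2/2, and (1 -
        y + y^2)(1 + y + y^2/2) >= 1.\<close>
      define y where "y = - (s * al i)"
      have y: "0 \<le> y" "y \<le> 1" using False le1 by (auto simp: y_def)
      have "1 + y + y\<^sup>2/2 \<le> exp y" by (rule exp_lower_Taylor_quadratic[OF y(1)])
      moreover have "0 < 1 + y + y\<^sup>2/2" using y by (simp add: add_pos_nonneg)
      ultimately have "exp (- y) \<le> 1 / (1 + y + y\<^sup>2/2)"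
        by (simp add: exp_minus divide_simps)
      also have "\<dots> \<le> 1 - y + y\<^sup>2"
      proof -
        have "(1 - y + y\<^sup>2) * (1 + y + y\<^sup>2/2) = 1 + y\<^sup>2 / 2 * (1 + y + y\<^sup>2)"
          by (simp add: field_simps power2_eq_square)
        moreover have "0 \<le> y\<^sup>2 / 2 * (1 + y + y\<^sup>2)" using y by simp
        ultimately show ?thesis using \<open>0 < 1 + y + y\<^sup>2/2\<close> by (simp add: divide_le_eq)
      qed
      finally show ?thesis by (simp add: y_def)
    qed
    thus "exp (s * al i) \<le> 1 + s * al i + s\<^sup>2 * B\<^sup>2" using sq by simp
  qed (use assms(2) that in auto)
  hence "(\<Sum>i\<in>S. p i * exp (s * al i)) \<le> (\<Sum>i\<in>S. p i * (1 + s * al i + s\<^sup>2 * B\<^sup>2))" by (rule sum_mono)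
  also have "\<dots> = (\<Sum>i\<in>S. p i) + s * (\<Sum>i\<in>S. p i * al i) + (\<Sum>i\<in>S. p i) * (s\<^sup>2 * B\<^sup>2)"
    by (simp add: distrib_left sum.distrib sum_distrib_left sum_distrib_right mult_ac)
  also have "\<dots> = 1 + (s * (\<Sum>i\<in>S. p i * al i) + s\<^sup>2 * B\<^sup>2)" using assms(3) by simp
  also have "\<dots> \<le> exp (s * (\<Sum>i\<in>S. p i * al i) + s\<^sup>2 * B\<^sup>2)" by (rule exp_ge_add_one_self)
  finally show ?thesis .
qed

text \<open>Markov's inequality for the exponential of \<open>tsum\<close>, whose expectation
  factorises over the letters of the word.\<close>

lemma tprod_markov:
  assumes "\<And>x i. i < d \<Longrightarrow> 0 \<le> p x i" "0 \<le> s"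
  shows "(\<Sum>k\<in>{k. k < d ^ length xs \<and> T \<le> tsum d al xs k}. tprod d p xs k)
     \<le> exp (- s * T) * (\<Prod>x\<leftarrow>xs. \<Sum>i<d. p x i * exp (s * al x i))"
proof -
  have "(\<Sum>k\<in>{k. k < d ^ length xs \<and> T \<le> tsum d al xs k}. tprod d p xs k)
    \<le> (\<Sum>k\<in>{k. k < d ^ length xs \<and> T \<le> tsum d al xs k}. exp (- s * T) * (tprod d p xs k * exp (s * tsum d al xs k)))"
  proof (rule sum_mono)
    fix k assume k: "k \<in> {k. k < d ^ length xs \<and> T \<le> tsum d al xs k}"
    hence "s * T \<le> s * tsum d al xs k" using assms(2) by (auto intro: mult_left_mono)
    hence "1 \<le> exp (- s * T) * exp (s * tsum d al xs k)" by (simp flip: exp_add)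
    hence "tprod d p xs k * 1 \<le> tprod d p xs k * (exp (- s * T) * exp (s * tsum d al xs k))"
      using k by (intro mult_left_mono tprod_nonneg assms) auto
    thus "tprod d p xs k \<le> exp (- s * T) * (tprod d p xs k * exp (s * tsum d al xs k))"
      by (simp add: mult_ac)
  qed
  also have "\<dots> \<le> (\<Sum>k<d ^ length xs. exp (- s * T) * (tprod d p xs k * exp (s * tsum d al xs k)))"
    by (rule sum_mono2) (auto intro!: mult_nonneg_nonneg tprod_nonneg assms)
  also have "\<dots> = exp (- s * T) * (\<Sum>k<d ^ length xs. tprod d (\<lambda>x i. p x i * exp (s * al x i)) xs k)"
    by (simp add: sum_distrib_left tprod_mult_exp)
  finally show ?thesis unfolding sum_tprod .
qed

text \<open>The choice s = \<open>\<delta>\<close>/(2 B^2) minimises s^2 B^2 - s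
  \<open>\<delta>\<close>, with minimum -\<open>\<delta>\<close>^2/(4 B^2). The condition
  \<open>\<delta> \<le> B\<close> keeps s B below 1, as the moment bound requires. The word is fixed
  and each letter may have its own distribution.\<close>

lemma chernoff_tprod:
  assumes p: "\<And>x i. i < d \<Longrightarrow> 0 \<le> p x i" "\<And>x. (\<Sum>i<d. p x i) = 1"
    and al: "\<And>x i. i < d \<Longrightarrow> \<bar>al x i\<bar> \<le> B" and B: "0 < \<delta>" "\<delta> \<le> B"
    and T: "(\<Sum>x\<leftarrow>xs. \<Sum>i<d. p x i * al x i) + real (length xs) * \<delta> \<le> T"
  shows "(\<Sum>k\<in>{k. k < d ^ length xs \<and> T \<le> tsum d al xs k}. tprod d p xs k)
     \<le> exp (- (\<delta>\<^sup>2 / (4 * B\<^sup>2)) * real (length xs))"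
proof -
  define s where "s = \<delta> / (2 * B\<^sup>2)"
  define m where "m x = (\<Sum>i<d. p x i * al x i)" for x
  have s: "0 \<le> s" using B by (simp add: s_def)
  have "s * B = \<delta> / (2 * B)" using B by (simp add: s_def power2_eq_square)
  hence sB: "s * B \<le> 1" using B by simp
  have "(\<Prod>x\<leftarrow>xs. \<Sum>i<d. p x i * exp (s * al x i)) \<le> exp (s * (\<Sum>x\<leftarrow>xs. m x) + real (length xs) * (s\<^sup>2 * B\<^sup>2))"
  proof (induction xs)
    case (Cons x xs)
    have "(\<Sum>i<d. p x i * exp (s * al x i)) \<le> exp (s * m x + s\<^sup>2 * B\<^sup>2)"
      unfolding m_def by (rule exp_moment_le) (use p al s sB in auto)
    moreover have "0 \<le> (\<Prod>x\<leftarrow>xs. \<Sum>i<d. p x i * exp (s * al x i))"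
      by (rule prod_list_nonneg) (auto intro!: sum_nonneg mult_nonneg_nonneg p)
    ultimately have "(\<Sum>i<d. p x i * exp (s * al x i)) * (\<Prod>x\<leftarrow>xs. \<Sum>i<d. p x i * exp (s * al x i))
      \<le> exp (s * m x + s\<^sup>2 * B\<^sup>2) * exp (s * (\<Sum>x\<leftarrow>xs. m x) + real (length xs) * (s\<^sup>2 * B\<^sup>2))"
      using Cons by (intro mult_mono) auto
    thus ?case by (simp add: algebra_simps flip: exp_add)
  qed simp
  hence "(\<Sum>k\<in>{k. k < d ^ length xs \<and> T \<le> tsum d al xs k}. tprod d p xs k)
     \<le> exp (- s * T) * exp (s * (\<Sum>x\<leftarrow>xs. m x) + real (length xs) * (s\<^sup>2 * B\<^sup>2))"
    using tprod_markov[of d p s xs T al] p s by (meson exp_ge_zero mult_left_mono order_trans)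
  also have "\<dots> = exp (s * ((\<Sum>x\<leftarrow>xs. m x) - T) + real (length xs) * (s\<^sup>2 * B\<^sup>2))"
    by (simp add: algebra_simps flip: exp_add)
  also have "\<dots> \<le> exp (s * (- (real (length xs) * \<delta>)) + real (length xs) * (s\<^sup>2 * B\<^sup>2))"
    using T s unfolding m_def by (intro exp_le_cancel_iff[THEN iffD2] add_right_mono mult_left_mono) auto
  also have "s * (- (real (length xs) * \<delta>)) + real (length xs) * (s\<^sup>2 * B\<^sup>2) = - (\<delta>\<^sup>2 / (4 * B\<^sup>2)) * real (length xs)"
    using B by (simp add: s_def power2_eq_square field_simps)
  finally show ?thesis .
qed

section \<open>Random words with independent letters\<close>

lemma finite_words[simp]: "finite (words n :: 'x::finite list set)"
  unfolding words_def using finite_lists_length_eq[of "UNIV :: 'x set" n] by simp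

lemma words_0[simp]: "words 0 = {[]}"
  by (auto simp: words_def)

lemma sum_words_Suc:
  fixes f :: "'x::finite list \<Rightarrow> 'a::comm_monoid_add"
  shows "(\<Sum>xs\<in>words (Suc n). f xs) = (\<Sum>x\<in>UNIV. \<Sum>xs\<in>words n. f (x # xs))"
proof -
  have "bij_betw (\<lambda>(x,xs). x # xs) (UNIV \<times> words n) (words (Suc n) :: 'x list set)"
    by (rule bij_betwI[of _ _ _ "\<lambda>xs. (hd xs, tl xs)"]) (auto simp: words_def length_Suc_conv)
  from sum.reindex_bij_betw[OF this, of f] show ?thesis
    by (simp add: sum.cartesian_product case_prod_unfold)
qed

lemma iid_Cons: "iid p (Suc n) (x # xs) = p x * iid p n xs"
  by (simp add: iid_def)

lemma sum_iid_prod_list: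
  fixes q g :: "'x::finite \<Rightarrow> real"
  shows "(\<Sum>xs\<in>words n. iid q n xs * (\<Prod>x\<leftarrow>xs. g x)) = (\<Sum>x\<in>UNIV. q x * g x) ^ n"
proof (induction n)
  case 0
  show ?case by (simp add: iid_def)
next
  case (Suc n)
  have "(\<Sum>xs\<in>words (Suc n). iid q (Suc n) xs * (\<Prod>x\<leftarrow>xs. g x))
     = (\<Sum>x\<in>UNIV. \<Sum>xs\<in>words n. (q x * g x) * (iid q n xs * (\<Prod>x\<leftarrow>xs. g x)))"
    by (simp add: sum_words_Suc iid_Cons mult_ac)
  thus ?case by (simp add: sum_product[symmetric] Suc)
qed

lemma prob_dist_n_iid:
  assumes "prob_dist p"
  shows "prob_dist_n n (iid p n)"
proof -
  have "0 \<le> iid p n xs" for xs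
    using assms by (auto simp: iid_def prob_dist_def intro!: prod_list_nonneg)
  moreover have "iid p n xs = 0" if "xs \<notin> words n" for xs using that by (auto simp: iid_def words_def)
  moreover have "(\<Sum>xs\<in>words n. iid p n xs) = 1"
    using sum_iid_prod_list[of p n "\<lambda>_. 1"] assms by (simp add: prob_dist_def map_replicate_const)
  ultimately show ?thesis by (auto simp: prob_dist_n_def)
qed

text \<open>Here the word is random too: letter x and index i have joint law q(x) p(x,i), so the
  threshold refers to the mean over both. A fixed word need not have letter frequencies close to q,
  hence \<open>chernoff_tprod\<close> cannot replace this.\<close>

lemma chernoff_iid_tprod:
  fixes q :: "'x::finite \<Rightarrow> real"
  assumes q: "prob_dist q" and p: "\<And>x i. i < d \<Longrightarrow> 0 \<le> p x i" "\<And>x. (\<Sum>i<d. p x i) = 1"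
    and al: "\<And>x i. i < d \<Longrightarrow> \<bar>al x i\<bar> \<le> B" and B: "0 < \<delta>" "\<delta> \<le> B"
    and T: "real n * ((\<Sum>x\<in>UNIV. q x * (\<Sum>i<d. p x i * al x i)) + \<delta>) \<le> T"
  shows "(\<Sum>xs\<in>words n. iid q n xs * (\<Sum>k\<in>{k. k < d ^ n \<and> T \<le> tsum d al xs k}. tprod d p xs k))
     \<le> exp (- (\<delta>\<^sup>2 / (4 * B\<^sup>2)) * real n)"
proof -
  define s where "s = \<delta> / (2 * B\<^sup>2)"
  define e where "e = (\<Sum>x\<in>UNIV. q x * (\<Sum>i<d. p x i * al x i))"
  have s: "0 \<le> s" using B by (simp add: s_def)
  have "s * B = \<delta> / (2 * B)" using B by (simp add: s_def power2_eq_square)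
  hence sB: "s * B \<le> 1" using B by simp
  define g where "g x = (\<Sum>i<d. p x i * exp (s * al x i))" for x
  have "(\<Sum>x\<in>UNIV. q x * g x) = (\<Sum>z\<in>UNIV \<times> {..<d}. (q (fst z) * p (fst z) (snd z)) * exp (s * al (fst z) (snd z)))"
    by (simp add: g_def sum_distrib_left sum.cartesian_product case_prod_unfold mult_ac)
  also have "\<dots> \<le> exp (s * (\<Sum>z\<in>UNIV \<times> {..<d}. (q (fst z) * p (fst z) (snd z)) * al (fst z) (snd z)) + s\<^sup>2 * B\<^sup>2)"
  proof (rule exp_moment_le)
    have "(\<Sum>z\<in>UNIV \<times> {..<d}. q (fst z) * p (fst z) (snd z)) = (\<Sum>x\<in>UNIV. q x * (\<Sum>i<d. p x i))"
      by (simp add: sum_distrib_left sum.cartesian_product case_prod_unfold)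
    thus "(\<Sum>z\<in>UNIV \<times> {..<d}. q (fst z) * p (fst z) (snd z)) = 1" using q p by (simp add: prob_dist_def)
  qed (use q p al s sB in \<open>auto simp: prob_dist_def\<close>)
  also have "(\<Sum>z\<in>UNIV \<times> {..<d}. (q (fst z) * p (fst z) (snd z)) * al (fst z) (snd z)) = e"
    by (simp add: e_def sum_distrib_left sum.cartesian_product case_prod_unfold mult_ac)
  finally have g: "(\<Sum>x\<in>UNIV. q x * g x) \<le> exp (s * e + s\<^sup>2 * B\<^sup>2)" .
  have g0: "0 \<le> g x" for x unfolding g_def by (auto intro!: sum_nonneg mult_nonneg_nonneg p)
  have "(\<Sum>xs\<in>words n. iid q n xs * (\<Sum>k\<in>{k. k < d ^ n \<and> T \<le> tsum d al xs k}. tprod d p xs k))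
    \<le> (\<Sum>xs\<in>words n. iid q n xs * (exp (- s * T) * (\<Prod>x\<leftarrow>xs. g x)))"
  proof (intro sum_mono mult_left_mono)
    fix xs :: "'x list" assume "xs \<in> words n"
    hence n: "n = length xs" by (simp add: words_def)
    show "(\<Sum>k\<in>{k. k < d ^ n \<and> T \<le> tsum d al xs k}. tprod d p xs k) \<le> exp (- s * T) * (\<Prod>x\<leftarrow>xs. g x)"
      unfolding n g_def by (rule tprod_markov) (use p s in auto)
  qed (use prob_dist_n_iid[OF q, of n] in \<open>auto simp: prob_dist_n_def\<close>)
  also have "\<dots> = exp (- s * T) * (\<Sum>xs\<in>words n. iid q n xs * (\<Prod>x\<leftarrow>xs. g x))"
    by (simp add: sum_distrib_left mult_ac)
  also have "\<dots> = exp (- s * T) * (\<Sum>x\<in>UNIV. q x * g x) ^ n" by (simp add: sum_iid_prod_list)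
  also have "\<dots> \<le> exp (- s * T) * exp (s * e + s\<^sup>2 * B\<^sup>2) ^ n"
    by (intro mult_left_mono power_mono g sum_nonneg mult_nonneg_nonneg g0) (use q in \<open>auto simp: prob_dist_def\<close>)
  also have "\<dots> = exp (s * (real n * e - T) + real n * (s\<^sup>2 * B\<^sup>2))"
    by (simp add: algebra_simps flip: exp_add exp_of_nat_mult)
  also have "\<dots> \<le> exp (s * (- (real n * \<delta>)) + real n * (s\<^sup>2 * B\<^sup>2))"
    using T s unfolding e_def[symmetric]
    by (intro exp_le_cancel_iff[THEN iffD2] add_right_mono mult_left_mono) (auto simp: algebra_simps)
  also have "s * (- (real n * \<delta>)) + real n * (s\<^sup>2 * B\<^sup>2) = - (\<delta>\<^sup>2 / (4 * B\<^sup>2)) * real n"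
    using B by (simp add: s_def power2_eq_square field_simps)
  finally show ?thesis .
qed

text \<open>The target state is the tensor power of W(q) and depends on q only through W(q). The
  power is written as the tensor word of a constant family along any word \<open>ys\<close> of
  length n, so that every lemma on tensor words applies to it.\<close>

lemma avg_state_n_iid:
  fixes W :: "'x::finite \<Rightarrow> complex mat"
  assumes W: "\<And>x. W x \<in> carrier_mat d d"
  shows "length ys = n \<Longrightarrow> avg_state_n d n W (iid q n) = tensor_word (\<lambda>_. avg_state d W q) ys"
proof (induction n arbitrary: ys)
  case 0
  thus ?case by (intro eq_matI) (auto simp: avg_state_n_def iid_def)
next
  case (Suc n)
  then obtain y ys' where ys: "ys = y # ys'" "length ys' = n" by (cases ys) auto
  note IH = Suc.IH[OF ys(2)]
  have A: "avg_state d W q \<in> carrier_mat d d" by (simp add: avg_state_def)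
  have T: "tensor_word (\<lambda>_. avg_state d W q) ys' \<in> carrier_mat (d ^ n) (d ^ n)"
    using tensor_word_carrier[of "\<lambda>_. avg_state d W q" d ys'] A ys by simp
  show ?case
  proof (rule eq_matI)
    fix i j assume "i < dim_row (tensor_word (\<lambda>_. avg_state d W q) ys)" "j < dim_col (tensor_word (\<lambda>_. avg_state d W q) ys)"
    hence i: "i < d * d ^ n" and j: "j < d * d ^ n" using A T ys by auto
    note i' = div_mod_less[OF i] and j' = div_mod_less[OF j]
    have "avg_state_n d (Suc n) W (iid q (Suc n)) $$ (i,j)
      = (\<Sum>x\<in>UNIV. \<Sum>xs\<in>words n. complex_of_real (q x * iid q n xs) * kron (W x) (tensor_word W xs) $$ (i,j))"
      using i j by (simp add: avg_state_n_def sum_words_Suc iid_Cons)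
    also have "\<dots> = (\<Sum>x\<in>UNIV. \<Sum>xs\<in>words n. (complex_of_real (q x) * W x $$ (i div d ^ n, j div d ^ n)) *
       (complex_of_real (iid q n xs) * tensor_word W xs $$ (i mod d ^ n, j mod d ^ n)))"
    proof (intro sum.cong refl)
      fix x and xs :: "'x list" assume "xs \<in> words n"
      hence "tensor_word W xs \<in> carrier_mat (d ^ n) (d ^ n)" using tensor_word_carrier[of W d xs] W by (simp add: words_def)
      thus "complex_of_real (q x * iid q n xs) * kron (W x) (tensor_word W xs) $$ (i,j) =
       (complex_of_real (q x) * W x $$ (i div d ^ n, j div d ^ n)) *
       (complex_of_real (iid q n xs) * tensor_word W xs $$ (i mod d ^ n, j mod d ^ n))"
        using i j by (simp add: kron_index[OF W])
    qed
    also have "\<dots> = avg_state d W q $$ (i div d ^ n, j div d ^ n) *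
        avg_state_n d n W (iid q n) $$ (i mod d ^ n, j mod d ^ n)"
      using i' j' by (simp add: sum_product avg_state_def avg_state_n_def)
    also have "\<dots> = tensor_word (\<lambda>_. avg_state d W q) ys $$ (i,j)"
      using i j by (simp add: IH ys kron_index[OF A T])
    finally show "avg_state_n d (Suc n) W (iid q (Suc n)) $$ (i,j) = tensor_word (\<lambda>_. avg_state d W q) ys $$ (i,j)" .
  qed (use A T ys in \<open>auto simp: avg_state_n_def\<close>)
qed

subsection \<open>Duality for linear programs on the simplex\<close>

text \<open>The cube of functions into [0,1] is compact for the product topology by Tychonoff, and
  the normalisation cuts out a closed part of it.\<close>

lemma compact_prob_dist: "compact {q :: 'x::finite \<Rightarrow> real. prob_dist q}"
proof -
  have "compactin (product_topology (\<lambda>_::'x. euclidean :: real topology) UNIV) (PiE UNIV (\<lambda>_. {0..1}))"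
    unfolding compactin_PiE by simp
  hence c: "compact (PiE UNIV (\<lambda>_::'x. {0..1::real}))"
    by (simp add: euclidean_product_topology)
  have "closed {q :: 'x \<Rightarrow> real. (\<Sum>x\<in>UNIV. q x) = 1}"
    by (intro closed_Collect_eq continuous_intros) simp_all
  hence "compact (PiE UNIV (\<lambda>_::'x. {0..1::real}) \<inter> {q. (\<Sum>x\<in>UNIV. q x) = 1})"
    by (rule compact_Int_closed[OF c])
  also have "PiE UNIV (\<lambda>_::'x. {0..1::real}) \<inter> {q. (\<Sum>x\<in>UNIV. q x) = 1} = {q. prob_dist q}"
  proof -
    have "q x \<le> 1" if "\<forall>x. 0 \<le> q x" "(\<Sum>x\<in>UNIV. q x) = 1" for q :: "'x \<Rightarrow> real" and x
      using member_le_sum[of x UNIV q] that by auto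
    thus ?thesis by (auto simp: prob_dist_def PiE_def)
  qed
  finally show ?thesis .
qed

text \<open>First-order optimality at the left endpoint: divide by s and let s tend to 0.\<close>

lemma linear_coeff_nonneg:
  fixes a b :: real
  assumes "\<And>s. 0 < s \<Longrightarrow> s \<le> 1 \<Longrightarrow> 0 \<le> s * a + s\<^sup>2 * b"
  shows "0 \<le> a"
proof (rule ccontr)
  assume "\<not> 0 \<le> a"
  hence a: "a < 0" by simp
  \<comment> \<open>Small enough that s |b| <= -a/2, so the quadratic term cannot make up for a
    negative linear one.\<close>
  define s where "s = min 1 (- a / (2 * (\<bar>b\<bar> + 1)))"
  have s: "0 < s" "s \<le> 1" using a divide_pos_pos[of "- a" "2 * (\<bar>b\<bar> + 1)"] unfolding s_def by simp_all
  have "s \<le> - a / (2 * (\<bar>b\<bar> + 1))" by (simp add: s_def)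
  hence sb: "s * (2 * (\<bar>b\<bar> + 1)) \<le> - a" by (subst (asm) pos_le_divide_eq) auto
  have "0 \<le> s * (a + s * b)" using assms[OF s] by (simp add: power2_eq_square algebra_simps)
  hence "0 \<le> a + s * b" using s by (simp add: zero_le_mult_iff)
  moreover have "s * b \<le> s * \<bar>b\<bar>" using s by (intro mult_left_mono) auto
  moreover have "s * \<bar>b\<bar> * 2 \<le> - a" using sb s by (simp add: algebra_simps)
  ultimately show False using a by linarith
qed

text \<open>Approximate strong duality for the linear program \<open>max \<Sum> q c\<close> subject to \<open>\<Sum> q w = t\<close> over
  the simplex. The multiplier \<open>y\<close> is read off the optimality condition of the problem in which
  the constraint is replaced by a quadratic penalty.\<close>

lemma simplex_lp_duality:
  fixes c p :: "'x::finite \<Rightarrow> real" and w :: "'x \<Rightarrow> 'i \<Rightarrow> complex" and t :: "'i \<Rightarrow> complex"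
  assumes I: "finite I" and p: "prob_dist p" "\<And>i. i \<in> I \<Longrightarrow> (\<Sum>x\<in>UNIV. complex_of_real (p x) * w x i) = t i"
    and v: "\<And>q. prob_dist q \<Longrightarrow> (\<And>i. i \<in> I \<Longrightarrow> (\<Sum>x\<in>UNIV. complex_of_real (q x) * w x i) = t i)
      \<Longrightarrow> (\<Sum>x\<in>UNIV. q x * c x) \<le> v"
    and \<delta>: "0 < \<delta>"
  shows "\<exists>y y0. (\<forall>x. c x + (\<Sum>i\<in>I. Re (cnj (y i) * w x i)) + y0 \<le> 0) \<and>
     - v - \<delta> \<le> (\<Sum>i\<in>I. Re (cnj (y i) * t i)) + y0"
proof -
  define C where "C q = (\<Sum>x\<in>UNIV. q x * c x)" for q
  define m where "m q i = (\<Sum>x\<in>UNIV. complex_of_real (q x) * w x i)" for q :: "'x \<Rightarrow> real" and i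
  define G where "G q = (\<Sum>i\<in>I. (cmod (m q i - t i))\<^sup>2)" for q
  let ?K = "{q :: 'x \<Rightarrow> real. prob_dist q}"
  have contC: "continuous_on UNIV C" unfolding C_def by (intro continuous_intros) simp_all
  have contG: "continuous_on UNIV G" unfolding G_def m_def by (intro continuous_intros) simp_all
  have cont: "continuous_on S C" "continuous_on S G" for S
    using contC contG by (auto intro: continuous_on_subset)
  \<comment> \<open>No point of \<open>K'\<close> satisfies the constraint, since its objective
    exceeds v. By compactness the squared violation \<open>G\<close> has a positive lower bound g on
    \<open>K'\<close>.\<close>
  define K' where "K' = ?K \<inter> {q. v + \<delta> \<le> C q}"
  have cK': "compact K'" unfolding K'_def
    by (intro compact_Int_closed compact_prob_dist closed_Collect_le continuous_intros contC)
  have "\<exists>g>0. \<forall>q\<in>K'. g \<le> G q"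
  proof (cases "K' = {}")
    case True
    thus ?thesis by (intro exI[of _ 1]) auto
  next
    case False
    obtain q0 where q0: "q0 \<in> K'" "\<And>q. q \<in> K' \<Longrightarrow> G q0 \<le> G q"
      using continuous_attains_inf[OF cK' False cont(2)] by blast
    have "G q0 \<noteq> 0"
    proof
      assume "G q0 = 0"
      hence "\<forall>i\<in>I. (cmod (m q0 i - t i))\<^sup>2 = 0" unfolding G_def using I
        by (subst (asm) sum_nonneg_eq_0_iff) auto
      hence "\<forall>i\<in>I. m q0 i = t i" by auto
      hence "C q0 \<le> v" unfolding C_def by (intro v) (use q0 in \<open>auto simp: K'_def m_def\<close>)
      thus False using q0(1) \<delta> by (auto simp: K'_def)
    qed
    moreover have "0 \<le> G q0" unfolding G_def by (intro sum_nonneg) auto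
    ultimately show ?thesis using q0 by (intro exI[of _ "G q0"]) auto
  qed
  then obtain g where g: "0 < g" "\<And>q. q \<in> K' \<Longrightarrow> g \<le> G q" by blast
  define S where "S = (\<Sum>x\<in>UNIV. \<bar>c x\<bar>)"
  \<comment> \<open>With this penalty weight a point of \<open>K'\<close> pays at least
    \<open>S + \<bar>C p\<bar> + 1\<close>, more than any gain in the objective compared with the
    feasible p. Hence the penalised minimiser stays outside \<open>K'\<close>.\<close>
  define L where "L = 2 * (S + \<bar>C p\<bar> + 1) / g"
  have S0: "0 \<le> S" unfolding S_def by (intro sum_nonneg) auto
  have L: "0 < L" using g(1) S0 by (simp add: L_def divide_pos_pos add_nonneg_pos)
  have Lg: "L / 2 * g = S + \<bar>C p\<bar> + 1" using g(1) by (simp add: L_def)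
  define F where "F q = - C q + L / 2 * G q" for q
  have "continuous_on ?K F" unfolding F_def by (intro continuous_intros cont)
  then obtain q where q: "prob_dist q" "\<And>q'. prob_dist q' \<Longrightarrow> F q \<le> F q'"
    using continuous_attains_inf[OF compact_prob_dist, of F] p(1) by blast
  have Gp: "G p = 0" unfolding G_def m_def using p(2) by simp
  have Cle: "C q \<le> S"
  proof -
    have "q x \<le> 1" for x using q(1) member_le_sum[of x UNIV q] by (auto simp: prob_dist_def)
    hence "q x * \<bar>c x\<bar> \<le> \<bar>c x\<bar>" "q x * c x \<le> q x * \<bar>c x\<bar>" for x
      using q(1) by (auto simp: prob_dist_def intro: mult_left_le_one_le mult_left_mono)
    from order_trans[OF this(2) this(1)] have "q x * c x \<le> \<bar>c x\<bar>" for x .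
    thus ?thesis unfolding C_def S_def by (intro sum_mono)
  qed
  have Cq: "C q < v + \<delta>"
  proof (rule ccontr)
    assume "\<not> C q < v + \<delta>"
    hence "q \<in> K'" using q(1) by (auto simp: K'_def)
    hence "L / 2 * g \<le> L / 2 * G q" using g(2) L by (intro mult_left_mono) auto
    hence "F q \<ge> - S + (S + \<bar>C p\<bar> + 1)" unfolding F_def using Lg Cle by linarith
    moreover have "F p = - C p" by (simp add: F_def Gp)
    ultimately show False using q(2)[OF p(1)] by linarith
  qed
  define D where "D i = m q i - t i" for i
  have opt: "c x - C q - L * (\<Sum>i\<in>I. Re (cnj (D i) * (w x i - m q i))) \<le> 0" for x
  proof -
    define a where "a = - (c x - C q) + L * (\<Sum>i\<in>I. Re (cnj (D i) * (w x i - m q i)))"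
    define b where "b = L / 2 * (\<Sum>i\<in>I. (cmod (w x i - m q i))\<^sup>2)"
    have "0 \<le> a"
    proof (rule linear_coeff_nonneg[of a b])
      fix s :: real assume s: "0 < s" "s \<le> 1"
      \<comment> \<open>The competitor moves a fraction s of the mass of q to the vertex x; along
        this segment the penalised objective is quadratic in s.\<close>
      define q' where "q' z = (1 - s) * q z + s * (if z = x then 1 else 0)" for z
      have "(\<Sum>z\<in>UNIV. q' z) = (1 - s) * (\<Sum>z\<in>UNIV. q z) + s * (\<Sum>z\<in>UNIV. if z = x then 1 else 0)"
        unfolding q'_def by (simp add: sum.distrib flip: sum_distrib_left)
      hence pq': "prob_dist q'" using q(1) s unfolding prob_dist_def by (auto simp: q'_def)
      have Cq': "C q' = C q + s * (c x - C q)"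
      proof -
        have "C q' = (\<Sum>z\<in>UNIV. (1 - s) * (q z * c z) + s * (if z = x then c x else 0))"
          unfolding C_def q'_def by (intro sum.cong) (auto simp: algebra_simps)
        also have "\<dots> = (1 - s) * C q + s * c x" by (simp add: sum.distrib C_def flip: sum_distrib_left)
        finally show ?thesis by (simp add: algebra_simps)
      qed
      have mq': "m q' i - t i = D i + complex_of_real s * (w x i - m q i)" for i
      proof -
        have "m q' i = (\<Sum>z\<in>UNIV. (1 - complex_of_real s) * (complex_of_real (q z) * w z i) + complex_of_real s * (if z = x then w x i else 0))"
          unfolding m_def q'_def by (intro sum.cong) (auto simp: algebra_simps)
        also have "\<dots> = (1 - complex_of_real s) * m q i + complex_of_real s * w x i"
          by (simp add: sum.distrib m_def flip: sum_distrib_left)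
        finally show ?thesis by (simp add: D_def algebra_simps)
      qed
      have sq: "(cmod (A + complex_of_real s * B))\<^sup>2 = (cmod A)\<^sup>2 + s * (2 * Re (cnj A * B)) + s\<^sup>2 * (cmod B)\<^sup>2" for A B
        unfolding cmod_power2 by (simp add: power2_eq_square algebra_simps)
      have "G q' = G q + s * (2 * (\<Sum>i\<in>I. Re (cnj (D i) * (w x i - m q i)))) + s\<^sup>2 * (\<Sum>i\<in>I. (cmod (w x i - m q i))\<^sup>2)"
        unfolding G_def mq' sq by (simp add: sum.distrib sum_distrib_left D_def)
      hence "F q' = F q + (s * a + s\<^sup>2 * b)" unfolding F_def Cq' a_def b_def by (simp add: algebra_simps)
      thus "0 \<le> s * a + s\<^sup>2 * b" using q(2)[OF pq'] by linarith
    qed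
    thus ?thesis by (simp add: a_def)
  qed
  \<comment> \<open>The multiplier is minus the penalty weight times the residual; \<open>y0\<close>
    collects the constants left in \<open>opt\<close>.\<close>
  define y where "y i = - complex_of_real L * D i" for i
  define y0 where "y0 = - C q + L * (\<Sum>i\<in>I. Re (cnj (D i) * m q i))"
  have ysum: "(\<Sum>i\<in>I. Re (cnj (y i) * z i)) = - L * (\<Sum>i\<in>I. Re (cnj (D i) * z i))" for z
    unfolding y_def sum_distrib_left by (intro sum.cong) (auto simp: algebra_simps)
  have "c x + (\<Sum>i\<in>I. Re (cnj (y i) * w x i)) + y0 \<le> 0" for x
  proof -
    have "(\<Sum>i\<in>I. Re (cnj (D i) * (w x i - m q i))) = (\<Sum>i\<in>I. Re (cnj (D i) * w x i)) - (\<Sum>i\<in>I. Re (cnj (D i) * m q i))"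
      unfolding sum_subtractf[symmetric] by (intro sum.cong) (auto simp: algebra_simps)
    from opt[of x, unfolded this] show ?thesis unfolding ysum y0_def by (simp add: right_diff_distrib[of L])
  qed
  moreover have "- v - \<delta> \<le> (\<Sum>i\<in>I. Re (cnj (y i) * t i)) + y0"
  proof -
    \<comment> \<open>The dual value is -C(q) + L sum |D_i|^2, so the residual only helps and C(q) <
      v + \<open>\<delta>\<close> suffices.\<close>
    have "(\<Sum>i\<in>I. Re (cnj (D i) * m q i)) - (\<Sum>i\<in>I. Re (cnj (D i) * t i)) = (\<Sum>i\<in>I. (cmod (D i))\<^sup>2)"
      unfolding sum_subtractf[symmetric] cmod_power2
      by (intro sum.cong) (auto simp: D_def algebra_simps power2_eq_square)
    moreover have "0 \<le> (\<Sum>i\<in>I. (cmod (D i))\<^sup>2)" by (intro sum_nonneg) auto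
    ultimately have "0 \<le> L * ((\<Sum>i\<in>I. Re (cnj (D i) * m q i)) - (\<Sum>i\<in>I. Re (cnj (D i) * t i)))"
      using L by simp
    thus ?thesis using Cq unfolding ysum y0_def right_diff_distrib by linarith
  qed
  ultimately show ?thesis by blast
qed

subsection \<open>Entropy and mutual information\<close>

definition vn_entropy :: "complex mat \<Rightarrow> real" where
  "vn_entropy A = - Re (ctrace (A * mat_log A))"

lemma conj_diag_entry:
  assumes U: "U \<in> carrier_mat n n" and A: "A \<in> carrier_mat n n" and k: "k < n"
  shows "(adj U * A * U) $$ (k,k) = (\<Sum>i<n. \<Sum>j<n. cnj (U $$ (i,k)) * A $$ (i,j) * U $$ (j,k))"
proof -
  have "(adj U * A * U) $$ (k,k) = (\<Sum>j<n. (adj U * A) $$ (k,j) * U $$ (j,k))"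
    by (rule mult_mat_index) (use assms in auto)
  also have "\<dots> = (\<Sum>j<n. (\<Sum>i<n. adj U $$ (k,i) * A $$ (i,j)) * U $$ (j,k))"
    using assms by (intro sum.cong refl) (subst mult_mat_index[of _ n n _ n], auto)
  also have "\<dots> = (\<Sum>j<n. \<Sum>i<n. cnj (U $$ (i,k)) * A $$ (i,j) * U $$ (j,k))"
    using assms by (auto simp: sum_distrib_right intro!: sum.cong)
  finally show ?thesis by (subst (asm) sum.swap)
qed

lemma spec_decomp_conj:
  assumes "A \<in> carrier_mat n n" "spec_decomp A U r"
  shows "adj U * A * U = mat_diag n (\<lambda>i. complex_of_real (r i))"
proof -
  have U: "unitary n U" and A: "A = U * mat_diag n (\<lambda>i. complex_of_real (r i)) * adj U"
    using assms by (auto simp: spec_decomp_iff)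
  show ?thesis unfolding A
    by (simp add: mat_assoc unitary_dim[OF U] unitary_cancel[OF U] unitaryD[OF U] right_mult_one_mat')
qed

lemma psd_conj_diag_nonneg:
  assumes A: "A \<in> carrier_mat n n" "psd A" and U: "U \<in> carrier_mat n n" and k: "k < n"
  shows "0 \<le> Re ((adj U * A * U) $$ (k,k))"
proof -
  have "0 \<le> Re (\<Sum>i<n. \<Sum>j<n. cnj (col U k $ i) * A $$ (i,j) * col U k $ j)"
  proof -
    have "\<forall>v\<in>carrier_vec n. 0 \<le> Re (\<Sum>i<n. \<Sum>j<n. cnj (v $ i) * A $$ (i,j) * v $ j)"
      using A unfolding psd_def by auto
    from bspec[OF this, of "col U k"] show ?thesis using U by auto
  qed
  also have "(\<Sum>i<n. \<Sum>j<n. cnj (col U k $ i) * A $$ (i,j) * col U k $ j) = (adj U * A * U) $$ (k,k)"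
    unfolding conj_diag_entry[OF U A(1) k] using U k by (intro sum.cong) auto
  finally show ?thesis .
qed

lemma density_spec_decomp:
  assumes "density d \<rho>"
  shows "\<exists>U r. spec_decomp \<rho> U r \<and> (\<forall>k<d. 0 \<le> r k) \<and> (\<Sum>k<d. r k) = 1"
proof -
  have A: "\<rho> \<in> carrier_mat d d" "psd \<rho>" and tr: "ctrace \<rho> = 1" using assms by (auto simp: density_def)
  obtain U r where sd: "spec_decomp \<rho> U r"
    using hermitian_spec_decomp_exists[OF A(1)] A(2) by (auto simp: psd_def)
  hence U: "unitary d U" using spec_decomp_iff[OF A(1)] by blast
  have "0 \<le> r k" if "k < d" for k
    using psd_conj_diag_nonneg[OF A unitaryD(1)[OF U] that] that
    unfolding spec_decomp_conj[OF A(1) sd] by (simp add: mat_diag_def)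
  moreover have "(\<Sum>k<d. r k) = 1"
    using ctrace_eq_sum_spec[OF A(1) sd] unfolding tr by (metis of_real_eq_1_iff)
  ultimately show ?thesis using sd by blast
qed

text \<open>Since \<open>ln 0 = 0\<close>, the cutoff at 0 in \<open>mat_log\<close> agrees with
  \<open>log 2\<close> on nonnegative eigenvalues, and later formulas carry no case distinction. It
  also makes all eigenvalue logarithms bounded, zero eigenvalues included.\<close>

lemma mat_log_spec:
  assumes "A \<in> carrier_mat n n" "spec_decomp A U r" "\<And>k. k < n \<Longrightarrow> 0 \<le> r k"
  shows "spec_decomp (mat_log A) U (\<lambda>k. log 2 (r k))" "mat_log A \<in> carrier_mat n n"
proof -
  have U: "unitary n U" using spec_decomp_iff[OF assms(1)] assms(2) by blast
  have e: "mat_log A = U * mat_diag n (\<lambda>i. complex_of_real (if r i > 0 then log 2 (r i) else 0)) * adj U"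
    unfolding mat_log_def by (rule mat_fun_spec[OF assms(1,2)])
  have "mat_diag n (\<lambda>i. complex_of_real (if r i > 0 then log 2 (r i) else 0)) = mat_diag n (\<lambda>i. complex_of_real (log 2 (r i)))"
    using assms(3) by (intro eq_matI) (auto simp: mat_diag_def log_def not_less dest: order_antisym)
  note e' = e[unfolded this]
  show c: "mat_log A \<in> carrier_mat n n" unfolding e using unitaryD(1)[OF U] by auto
  show "spec_decomp (mat_log A) U (\<lambda>k. log 2 (r k))"
    unfolding spec_decomp_iff[OF c] using U e' by simp
qed

lemma vn_entropy_spec:
  assumes A: "A \<in> carrier_mat n n" "spec_decomp A U r" and r: "\<And>k. k < n \<Longrightarrow> 0 \<le> r k"
  shows "vn_entropy A = - (\<Sum>k<n. r k * log 2 (r k))"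
proof -
  have "Re (ctrace (A * mat_log A)) = (\<Sum>k<n. log 2 (r k) * Re ((adj U * A * U) $$ (k,k)))"
    by (rule Re_ctrace_spec_decomp[OF mat_log_spec(2)[OF assms] A(1) mat_log_spec(1)[OF assms]])
  also have "\<dots> = (\<Sum>k<n. r k * log 2 (r k))"
    unfolding spec_decomp_conj[OF A] by (intro sum.cong) (auto simp: mat_diag_def)
  finally show ?thesis by (simp add: vn_entropy_def)
qed

section \<open>Averages over the input letter: linearity, positivity and support\<close>

lemma avg_state_carrier[simp]: "avg_state d W q \<in> carrier_mat d d"
  by (simp add: avg_state_def)

lemma avg_state_entry: "i < d \<Longrightarrow> j < d \<Longrightarrow> avg_state d W q $$ (i,j) = (\<Sum>x\<in>UNIV. complex_of_real (q x) * W x $$ (i,j))"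
  by (simp add: avg_state_def)

lemma ctrace_mult_avg_state:
  assumes "\<And>x. W x \<in> carrier_mat d d" "L \<in> carrier_mat d d"
  shows "ctrace (L * avg_state d W q) = (\<Sum>x\<in>UNIV. complex_of_real (q x) * ctrace (L * W x))"
proof -
  have "ctrace (L * avg_state d W q) = (\<Sum>i<d. \<Sum>j<d. \<Sum>x\<in>UNIV. complex_of_real (q x) * (L $$ (i,j) * W x $$ (j,i)))"
    unfolding ctrace_mult_entries[OF assms(2) avg_state_carrier]
    by (intro sum.cong refl) (simp add: avg_state_entry sum_distrib_left mult_ac)
  also have "\<dots> = (\<Sum>i<d. \<Sum>x\<in>UNIV. \<Sum>j<d. complex_of_real (q x) * (L $$ (i,j) * W x $$ (j,i)))"
    by (intro sum.cong refl) (rule sum.swap)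
  also have "\<dots> = (\<Sum>x\<in>UNIV. \<Sum>i<d. \<Sum>j<d. complex_of_real (q x) * (L $$ (i,j) * W x $$ (j,i)))"
    by (rule sum.swap)
  also have "\<dots> = (\<Sum>x\<in>UNIV. complex_of_real (q x) * ctrace (L * W x))"
    by (simp add: ctrace_mult_entries[OF assms(2,1)] sum_distrib_left)
  finally show ?thesis .
qed

lemma quadform_avg_state:
  "(\<Sum>i<d. \<Sum>j<d. cnj (v i) * avg_state d W q $$ (i,j) * v j)
   = (\<Sum>x\<in>UNIV. complex_of_real (q x) * (\<Sum>i<d. \<Sum>j<d. cnj (v i) * W x $$ (i,j) * v j))"
proof -
  have "(\<Sum>i<d. \<Sum>j<d. cnj (v i) * avg_state d W q $$ (i,j) * v j)
    = (\<Sum>i<d. \<Sum>j<d. \<Sum>x\<in>UNIV. complex_of_real (q x) * (cnj (v i) * W x $$ (i,j) * v j))"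
    by (intro sum.cong refl) (simp add: avg_state_entry sum_distrib_left sum_distrib_right mult_ac)
  also have "\<dots> = (\<Sum>i<d. \<Sum>x\<in>UNIV. \<Sum>j<d. complex_of_real (q x) * (cnj (v i) * W x $$ (i,j) * v j))"
    by (intro sum.cong refl) (rule sum.swap)
  also have "\<dots> = (\<Sum>x\<in>UNIV. \<Sum>i<d. \<Sum>j<d. complex_of_real (q x) * (cnj (v i) * W x $$ (i,j) * v j))"
    by (rule sum.swap)
  finally show ?thesis by (simp add: sum_distrib_left)
qed

lemma density_avg_state:
  assumes W: "cq_channel d W" and q: "prob_dist q"
  shows "density d (avg_state d W q)"
proof -
  have D: "W x \<in> carrier_mat d d" "psd (W x)" "ctrace (W x) = 1" for x
    using W by (auto simp: cq_channel_def density_def)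
  have h: "hermitian (avg_state d W q)"
  proof (rule hermitianI[OF avg_state_carrier], rule eq_matI)
    fix i j assume "i < dim_row (avg_state d W q)" "j < dim_col (avg_state d W q)"
    hence ij: "i < d" "j < d" by (auto simp: avg_state_def)
    have "cnj (W x $$ (j,i)) = W x $$ (i,j)" for x
      using hermitian_entry[OF _ D(1), of x i j] D(2)[of x] ij by (simp add: psd_def)
    thus "adj (avg_state d W q) $$ (i,j) = avg_state d W q $$ (i,j)"
      using ij avg_state_carrier[of d W q] by (simp add: avg_state_def)
  qed (auto simp: avg_state_def)
  have "0 \<le> Re (\<Sum>i<d. \<Sum>j<d. cnj (v $ i) * avg_state d W q $$ (i,j) * v $ j)" if "v \<in> carrier_vec d" for v
  proof -
    have "0 \<le> Re (\<Sum>i<d. \<Sum>j<d. cnj (v $ i) * W x $$ (i,j) * v $ j)" for x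
      using D(2)[of x] that D(1)[of x] by (auto simp: psd_def)
    hence "0 \<le> (\<Sum>x\<in>UNIV. q x * Re (\<Sum>i<d. \<Sum>j<d. cnj (v $ i) * W x $$ (i,j) * v $ j))"
      using q unfolding prob_dist_def by (intro sum_nonneg mult_nonneg_nonneg) auto
    thus ?thesis unfolding quadform_avg_state by (subst Re_sum) simp
  qed
  moreover have "ctrace (avg_state d W q) = 1"
  proof -
    have "ctrace (1\<^sub>m d * avg_state d W q) = (\<Sum>x\<in>UNIV. complex_of_real (q x) * ctrace (1\<^sub>m d * W x))"
      by (rule ctrace_mult_avg_state) (use D in auto)
    also have "\<dots> = complex_of_real (\<Sum>x\<in>UNIV. q x)"
      using D by (simp add: left_mult_one_mat[of _ d d])
    also have "(\<Sum>x\<in>UNIV. q x) = 1" using q by (simp add: prob_dist_def)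
    finally show ?thesis by (simp add: left_mult_one_mat[of _ d d])
  qed
  moreover have "dim_row (avg_state d W q) = d" by (simp add: avg_state_def)
  ultimately show ?thesis using h by (auto simp: density_def psd_def simp del: Re_sum)
qed

lemma quadform_spec:
  assumes A: "A \<in> carrier_mat n n" "spec_decomp A U r"
  shows "(\<Sum>i<n. \<Sum>j<n. cnj (v i) * A $$ (i,j) * v j)
    = complex_of_real (\<Sum>k<n. r k * (cmod (\<Sum>i<n. cnj (U $$ (i,k)) * v i))\<^sup>2)"
proof -
  have "(\<Sum>i<n. \<Sum>j<n. cnj (v i) * A $$ (i,j) * v j)
    = (\<Sum>i<n. \<Sum>j<n. \<Sum>k<n. complex_of_real (r k) * ((cnj (v i) * U $$ (i,k)) * (cnj (U $$ (j,k)) * v j)))"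
    by (intro sum.cong refl) (simp add: spec_decomp_entry[OF A] sum_distrib_left sum_distrib_right mult_ac)
  also have "\<dots> = (\<Sum>i<n. \<Sum>k<n. \<Sum>j<n. complex_of_real (r k) * ((cnj (v i) * U $$ (i,k)) * (cnj (U $$ (j,k)) * v j)))"
    by (rule sum.cong[OF refl], rule sum.swap)
  also have "\<dots> = (\<Sum>k<n. \<Sum>i<n. \<Sum>j<n. complex_of_real (r k) * ((cnj (v i) * U $$ (i,k)) * (cnj (U $$ (j,k)) * v j)))"
    by (rule sum.swap)
  also have "\<dots> = (\<Sum>k<n. complex_of_real (r k) * (cnj (\<Sum>i<n. cnj (U $$ (i,k)) * v i) * (\<Sum>j<n. cnj (U $$ (j,k)) * v j)))"
    by (simp add: sum_product sum_distrib_left mult_ac)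
  also have "\<dots> = (\<Sum>k<n. complex_of_real (r k * (cmod (\<Sum>i<n. cnj (U $$ (i,k)) * v i))\<^sup>2))"
    by (intro sum.cong refl) (simp add: complex_norm_square mult.commute del: of_real_power cnj_sum)
  finally show ?thesis by simp
qed

lemma spec_mult_vec:
  assumes A: "A \<in> carrier_mat n n" "spec_decomp A U r" and i: "i < n"
  shows "(\<Sum>j<n. A $$ (i,j) * v j) = (\<Sum>k<n. U $$ (i,k) * (complex_of_real (r k) * (\<Sum>j<n. cnj (U $$ (j,k)) * v j)))"
proof -
  have "(\<Sum>j<n. A $$ (i,j) * v j) = (\<Sum>j<n. \<Sum>k<n. complex_of_real (r k) * U $$ (i,k) * cnj (U $$ (j,k)) * v j)"
    using i by (intro sum.cong refl) (simp add: spec_decomp_entry[OF A] sum_distrib_right)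
  also have "\<dots> = (\<Sum>k<n. \<Sum>j<n. complex_of_real (r k) * U $$ (i,k) * cnj (U $$ (j,k)) * v j)"
    by (rule sum.swap)
  finally show ?thesis by (simp add: sum_distrib_left mult_ac)
qed

lemma mult_mat_vec_entry:
  "A \<in> carrier_mat n n \<Longrightarrow> v \<in> carrier_vec n \<Longrightarrow> i < n \<Longrightarrow> (A *\<^sub>v v) $ i = (\<Sum>j<n. A $$ (i,j) * v $ j)"
  by (auto simp: mult_mat_vec_def scalar_prod_def atLeast0LessThan intro!: sum.cong)

text \<open>If W(q) v = 0, then the sum of q(x) <v, W_x v> vanishes, so each nonnegative term does.
  In the spectral decomposition of W_x a vanishing quadratic form forces W_x v = 0.\<close>

lemma supp_le_avg_state:
  assumes W: "cq_channel d W" and q: "prob_dist q" and x: "0 < q x"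
  shows "supp_le (W x) (avg_state d W q)"
  unfolding supp_le_def
proof (intro ballI impI)
  have D: "density d (W x)" "W x \<in> carrier_mat d d" "psd (W x)" for x
    using W by (auto simp: cq_channel_def density_def)
  fix v assume v: "v \<in> carrier_vec (dim_col (avg_state d W q))"
    and 0: "avg_state d W q *\<^sub>v v = 0\<^sub>v (dim_row (avg_state d W q))"
  have v: "v \<in> carrier_vec d" using v by (simp add: avg_state_def)
  have 0: "(\<Sum>j<d. avg_state d W q $$ (i,j) * v $ j) = 0" if "i < d" for i
    using 0 that mult_mat_vec_entry[OF avg_state_carrier v that, of W q] by (simp add: avg_state_def)
  define Q where "Q x = Re (\<Sum>i<d. \<Sum>j<d. cnj (v $ i) * W x $$ (i,j) * v $ j)" for x
  have Q0: "0 \<le> Q x" for x using D(2,3)[of x] v unfolding Q_def psd_def by auto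
  have "(\<Sum>i<d. \<Sum>j<d. cnj (v $ i) * avg_state d W q $$ (i,j) * v $ j)
    = (\<Sum>i<d. cnj (v $ i) * (\<Sum>j<d. avg_state d W q $$ (i,j) * v $ j))"
    by (simp add: sum_distrib_left mult_ac)
  hence "(\<Sum>i<d. \<Sum>j<d. cnj (v $ i) * avg_state d W q $$ (i,j) * v $ j) = 0" using 0 by simp
  hence "Re (\<Sum>x\<in>UNIV. complex_of_real (q x) * (\<Sum>i<d. \<Sum>j<d. cnj (v $ i) * W x $$ (i,j) * v $ j)) = 0"
    unfolding quadform_avg_state by simp
  hence "(\<Sum>x\<in>UNIV. q x * Q x) = 0" unfolding Q_def by (subst (asm) Re_sum) simp
  hence "\<forall>x\<in>UNIV. q x * Q x = 0"
    using q Q0 by (subst (asm) sum_nonneg_eq_0_iff) (auto simp: prob_dist_def)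
  hence "q x * Q x = 0" by blast
  hence Qx: "Q x = 0" using x by simp
  obtain U r where sd: "spec_decomp (W x) U r" and r: "\<forall>k<d. 0 \<le> r k"
    using density_spec_decomp[OF D(1)] by blast
  have "(\<Sum>k<d. r k * (cmod (\<Sum>i<d. cnj (U $$ (i,k)) * v $ i))\<^sup>2) = 0"
    using Qx unfolding Q_def quadform_spec[OF D(2) sd] by simp
  hence z: "\<forall>k\<in>{..<d}. r k * (cmod (\<Sum>i<d. cnj (U $$ (i,k)) * v $ i))\<^sup>2 = 0"
    using r by (subst (asm) sum_nonneg_eq_0_iff) auto
  show "W x *\<^sub>v v = 0\<^sub>v (dim_row (W x))"
  proof (rule eq_vecI)
    fix i assume "i < dim_vec (0\<^sub>v (dim_row (W x)) :: complex vec)"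
    hence i: "i < d" using D(2)[of x] by auto
    have "(W x *\<^sub>v v) $ i = (\<Sum>k<d. U $$ (i,k) * (complex_of_real (r k) * (\<Sum>j<d. cnj (U $$ (j,k)) * v $ j)))"
      unfolding mult_mat_vec_entry[OF D(2) v i] by (rule spec_mult_vec[OF D(2) sd i])
    also have "\<dots> = 0" by (rule sum.neutral) (use z in auto)
    finally show "(W x *\<^sub>v v) $ i = 0\<^sub>v (dim_row (W x)) $ i" using i D(2)[of x] by simp
  qed (use D(2)[of x] in auto)
qed

section \<open>Mutual information as an entropy difference\<close>

text \<open>The value infinity of \<open>rel_ent\<close> can occur only where q(x) = 0, and there
  the product in \<open>ereal\<close> is 0.\<close>

lemma mutual_info_eq:
  assumes W: "cq_channel d W" and q: "prob_dist q"
  shows "mutual_info d W q = ereal (\<Sum>x\<in>UNIV. q x * Re (ctrace (W x * (mat_log (W x) - mat_log (avg_state d W q)))))"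
proof -
  have "ereal (q x) * rel_ent (W x) (avg_state d W q) =
     ereal (q x * Re (ctrace (W x * (mat_log (W x) - mat_log (avg_state d W q)))))" for x
  proof (cases "q x = 0")
    case False
    hence "0 < q x" using q by (auto simp: prob_dist_def order_less_le)
    thus ?thesis using supp_le_avg_state[OF W q] by (simp add: rel_ent_def)
  qed (simp add: zero_ereal_def[symmetric])
  thus ?thesis unfolding mutual_info_def by simp
qed

lemma mat_log_carrier:
  assumes "density d \<rho>"
  shows "mat_log \<rho> \<in> carrier_mat d d"
  using density_spec_decomp[OF assms] mat_log_spec(2)[of \<rho> d] assms by (auto simp: density_def)

text \<open>The cross terms Tr(W_x log W(q)) are linear in W_x and average to Tr(W(q) log W(q)). In
  this form the mutual information is affine in q as long as W(q) is held fixed.\<close>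

lemma mutual_info_eq_entropy:
  assumes W: "cq_channel d W" and q: "prob_dist q"
  shows "mutual_info d W q = ereal (vn_entropy (avg_state d W q) - (\<Sum>x\<in>UNIV. q x * vn_entropy (W x)))"
proof -
  have D: "density d (W x)" "W x \<in> carrier_mat d d" for x
    using W by (auto simp: cq_channel_def density_def)
  let ?\<rho> = "avg_state d W q"
  let ?L = "mat_log ?\<rho>"
  have L: "?L \<in> carrier_mat d d" by (rule mat_log_carrier[OF density_avg_state[OF W q]])
  have "Re (ctrace (W x * (mat_log (W x) - ?L))) = - vn_entropy (W x) - Re (ctrace (?L * W x))" for x
  proof -
    have "W x * (mat_log (W x) - ?L) = W x * mat_log (W x) - W x * ?L"
      by (rule mult_minus_distrib_mat[OF D(2) mat_log_carrier[OF D(1)] L])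
    hence "ctrace (W x * (mat_log (W x) - ?L)) = ctrace (W x * mat_log (W x)) - ctrace (W x * ?L)"
      using ctrace_minus[of "W x * mat_log (W x)" d "W x * ?L"] D(2)[of x] mat_log_carrier[OF D(1)[of x]] L by simp
    thus ?thesis using ctrace_comm[OF D(2) L] by (simp add: vn_entropy_def)
  qed
  hence "(\<Sum>x\<in>UNIV. q x * Re (ctrace (W x * (mat_log (W x) - ?L))))
     = - (\<Sum>x\<in>UNIV. q x * vn_entropy (W x)) - (\<Sum>x\<in>UNIV. q x * Re (ctrace (?L * W x)))"
    by (simp only:) (simp add: right_diff_distrib sum_subtractf sum_negf)
  also have "(\<Sum>x\<in>UNIV. q x * Re (ctrace (?L * W x))) = Re (ctrace (?L * ?\<rho>))"
    unfolding ctrace_mult_avg_state[OF D(2) L] by simp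
  also have "ctrace (?L * ?\<rho>) = ctrace (?\<rho> * ?L)" by (rule ctrace_comm[OF L avg_state_carrier])
  finally show ?thesis unfolding mutual_info_eq[OF W q] vn_entropy_def by simp
qed

text \<open>The squared overlaps P(j,k) of the two eigenbases form a doubly stochastic matrix. By ln
  x <= x - 1 the divergence, in natural units, is at least sum P(j,k) (a_j - b_k) = 1 - 1 =
  0.\<close>

lemma klein_inequality:
  assumes A: "density d A" and B: "density d B" and supp: "supp_le A B"
  shows "0 \<le> Re (ctrace (A * (mat_log A - mat_log B)))"
proof -
  have cA: "A \<in> carrier_mat d d" and cB: "B \<in> carrier_mat d d" using A B by (auto simp: density_def)
  obtain U a where U: "spec_decomp A U a" and a: "\<And>k. k < d \<Longrightarrow> 0 \<le> a k" "(\<Sum>k<d. a k) = 1"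
    using density_spec_decomp[OF A] by blast
  obtain V b where V: "spec_decomp B V b" and b: "\<And>k. k < d \<Longrightarrow> 0 \<le> b k" "(\<Sum>k<d. b k) = 1"
    using density_spec_decomp[OF B] by blast
  have uU: "unitary d U" and uV: "unitary d V" using U V spec_decomp_iff cA cB by blast+
  note cU = unitaryD(1)[OF uU] and cV = unitaryD(1)[OF uV]
  define Z where "Z = adj U * V"
  have uZ: "unitary d Z" unfolding Z_def
    by (intro unitary_mult uV) (use unitaryD[OF uU] in \<open>auto simp: unitary_def\<close>)
  have cZ: "Z \<in> carrier_mat d d" by (rule unitaryD(1)[OF uZ])
  define P where "P j k = (cmod (Z $$ (j,k)))\<^sup>2" for j k
  have P0: "0 \<le> P j k" for j k by (simp add: P_def)
  have rows: "(\<Sum>k<d. P j k) = 1" if j: "j < d" for j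
  proof -
    have "complex_of_real (\<Sum>k<d. P j k) = (\<Sum>k<d. Z $$ (j,k) * adj Z $$ (k,j))"
      using j cZ by (auto simp: P_def complex_norm_square simp del: of_real_power intro!: sum.cong)
    also have "\<dots> = (Z * adj Z) $$ (j,j)" by (rule mult_mat_index[symmetric]) (use j cZ in auto)
    also have "\<dots> = 1" using j by (simp add: unitaryD(2)[OF uZ])
    finally show ?thesis by (simp only: of_real_eq_1_iff)
  qed
  have cols: "(\<Sum>j<d. P j k) = 1" if k: "k < d" for k
  proof -
    have "complex_of_real (\<Sum>j<d. P j k) = (\<Sum>j<d. adj Z $$ (k,j) * Z $$ (j,k))"
      using k cZ by (auto simp: P_def complex_norm_square mult.commute simp del: of_real_power intro!: sum.cong)
    also have "\<dots> = (adj Z * Z) $$ (k,k)" by (rule mult_mat_index[symmetric]) (use k cZ in auto)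
    also have "\<dots> = 1" using k by (simp add: unitaryD(3)[OF uZ])
    finally show ?thesis by (simp only: of_real_eq_1_iff)
  qed
  have w: "(adj V * A * V) $$ (k,k) = complex_of_real (\<Sum>j<d. P j k * a j)" if k: "k < d" for k
  proof -
    have "(adj V * A * V) $$ (k,k) = complex_of_real (\<Sum>j<d. a j * (cmod (\<Sum>i<d. cnj (U $$ (i,j)) * V $$ (i,k)))\<^sup>2)"
      unfolding conj_diag_entry[OF cV cA k] by (rule quadform_spec[OF cA U])
    also have "(\<Sum>j<d. a j * (cmod (\<Sum>i<d. cnj (U $$ (i,j)) * V $$ (i,k)))\<^sup>2) = (\<Sum>j<d. P j k * a j)"
    proof (rule sum.cong[OF refl])
      fix j assume "j \<in> {..<d}"
      hence "Z $$ (j,k) = (\<Sum>i<d. cnj (U $$ (i,j)) * V $$ (i,k))" unfolding Z_def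
        using k cU cV by (subst mult_mat_index[of _ d d _ d]) auto
      thus "a j * (cmod (\<Sum>i<d. cnj (U $$ (i,j)) * V $$ (i,k)))\<^sup>2 = P j k * a j" by (simp add: P_def)
    qed
    finally show ?thesis .
  qed
  \<comment> \<open>Where b_k = 0 the estimate through ln(b_k / a_j) breaks down; the support
    condition makes the weight of that term vanish.\<close>
  have zero: "P j k * a j = 0" if j: "j < d" and k: "k < d" and bk: "b k = 0" for j k
  proof -
    have vk: "col V k \<in> carrier_vec d" using cV k by auto
    have "B *\<^sub>v col V k = 0\<^sub>v d"
    proof (rule eq_vecI)
      fix i assume "i < dim_vec (0\<^sub>v d :: complex vec)"
      hence i: "i < d" by simp
      have ort: "(\<Sum>l<d. cnj (V $$ (l,m)) * col V k $ l) = (if m = k then 1 else 0)" if "m < d" for m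
      proof -
        have "(\<Sum>l<d. cnj (V $$ (l,m)) * col V k $ l) = (adj V * V) $$ (m,k)"
          using that k cV by (subst mult_mat_index[of _ d d _ d]) auto
        thus ?thesis using that k by (simp add: unitaryD(3)[OF uV])
      qed
      show "(B *\<^sub>v col V k) $ i = 0\<^sub>v d $ i"
        unfolding mult_mat_vec_entry[OF cB vk i] spec_mult_vec[OF cB V i]
        using i bk by (auto simp: ort intro!: sum.neutral)
    qed (use cB in auto)
    hence "A *\<^sub>v col V k = 0\<^sub>v d" using supp vk cA cB by (auto simp: supp_le_def)
    hence z: "(\<Sum>j<d. A $$ (i,j) * V $$ (j,k)) = 0" if "i < d" for i
      using mult_mat_vec_entry[OF cA vk that] that cV k by simp
    have "(adj V * A * V) $$ (k,k) = (\<Sum>i<d. cnj (V $$ (i,k)) * (\<Sum>j<d. A $$ (i,j) * V $$ (j,k)))"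
      unfolding conj_diag_entry[OF cV cA k] by (simp add: sum_distrib_left mult_ac)
    hence "(\<Sum>j<d. P j k * a j) = 0" using w[OF k] z by (simp add: of_real_eq_0_iff del: of_real_sum)
    thus ?thesis using j P0 a by (subst (asm) sum_nonneg_eq_0_iff) auto
  qed
  have tA: "Re (ctrace (A * mat_log A)) = (\<Sum>j<d. a j * log 2 (a j))"
    using vn_entropy_spec[OF cA U a(1)] by (simp add: vn_entropy_def)
  have tB: "Re (ctrace (A * mat_log B)) = (\<Sum>k<d. log 2 (b k) * (\<Sum>j<d. P j k * a j))"
  proof -
    have "Re (ctrace (A * mat_log B)) = (\<Sum>k<d. log 2 (b k) * Re ((adj V * A * V) $$ (k,k)))"
      by (rule Re_ctrace_spec_decomp[OF mat_log_spec(2)[OF cB V b(1)] cA mat_log_spec(1)[OF cB V b(1)]])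
    also have "\<dots> = (\<Sum>k<d. log 2 (b k) * (\<Sum>j<d. P j k * a j))"
      by (rule sum.cong) (auto simp: w simp del: index_mult_mat(1))
    finally show ?thesis .
  qed
  have key: "P j k * (a j - b k) \<le> P j k * (a j * (ln (a j) - ln (b k)))" if j: "j < d" and k: "k < d" for j k
  proof (cases "a j = 0 \<or> b k = 0")
    case True
    thus ?thesis using zero[OF j k] b(1)[OF k] P0[of j k] by (auto simp: algebra_simps)
  next
    case False
    hence p: "0 < a j" "0 < b k" using a(1)[OF j] b(1)[OF k] by auto
    have "ln (b k / a j) \<le> b k / a j - 1" using p by (intro ln_le_minus_one) auto
    hence "a j * (ln (b k) - ln (a j)) \<le> a j * (b k / a j - 1)"
      using p by (intro mult_left_mono) (auto simp: ln_div)
    hence "a j - b k \<le> a j * (ln (a j) - ln (b k))" using p by (simp add: algebra_simps)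
    thus ?thesis by (intro mult_left_mono P0)
  qed
  have "(\<Sum>j<d. \<Sum>k<d. P j k * (a j - b k)) = (\<Sum>j<d. a j * (\<Sum>k<d. P j k)) - (\<Sum>k<d. b k * (\<Sum>j<d. P j k))"
    using sum.swap[of "\<lambda>j k. P j k * b k" "{..<d}" "{..<d}"]
    by (simp add: algebra_simps sum_subtractf sum_distrib_left)
  also have "\<dots> = 0" using rows cols a b by simp
  finally have "0 \<le> (\<Sum>j<d. \<Sum>k<d. P j k * (a j * (ln (a j) - ln (b k))))"
    using sum_mono[of "{..<d}" "\<lambda>j. \<Sum>k<d. P j k * (a j - b k)" "\<lambda>j. \<Sum>k<d. P j k * (a j * (ln (a j) - ln (b k)))"]
    by (auto intro!: sum_mono key)
  also have "\<dots> = (\<Sum>j<d. a j * ln (a j) * (\<Sum>k<d. P j k)) - (\<Sum>k<d. ln (b k) * (\<Sum>j<d. P j k * a j))"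
    using sum.swap[of "\<lambda>j k. P j k * a j * ln (b k)" "{..<d}" "{..<d}"]
    by (simp add: algebra_simps sum_subtractf sum_distrib_left)
  also have "(\<Sum>j<d. a j * ln (a j) * (\<Sum>k<d. P j k)) = (\<Sum>j<d. a j * ln (a j))" using rows by simp
  finally have "0 \<le> ((\<Sum>j<d. a j * ln (a j)) - (\<Sum>k<d. ln (b k) * (\<Sum>j<d. P j k * a j))) / ln 2" by simp
  also have "\<dots> = Re (ctrace (A * mat_log A)) - Re (ctrace (A * mat_log B))"
    unfolding tA tB log_def by (simp add: diff_divide_distrib sum_divide_distrib)
  also have "\<dots> = Re (ctrace (A * (mat_log A - mat_log B)))"
    using mult_minus_distrib_mat[OF cA mat_log_carrier[OF A] mat_log_carrier[OF B]] cA
      mat_log_carrier[OF A] mat_log_carrier[OF B] by (simp add: ctrace_minus[of _ d])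
  finally show ?thesis .
qed

text \<open>Supplies the lower bound that makes the real infimum \<open>opt_rate\<close> meaningful
  and every rate above it positive.\<close>

lemma mutual_info_nonneg:
  assumes W: "cq_channel d W" and q: "prob_dist q"
  shows "0 \<le> mutual_info d W q"
proof -
  have "0 \<le> q x * Re (ctrace (W x * (mat_log (W x) - mat_log (avg_state d W q))))" for x
  proof (cases "q x = 0")
    case False
    hence x: "0 < q x" using q by (auto simp: prob_dist_def order_less_le)
    have "0 \<le> Re (ctrace (W x * (mat_log (W x) - mat_log (avg_state d W q))))"
      by (rule klein_inequality[OF _ density_avg_state[OF W q] supp_le_avg_state[OF W q x]])
        (use W in \<open>simp add: cq_channel_def\<close>)
    thus ?thesis using x by simp
  qed simp
  thus ?thesis unfolding mutual_info_eq[OF W q] by (simp add: sum_nonneg)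
qed

subsection \<open>Dual observable and product measurements\<close>

text \<open>The constraint W(q) = W(p) is read entry by entry as a linear program, and its
  multipliers are assembled into one Hermitian matrix. The scalar multiplier becomes a multiple of
  the identity because all states have trace 1.\<close>

lemma dual_observable:
  fixes W :: "'x::finite \<Rightarrow> complex mat"
  assumes W: "cq_channel d W" and p: "prob_dist p" and \<delta>: "0 < \<delta>"
    and v: "\<And>q. prob_dist q \<Longrightarrow> avg_state d W q = avg_state d W p \<Longrightarrow> (\<Sum>x\<in>UNIV. q x * vn_entropy (W x)) \<le> v"
  shows "\<exists>A. A \<in> carrier_mat d d \<and> hermitian A \<and> (\<forall>x. vn_entropy (W x) + Re (ctrace (A * W x)) \<le> 0)
    \<and> - v - \<delta> \<le> Re (ctrace (A * avg_state d W p))"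
proof -
  let ?I = "{..<d} \<times> {..<d}"
  obtain y y0 where y: "\<And>x. vn_entropy (W x) + (\<Sum>i\<in>?I. Re (cnj (y i) * W x $$ i)) + y0 \<le> 0"
    and y0: "- v - \<delta> \<le> (\<Sum>i\<in>?I. Re (cnj (y i) * avg_state d W p $$ i)) + y0"
  proof -
    have "\<exists>y y0. (\<forall>x. vn_entropy (W x) + (\<Sum>i\<in>?I. Re (cnj (y i) * W x $$ i)) + y0 \<le> 0) \<and>
       - v - \<delta> \<le> (\<Sum>i\<in>?I. Re (cnj (y i) * avg_state d W p $$ i)) + y0"
    proof (rule simplex_lp_duality[OF _ p _ _ \<delta>])
      fix q assume q: "prob_dist q" "\<And>i. i \<in> ?I \<Longrightarrow> (\<Sum>x\<in>UNIV. complex_of_real (q x) * W x $$ i) = avg_state d W p $$ i"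
      have "avg_state d W q = avg_state d W p"
        by (rule eq_matI) (use q(2) in \<open>auto simp: avg_state_def\<close>)
      thus "(\<Sum>x\<in>UNIV. q x * vn_entropy (W x)) \<le> v" by (rule v[OF q(1)])
    qed (auto simp: avg_state_def)
    thus ?thesis using that by blast
  qed
  \<comment> \<open>Conjugated and transposed, so that Tr(BX) is the sum of cnj(y_ij) X_ij.\<close>
  define B where "B = mat d d (\<lambda>(i,j). cnj (y (j,i)))"
  have B: "B \<in> carrier_mat d d" by (simp add: B_def)
  \<comment> \<open>The Hermitian part of B has the same real trace against a Hermitian X as B
    itself.\<close>
  define A where "A = complex_of_real (1/2) \<cdot>\<^sub>m (B + adj B) + complex_of_real y0 \<cdot>\<^sub>m 1\<^sub>m d"
  have A: "A \<in> carrier_mat d d" using B by (auto simp: A_def)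
  have h: "hermitian A"
    by (rule hermitianI[OF A], rule eq_matI) (use B in \<open>auto simp: A_def\<close>)
  have key: "Re (ctrace (A * X)) = (\<Sum>i\<in>?I. Re (cnj (y i) * X $$ i)) + y0" if "density d X" for X
  proof -
    have X: "X \<in> carrier_mat d d" "adj X = X" "ctrace X = 1" using that
      by (auto simp: density_def psd_def hermitian_def)
    have "Re (ctrace (B * X)) = (\<Sum>i<d. \<Sum>j<d. Re (cnj (y (j,i)) * X $$ (j,i)))"
      unfolding ctrace_mult_entries[OF B X(1)] by (simp add: B_def)
    also have "\<dots> = (\<Sum>j<d. \<Sum>i<d. Re (cnj (y (j,i)) * X $$ (j,i)))" by (rule sum.swap)
    also have "\<dots> = (\<Sum>i\<in>?I. Re (cnj (y i) * X $$ i))" by (simp only: sum.cartesian_product case_prod_unfold prod.collapse)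
    finally have BX: "Re (ctrace (B * X)) = (\<Sum>i\<in>?I. Re (cnj (y i) * X $$ i))" .
    have "adj B * X = adj (X * B)" using B X by (simp add: adj_mult_dim)
    moreover have "ctrace (adj (X * B)) = cnj (ctrace (X * B))" using B X by (simp add: ctrace_def)
    ultimately have aBX: "Re (ctrace (adj B * X)) = Re (ctrace (B * X))"
      using ctrace_comm[OF X(1) B] by simp
    have "A * X = complex_of_real (1/2) \<cdot>\<^sub>m (B * X + adj B * X) + complex_of_real y0 \<cdot>\<^sub>m X"
      unfolding A_def using B X
      by (simp add: add_mult_distrib_mat[of _ d d _ _ d] mult_smult_assoc_mat[of _ d d _ d])
    moreover have "ctrace (complex_of_real (1/2) \<cdot>\<^sub>m (B * X + adj B * X) + complex_of_real y0 \<cdot>\<^sub>m X)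
       = complex_of_real (1/2) * (ctrace (B * X) + ctrace (adj B * X)) + complex_of_real y0 * ctrace X"
    proof -
      have c: "B * X \<in> carrier_mat d d" "adj B * X \<in> carrier_mat d d" using B X by auto
      hence c2: "B * X + adj B * X \<in> carrier_mat d d" by auto
      show ?thesis using ctrace_add[OF smult_carrier_mat[OF c2] smult_carrier_mat[OF X(1)]]
          ctrace_smult[OF c2] ctrace_smult[OF X(1)] ctrace_add[OF c] by simp
    qed
    ultimately have "ctrace (A * X) = complex_of_real (1/2) * (ctrace (B * X) + ctrace (adj B * X)) + complex_of_real y0"
      using X(3) by simp
    hence "Re (ctrace (A * X)) = Re (ctrace (B * X)) + y0" using aBX by simp
    thus ?thesis using BX by simp
  qed
  have "density d (W x)" for x using W by (simp add: cq_channel_def)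
  thus ?thesis using A h y y0 key[OF density_avg_state[OF W p]] key
    by (intro exI[of _ A]) (auto simp: add.assoc)
qed

section \<open>Output states of codes and product measurements\<close>

lemma tensor_word_const:
  "length xs = length ys \<Longrightarrow> tensor_word (\<lambda>_. C) xs = tensor_word (\<lambda>_. C) ys"
  by (induction xs ys rule: list_induct2) auto

lemma tsum_const: "length xs = length ys \<Longrightarrow> tsum d (\<lambda>_. f) xs k = tsum d (\<lambda>_. f) ys k"
  by (induction xs ys arbitrary: k rule: list_induct2) auto

lemma avg_state_n_carrier[simp]: "avg_state_n d n W q \<in> carrier_mat (d ^ n) (d ^ n)"
  by (simp add: avg_state_n_def)

lemma tensor_word_carrier_words:
  "(\<And>x. W x \<in> carrier_mat d d) \<Longrightarrow> xs \<in> words n \<Longrightarrow> tensor_word W xs \<in> carrier_mat (d ^ n) (d ^ n)"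
  using tensor_word_carrier[of W d xs] by (simp add: words_def)

lemma ctrace_mult_avg_state_n:
  fixes W :: "'x::finite \<Rightarrow> complex mat"
  assumes W: "\<And>x. W x \<in> carrier_mat d d" and L: "L \<in> carrier_mat (d ^ n) (d ^ n)"
  shows "ctrace (L * avg_state_n d n W q) = (\<Sum>xs\<in>words n. complex_of_real (q xs) * ctrace (L * tensor_word W xs))"
proof -
  let ?N = "d ^ n"
  have "ctrace (L * avg_state_n d n W q) = (\<Sum>i<?N. \<Sum>j<?N. \<Sum>x\<in>words n. complex_of_real (q x) * (L $$ (i,j) * tensor_word W x $$ (j,i)))"
    unfolding ctrace_mult_entries[OF L avg_state_n_carrier]
    by (intro sum.cong refl) (simp add: avg_state_n_def sum_distrib_left mult_ac)
  also have "\<dots> = (\<Sum>i<?N. \<Sum>x\<in>words n. \<Sum>j<?N. complex_of_real (q x) * (L $$ (i,j) * tensor_word W x $$ (j,i)))"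
    by (rule sum.cong[OF refl], rule sum.swap)
  also have "\<dots> = (\<Sum>x\<in>words n. \<Sum>i<?N. \<Sum>j<?N. complex_of_real (q x) * (L $$ (i,j) * tensor_word W x $$ (j,i)))"
    by (rule sum.swap)
  also have "\<dots> = (\<Sum>x\<in>words n. complex_of_real (q x) * ctrace (L * tensor_word W x))"
    using ctrace_mult_entries[OF L tensor_word_carrier_words[where W = W, OF W]]
    by (intro sum.cong refl) (simp add: sum_distrib_left)
  finally show ?thesis .
qed

lemma hermitian_tensor_word:
  assumes "\<And>x. density d (W x)"
  shows "hermitian (tensor_word W xs)"
proof -
  have "adj (W x) = W x" for x using assms[of x] by (simp add: density_def psd_def hermitian_def)
  hence "adj (tensor_word W xs) = tensor_word W xs" by (simp add: tensor_word_adj)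
  thus ?thesis using assms hermitianI[OF tensor_word_carrier[of W d xs]] by (auto simp: density_def)
qed

lemma hermitian_avg_state_n:
  fixes W :: "'x::finite \<Rightarrow> complex mat"
  assumes "\<And>x. density d (W x)"
  shows "hermitian (avg_state_n d n W q)"
proof (rule hermitianI[OF avg_state_n_carrier], rule eq_matI)
  have W: "W x \<in> carrier_mat d d" for x using assms[of x] by (simp add: density_def)
  fix i j assume "i < dim_row (avg_state_n d n W q)" "j < dim_col (avg_state_n d n W q)"
  hence ij: "i < d ^ n" "j < d ^ n" by (auto simp: avg_state_n_def)
  have "cnj (tensor_word W xs $$ (j,i)) = tensor_word W xs $$ (i,j)" if "xs \<in> words n" for xs
    using hermitian_entry[OF hermitian_tensor_word[OF assms] tensor_word_carrier_words[OF W that] ij] by simp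
  thus "adj (avg_state_n d n W q) $$ (i,j) = avg_state_n d n W q $$ (i,j)"
    using ij by (simp add: avg_state_n_def)
qed (auto simp: avg_state_n_def)

lemma tensor_word_spec_states:
  assumes W: "\<And>x. W x \<in> carrier_mat d d" and sd: "\<And>x. spec_decomp (W x) (U x) (mu x)"
    and mu: "\<And>x i. i < d \<Longrightarrow> 0 \<le> mu x i" "\<And>x. (\<Sum>i<d. mu x i) = 1"
  shows "(\<Sum>k<d ^ length xs. tprod d mu xs k) = 1" "ctrace (tensor_word W xs) = 1"
proof -
  show "(\<Sum>k<d ^ length xs. tprod d mu xs k) = 1" unfolding sum_tprod mu(2) by (induction xs) auto
  thus "ctrace (tensor_word W xs) = 1"
    using ctrace_eq_sum_spec[OF tensor_word_carrier[where W = W, OF W] spec_decomp_tensor_word[where W = W, OF W sd], of xs] by simp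
qed

lemma ctrace_avg_state_n:
  fixes W :: "'x::finite \<Rightarrow> complex mat"
  assumes W: "\<And>x. W x \<in> carrier_mat d d" and tr: "\<And>xs. ctrace (tensor_word W xs) = 1" and q: "prob_dist_n n q"
  shows "ctrace (avg_state_n d n W q) = 1"
proof -
  have "ctrace (1\<^sub>m (d ^ n) * avg_state_n d n W q) = (\<Sum>xs\<in>words n. complex_of_real (q xs) * ctrace (1\<^sub>m (d ^ n) * tensor_word W xs))"
    by (rule ctrace_mult_avg_state_n[OF W]) simp
  also have "\<dots> = complex_of_real (\<Sum>xs\<in>words n. q xs)"
    unfolding of_real_sum using tr left_mult_one_mat[OF tensor_word_carrier_words[where W = W, OF W]]
    by (intro sum.cong) auto
  also have "(\<Sum>xs\<in>words n. q xs) = 1" using q by (simp add: prob_dist_n_def)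
  finally show ?thesis by (simp add: left_mult_one_mat[OF avg_state_n_carrier])
qed

lemma spec_decomp_indicator:
  assumes "unitary n U"
  shows "spec_decomp (U * mat_diag n (\<lambda>i. if K i then 1 else 0) * adj U) U (\<lambda>i. if K i then 1 else 0)"
proof -
  have c: "U * mat_diag n (\<lambda>i. if K i then 1 else 0) * adj U \<in> carrier_mat n n"
    using unitaryD(1)[OF assms] by auto
  show ?thesis unfolding spec_decomp_iff[OF c] using assms by (simp add: if_distrib[of complex_of_real] cong: if_cong)
qed

text \<open>Measuring each site in the eigenbasis of A turns the family Y into outcome distributions
  b(x,i) = <v_i, Y_x v_i> whose means are Tr(A Y_x). Spectral projectors of an additive observable
  then have classical probabilities. The family is general so that both the codewords and the
  constant family W(p) are covered.\<close>

lemma product_measurement: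
  assumes Y: "\<And>x. density d (Y x)" and A: "A \<in> carrier_mat d d" "spec_decomp A V al"
  shows "\<exists>b. (\<forall>x. \<forall>i<d. 0 \<le> b x i) \<and> (\<forall>x. (\<Sum>i<d. b x i) = 1) \<and>
    (\<forall>x. (\<Sum>i<d. b x i * al i) = Re (ctrace (A * Y x))) \<and>
    (\<forall>xs K. Re (ctrace (tensor_word (\<lambda>_. V) xs * mat_diag (d ^ length xs) (\<lambda>i. if K i then 1 else 0)
       * adj (tensor_word (\<lambda>_. V) xs) * tensor_word Y xs)) = (\<Sum>k\<in>{k. k < d ^ length xs \<and> K k}. tprod d b xs k))"
proof -
  have V: "unitary d V" using A spec_decomp_iff by blast
  note cV = unitaryD(1)[OF V]
  have Yc: "Y x \<in> carrier_mat d d" "psd (Y x)" "adj (Y x) = Y x" "ctrace (Y x) = 1" for x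
    using Y[of x] by (auto simp: density_def psd_def hermitian_def)
  define b where "b x i = Re ((adj V * Y x * V) $$ (i,i))" for x i
  have C: "adj V * Y x * V \<in> carrier_mat d d" for x using cV Yc(1)[of x] by auto
  have bc: "(adj V * Y x * V) $$ (i,i) = complex_of_real (b x i)" if "i < d" for x i
  proof -
    have "adj (adj V * Y x * V) = adj V * Y x * V"
      using cV Yc(1,3)[of x] by (simp add: adj_mult_dim mat_assoc)
    from hermitian_entry[OF hermitianI[OF C this] C that that]
    have "Im ((adj V * Y x * V) $$ (i,i)) = 0" by (metis Im_complex_of_real Reals_cnj_iff complex_is_Real_iff)
    thus ?thesis by (simp add: b_def complex_eq_iff del: index_mult_mat(1))
  qed
  have 1: "0 \<le> b x i" if "i < d" for x i
    unfolding b_def by (rule psd_conj_diag_nonneg[OF Yc(1,2) cV that])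
  have 2: "(\<Sum>i<d. b x i) = 1" for x
    using sum_conj_diag[OF V Yc(1)[of x]] Yc(4)[of x] unfolding b_def by (metis Re_sum one_complex.sel(1))
  have 3: "(\<Sum>i<d. b x i * al i) = Re (ctrace (A * Y x))" for x
    unfolding ctrace_comm[OF A(1) Yc(1)] Re_ctrace_spec_decomp[OF A(1) Yc(1) A(2)] b_def
    by (simp add: mult.commute del: index_mult_mat(1))
  have 4: "Re (ctrace (tensor_word (\<lambda>_. V) xs * mat_diag (d ^ length xs) (\<lambda>i. if K i then 1 else 0)
       * adj (tensor_word (\<lambda>_. V) xs) * tensor_word Y xs)) = (\<Sum>k\<in>{k. k < d ^ length xs \<and> K k}. tprod d b xs k)" for xs K
  proof -
    let ?n = "d ^ length xs" and ?V = "tensor_word (\<lambda>_. V) xs"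
    let ?Q = "?V * mat_diag ?n (\<lambda>i. if K i then 1 else 0) * adj ?V"
    have uV: "unitary ?n ?V" by (rule unitary_tensor_word[OF V])
    have Q: "?Q \<in> carrier_mat ?n ?n" using unitaryD(1)[OF uV] by auto
    have T: "tensor_word Y xs \<in> carrier_mat ?n ?n" by (rule tensor_word_carrier[OF Yc(1)])
    have "adj ?V * tensor_word Y xs * ?V = tensor_word (\<lambda>x. adj V * Y x * V) xs"
      unfolding tensor_word_adj using cV Yc(1) by (simp add: tensor_word_mult[of _ d] mult_carrier_mat[of _ d d _ d])
    hence e: "(adj ?V * tensor_word Y xs * ?V) $$ (k,k) = complex_of_real (tprod d b xs k)" if "k < ?n" for k
      using tensor_word_diag[of "\<lambda>x. adj V * Y x * V" d b k xs, OF C bc that] by simp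
    have "Re (ctrace (?Q * tensor_word Y xs)) = Re (ctrace (tensor_word Y xs * ?Q))"
      using ctrace_comm[OF Q T] by simp
    also have "\<dots> = (\<Sum>k<?n. (if K k then 1 else 0) * Re ((adj ?V * tensor_word Y xs * ?V) $$ (k,k)))"
      by (rule Re_ctrace_spec_decomp[OF Q T spec_decomp_indicator[OF uV]])
    also have "\<dots> = (\<Sum>k<?n. if K k then tprod d b xs k else 0)"
      by (rule sum.cong) (auto simp: e simp del: index_mult_mat(1))
    also have "\<dots> = (\<Sum>k\<in>{k. k < ?n \<and> K k}. tprod d b xs k)"
      by (subst sum.inter_filter[symmetric]) (auto intro!: sum.cong)
    finally show ?thesis .
  qed
  show ?thesis using 1 2 3 4 by blast
qed

subsection \<open>Strong converse\<close>

text \<open>A positive value is at least 1/M, so there are at most M distinct codewords. Positivity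
  of M is essential: \<open>types_M n 0\<close> contains every distribution.\<close>

lemma types_M_support:
  assumes "q \<in> types_M n M" "0 < M"
  shows "finite {xs. 0 < q xs}" "{xs. 0 < q xs} \<subseteq> words n" "card {xs. 0 < q xs} \<le> M"
proof -
  have q: "\<And>xs. 0 \<le> q xs" "\<And>xs. xs \<notin> words n \<Longrightarrow> q xs = 0" "(\<Sum>xs\<in>words n. q xs) = 1"
    and int: "\<And>xs. real M * q xs \<in> \<int>" using assms(1) by (auto simp: types_M_def prob_dist_n_def)
  show sub: "{xs. 0 < q xs} \<subseteq> words n" using q(2) by fastforce
  thus fin: "finite {xs. 0 < q xs}" by (rule finite_subset) simp
  have "1 \<le> real M * q xs" if "0 < q xs" for xs
  proof -
    obtain k where k: "real M * q xs = of_int k" using int by (auto elim: Ints_cases)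
    have "0 < real M * q xs" using that assms(2) by simp
    hence "1 \<le> k" unfolding k by simp
    thus ?thesis unfolding k by simp
  qed
  hence "(\<Sum>xs\<in>{xs. 0 < q xs}. 1) \<le> (\<Sum>xs\<in>{xs. 0 < q xs}. real M * q xs)" by (intro sum_mono) auto
  also have "\<dots> = real M * (\<Sum>xs\<in>{xs. 0 < q xs}. q xs)" by (simp add: sum_distrib_left)
  also have "(\<Sum>xs\<in>{xs. 0 < q xs}. q xs) \<le> (\<Sum>xs\<in>words n. q xs)"
    by (rule sum_mono2) (use sub q in auto)
  finally show "card {xs. 0 < q xs} \<le> M" using q(3) assms(2) by (simp add: mult_left_mono)
qed

text \<open>The test is \<open>E = Q - P\<close>, where \<open>Q\<close> is the spectral projector of \<open>\<Sum>\<^sub>i A\<^sub>i\<close> for high values and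
  \<open>P\<close> projects onto the span of the vectors \<open>Q v\<close>, with \<open>v\<close> a typical eigenvector of a codeword of small
  entropy. Taking \<open>Q v\<close> instead of \<open>v\<close> gives \<open>P \<le> Q\<close>, hence \<open>E\<close> is a projector with \<open>E v = 0\<close>.\<close>

lemma converse_one_shot:
  fixes W :: "'x::finite \<Rightarrow> complex mat"
  assumes W: "cq_channel d W" and p: "prob_dist p"
    and A: "A \<in> carrier_mat d d" "hermitian A"
    and dual: "\<And>x. vn_entropy (W x) + Re (ctrace (A * W x)) \<le> 0"
    and a: "a = Re (ctrace (A * avg_state d W p))" and h: "h = vn_entropy (avg_state d W p)"
    and \<delta>: "0 < \<delta>"
  shows "\<exists>c>0. \<forall>n M q. 0 < M \<longrightarrow> q \<in> types_M n M \<longrightarrow>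
     1 - trace_norm (avg_state_n d n W (iid p n) - avg_state_n d n W q) / 2
       \<le> 3 * exp (- c * real n) + real M * 2 powr (real n * (4 * \<delta> - a - h))"
proof -
  let ?\<rho> = "avg_state d W p"
  have DW: "density d (W x)" for x using W by (simp add: cq_channel_def)
  have cW: "W x \<in> carrier_mat d d" for x using DW[of x] by (simp add: density_def)
  have D\<rho>: "density d ?\<rho>" by (rule density_avg_state[OF W p])
  have "\<forall>x. \<exists>U mu. spec_decomp (W x) U mu \<and> (\<forall>k<d. 0 \<le> mu k) \<and> (\<Sum>k<d. mu k) = 1"
    using density_spec_decomp[OF DW] by blast
  then obtain U mu where sW: "\<And>x. spec_decomp (W x) (U x) (mu x)" and mu: "\<And>x i. i < d \<Longrightarrow> 0 \<le> mu x i" "\<And>x. (\<Sum>i<d. mu x i) = 1"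
    by metis
  obtain V r where s\<rho>: "spec_decomp ?\<rho> V r" and r: "\<And>i. i < d \<Longrightarrow> 0 \<le> r i" "(\<Sum>i<d. r i) = 1"
    using density_spec_decomp[OF D\<rho>] by blast
  obtain VA al where sA: "spec_decomp A VA al" using hermitian_spec_decomp_exists[OF A] by blast
  have uU: "unitary d (U x)" for x using sW[of x] spec_decomp_iff[OF cW] by blast
  have uV: "unitary d V" using s\<rho> spec_decomp_iff[OF avg_state_carrier] by blast
  have uVA: "unitary d VA" using sA spec_decomp_iff[OF A(1)] by blast
  obtain b where b: "\<And>x i. i < d \<Longrightarrow> 0 \<le> b x i" "\<And>x. (\<Sum>i<d. b x i) = 1"
    "\<And>x. (\<Sum>i<d. b x i * al i) = Re (ctrace (A * W x))"
    and bQ: "\<And>xs K. Re (ctrace (tensor_word (\<lambda>_. VA) xs * mat_diag (d ^ length xs) (\<lambda>i. if K i then 1 else 0)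
       * adj (tensor_word (\<lambda>_. VA) xs) * tensor_word W xs)) = (\<Sum>k\<in>{k. k < d ^ length xs \<and> K k}. tprod d b xs k)"
    using product_measurement[of d W, OF DW A(1) sA] by blast
  obtain g where g: "\<And>x i. i < d \<Longrightarrow> 0 \<le> g x i" "\<And>x. (\<Sum>i<d. g x i) = 1"
    "\<And>x. (\<Sum>i<d. g x i * al i) = Re (ctrace (A * ?\<rho>))"
    and gQ: "\<And>(xs :: 'x list) K. Re (ctrace (tensor_word (\<lambda>_. VA) xs * mat_diag (d ^ length xs) (\<lambda>i. if K i then 1 else 0)
       * adj (tensor_word (\<lambda>_. VA) xs) * tensor_word (\<lambda>_. ?\<rho>) xs)) = (\<Sum>k\<in>{k. k < d ^ length xs \<and> K k}. tprod d g xs k)"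
    using product_measurement[of d "\<lambda>_::'x. ?\<rho>", OF D\<rho> A(1) sA] by blast
  \<comment> \<open>One common bound for all one-site quantities fed to the Chernoff estimate, so
    that all error terms share the exponent c; the summand \<open>\<delta>\<close> ensures
    \<open>\<delta> \<le> B\<close>.\<close>
  define B where "B = \<delta> + (\<Sum>i<d. \<bar>al i\<bar>) + (\<Sum>i<d. \<bar>log 2 (r i)\<bar>) + (\<Sum>x\<in>UNIV. \<Sum>i<d. \<bar>log 2 (mu x i)\<bar>)"
  have B: "\<delta> \<le> B" and Bal: "\<And>i. i < d \<Longrightarrow> \<bar>al i\<bar> \<le> B" and Br: "\<And>i. i < d \<Longrightarrow> \<bar>log 2 (r i)\<bar> \<le> B"
    and Bmu: "\<And>x i. i < d \<Longrightarrow> \<bar>log 2 (mu x i)\<bar> \<le> B"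
  proof -
    have nn: "0 \<le> (\<Sum>i<d. \<bar>al i\<bar>)" "0 \<le> (\<Sum>i<d. \<bar>log 2 (r i)\<bar>)" "0 \<le> (\<Sum>x\<in>UNIV. \<Sum>i<d. \<bar>log 2 (mu x i)\<bar>)"
      by (auto intro!: sum_nonneg)
    show "\<delta> \<le> B" unfolding B_def using nn by linarith
    show "\<bar>al i\<bar> \<le> B" if "i < d" for i
      using member_le_sum[of i "{..<d}" "\<lambda>i. \<bar>al i\<bar>"] that nn(2,3) \<delta> unfolding B_def by (smt (verit) finite_lessThan lessThan_iff abs_ge_zero)
    show "\<bar>log 2 (r i)\<bar> \<le> B" if "i < d" for i
      using member_le_sum[of i "{..<d}" "\<lambda>i. \<bar>log 2 (r i)\<bar>"] that nn(1,3) \<delta> unfolding B_def by (smt (verit) finite_lessThan lessThan_iff abs_ge_zero)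
    show "\<bar>log 2 (mu x i)\<bar> \<le> B" if "i < d" for x i
    proof -
      have "\<bar>log 2 (mu x i)\<bar> \<le> (\<Sum>i<d. \<bar>log 2 (mu x i)\<bar>)" using that by (intro member_le_sum) auto
      also have "\<dots> \<le> (\<Sum>x\<in>UNIV. \<Sum>i<d. \<bar>log 2 (mu x i)\<bar>)"
        by (rule member_le_sum) (auto intro!: sum_nonneg)
      finally show ?thesis unfolding B_def using nn \<delta> by linarith
    qed
  qed
  define c where "c = \<delta>\<^sup>2 / (4 * B\<^sup>2)"
  have c: "0 < c" using \<delta> B by (simp add: c_def)
  have "1 - trace_norm (avg_state_n d n W (iid p n) - avg_state_n d n W q) / 2
       \<le> 3 * exp (- c * real n) + real M * 2 powr (real n * (4 * \<delta> - a - h))"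
    if M: "0 < M" and q: "q \<in> types_M n M" for n M q
  proof -
    let ?N = "d ^ n"
    let ?e = "exp (- c * real n)"
    define ys :: "'x list" where "ys = replicate n undefined"
    have ly: "length ys = n" by (simp add: ys_def)
    define \<rho>n where "\<rho>n = tensor_word (\<lambda>_. ?\<rho>) ys"
    have \<rho>n: "avg_state_n d n W (iid p n) = \<rho>n" unfolding \<rho>n_def by (rule avg_state_n_iid[OF cW ly])
    have c\<rho>: "\<rho>n \<in> carrier_mat ?N ?N" using \<rho>n avg_state_n_carrier by metis
    define \<sigma> where "\<sigma> = avg_state_n d n W q"
    have c\<sigma>: "\<sigma> \<in> carrier_mat ?N ?N" by (simp add: \<sigma>_def)
    have qn: "prob_dist_n n q" using q by (simp add: types_M_def)
    define S where "S = {xs. 0 < q xs}"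
    have S: "finite S" "S \<subseteq> words n" "card S \<le> M" using types_M_support[OF q M] by (auto simp: S_def)
    define VAn where "VAn = tensor_word (\<lambda>_::'x. VA) ys"
    have uVAn: "unitary ?N VAn" unfolding VAn_def ly[symmetric] by (rule unitary_tensor_word[OF uVA])
    define be where "be k = tsum d (\<lambda>_::'x. al) ys k" for k
    \<comment> \<open>On the target state the additive observable has mean n a; the event that it
      falls below n (a - \<open>\<delta>\<close>) has probability at most \<open>?e\<close>.\<close>
    define K where "K k \<longleftrightarrow> real n * (a - \<delta>) \<le> be k" for k
    define Q where "Q = VAn * mat_diag ?N (\<lambda>k. if K k then 1 else 0) * adj VAn"
    have Q: "projector ?N Q" unfolding Q_def by (rule projector_mat_diag_conj[OF uVAn])
    note Qc = projectorD[OF Q]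
    have trQ\<rho>: "1 - Re (ctrace (Q * \<rho>n)) \<le> ?e"
    proof -
      have "Re (ctrace (Q * \<rho>n)) = (\<Sum>k\<in>{k. k < ?N \<and> K k}. tprod d g ys k)"
        unfolding Q_def VAn_def \<rho>n_def using gQ[of ys K] by (simp add: ly)
      moreover have "(\<Sum>k<?N. tprod d g ys k) = 1"
        using sum_tprod[of d g ys] by (simp add: ly g(2) map_replicate_const)
      moreover have "(\<Sum>k<?N. tprod d g ys k) = (\<Sum>k\<in>{k. k < ?N \<and> K k}. tprod d g ys k) + (\<Sum>k\<in>{k. k < ?N \<and> \<not> K k}. tprod d g ys k)"
        by (subst sum.union_disjoint[symmetric]) (auto intro!: sum.cong)
      moreover have "(\<Sum>k\<in>{k. k < ?N \<and> \<not> K k}. tprod d g ys k) \<le>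
          (\<Sum>k\<in>{k. k < ?N \<and> - (real n * (a - \<delta>)) \<le> tsum d (\<lambda>_ i. - al i) ys k}. tprod d g ys k)"
        by (rule sum_mono2) (auto simp: K_def be_def tsum_uminus intro!: tprod_nonneg g(1) simp: ly)
      moreover have "\<dots> \<le> exp (- (\<delta>\<^sup>2 / (4 * B\<^sup>2)) * real (length ys))"
        unfolding ly[symmetric]
      proof (rule chernoff_tprod)
        have "(\<Sum>x\<leftarrow>ys. \<Sum>i<d. g x i * - al i) = - (real n * a)"
          using g(3) by (simp add: sum_negf a ys_def sum_list_replicate)
        thus "(\<Sum>x\<leftarrow>ys. \<Sum>i<d. g x i * - al i) + real (length ys) * \<delta> \<le> - (real (length ys) * (a - \<delta>))"
          by (simp add: ly algebra_simps)
      qed (use g \<delta> B Bal in auto)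
      ultimately show ?thesis by (simp add: ly c_def)
    qed
    define Hs where "Hs xs = (\<Sum>x\<leftarrow>xs. vn_entropy (W x))" for xs
    \<comment> \<open>By the dual inequality a word that is not near has mean at most
      -\<open>Hs xs\<close> < n (a - 2 \<open>\<delta>\<close>), a full n \<open>\<delta>\<close>
      below the threshold of Q.\<close>
    define near where "near xs \<longleftrightarrow> Hs xs \<le> real n * (2 * \<delta> - a)" for xs
    have far: "Re (ctrace (Q * tensor_word W xs)) \<le> ?e" if xs: "xs \<in> words n" "\<not> near xs" for xs
    proof -
      have l: "length xs = n" using xs by (simp add: words_def)
      have "Re (ctrace (Q * tensor_word W xs)) = (\<Sum>k\<in>{k. k < ?N \<and> K k}. tprod d b xs k)"
        using bQ[of xs K] tensor_word_const[of ys xs VA] unfolding Q_def VAn_def by (simp add: ly l)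
      also have "\<dots> = (\<Sum>k\<in>{k. k < d ^ length xs \<and> real n * (a - \<delta>) \<le> tsum d (\<lambda>_. al) xs k}. tprod d b xs k)"
        using tsum_const[of ys xs d al] unfolding K_def be_def by (simp add: ly l)
      also have "\<dots> \<le> exp (- (\<delta>\<^sup>2 / (4 * B\<^sup>2)) * real (length xs))"
      proof (rule chernoff_tprod)
        have "(\<Sum>x\<leftarrow>xs. \<Sum>i<d. b x i * al i) \<le> (\<Sum>x\<leftarrow>xs. - vn_entropy (W x))"
        proof (rule sum_list_mono)
          show "(\<Sum>i<d. b x i * al i) \<le> - vn_entropy (W x)" for x using dual[of x] b(3)[of x] by linarith
        qed
        also have "\<dots> = - Hs xs" unfolding Hs_def by (induction xs) auto
        also have "\<dots> \<le> real n * (a - 2 * \<delta>)" using xs(2) by (simp add: near_def algebra_simps)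
        finally show "(\<Sum>x\<leftarrow>xs. \<Sum>i<d. b x i * al i) + real (length xs) * \<delta> \<le> real n * (a - \<delta>)"
          by (simp add: l algebra_simps)
      qed (use b \<delta> B Bal in auto)
      finally show ?thesis by (simp add: l c_def)
    qed
    define Uw where "Uw xs = tensor_word U xs" for xs
    have uUw: "unitary ?N (Uw xs)" if "xs \<in> words n" for xs
      using unitary_tensor_word[of d U xs, OF uU] that by (simp add: Uw_def words_def)
    have sUw: "spec_decomp (tensor_word W xs) (Uw xs) (tprod d mu xs)" for xs
      unfolding Uw_def by (rule spec_decomp_tensor_word[OF cW sW])
    have mu0: "0 \<le> tprod d mu xs k" if "xs \<in> words n" "k < ?N" for xs k
      using that by (intro tprod_nonneg mu) (auto simp: words_def)
    have mu1: "(\<Sum>k<?N. tprod d mu xs k) = 1" if "xs \<in> words n" for xs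
      using tensor_word_spec_states(1)[of W d U mu xs, OF cW sW mu] that by (simp add: words_def)
    have trW: "ctrace (tensor_word W xs) = 1" for xs
      by (rule tensor_word_spec_states(2)[of W d U mu xs, OF cW sW mu])
    \<comment> \<open>Indices of the typical eigenvectors. Each has weight at least 2^-(Hs + n
      \<open>\<delta>\<close>) and the weights sum to 1, which bounds their number.\<close>
    define G where "G xs = {k. k < ?N \<and> 2 powr (- (Hs xs + real n * \<delta>)) \<le> tprod d mu xs k}" for xs
    have cG: "real (card (G xs)) \<le> 2 powr (Hs xs + real n * \<delta>)" if xs: "xs \<in> words n" for xs
    proof -
      have "real (card (G xs)) * 2 powr (- (Hs xs + real n * \<delta>)) = (\<Sum>k\<in>G xs. 2 powr (- (Hs xs + real n * \<delta>)))"
        by simp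
      also have "\<dots> \<le> (\<Sum>k\<in>G xs. tprod d mu xs k)" by (rule sum_mono) (auto simp: G_def)
      also have "\<dots> \<le> (\<Sum>k<?N. tprod d mu xs k)" by (rule sum_mono2) (use mu0[OF xs] in \<open>auto simp: G_def\<close>)
      finally have "real (card (G xs)) * 2 powr (- (Hs xs + real n * \<delta>)) \<le> 1" using mu1[OF xs] by simp
      thus ?thesis unfolding powr_minus by (simp add: field_simps)
    qed
    have bad: "(\<Sum>k\<in>{..<?N} - G xs. tprod d mu xs k) \<le> ?e" if xs: "xs \<in> words n" for xs
    proof -
      have l: "length xs = n" using xs by (simp add: words_def)
      \<comment> \<open>Zero eigenvalues are discarded first: they carry no weight, and with
        \<open>log 2 0 = 0\<close> their logarithm would not be the sum over the sites.\<close>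
      have "(\<Sum>k\<in>{..<?N} - G xs. tprod d mu xs k) = (\<Sum>k\<in>{k\<in>{..<?N} - G xs. tprod d mu xs k \<noteq> 0}. tprod d mu xs k)"
        by (rule sum.mono_neutral_right) auto
      also have "\<dots> \<le> (\<Sum>k\<in>{k. k < d ^ length xs \<and> Hs xs + real n * \<delta> \<le> tsum d (\<lambda>x i. - log 2 (mu x i)) xs k}. tprod d mu xs k)"
      proof (rule sum_mono2)
        show "{k \<in> {..<?N} - G xs. tprod d mu xs k \<noteq> 0} \<subseteq>
           {k. k < d ^ length xs \<and> Hs xs + real n * \<delta> \<le> tsum d (\<lambda>x i. - log 2 (mu x i)) xs k}"
        proof safe
          fix k assume k: "k < ?N" "k \<notin> G xs" "tprod d mu xs k \<noteq> 0"
          hence pos: "0 < tprod d mu xs k" using mu0[OF xs k(1)] by simp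
          have "tprod d mu xs k < 2 powr (- (Hs xs + real n * \<delta>))" using k by (auto simp: G_def)
          hence "log 2 (tprod d mu xs k) < - (Hs xs + real n * \<delta>)" using pos by (simp add: log_less_iff)
          moreover have "log 2 (tprod d mu xs k) = tsum d (\<lambda>x i. log 2 (mu x i)) xs k"
            by (rule log_tprod) (use mu k pos l in auto)
          ultimately show "Hs xs + real n * \<delta> \<le> tsum d (\<lambda>x i. - log 2 (mu x i)) xs k" by (simp add: tsum_uminus)
        qed (auto simp: l)
      qed (auto intro!: mu0[OF xs] simp: l)
      also have "\<dots> \<le> exp (- (\<delta>\<^sup>2 / (4 * B\<^sup>2)) * real (length xs))"
      proof (rule chernoff_tprod)
        have "(\<Sum>i<d. mu x i * - log 2 (mu x i)) = vn_entropy (W x)" for x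
          using vn_entropy_spec[OF cW sW mu(1)] by (simp add: sum_negf)
        thus "(\<Sum>x\<leftarrow>xs. \<Sum>i<d. mu x i * - log 2 (mu x i)) + real (length xs) * \<delta> \<le> Hs xs + real n * \<delta>"
          by (simp add: l Hs_def)
      qed (use mu \<delta> B Bmu in auto)
      finally show ?thesis by (simp add: l c_def)
    qed
    define colv where "colv xs k = mat ?N 1 (\<lambda>(i,j). Uw xs $$ (i,k))" for xs k
    have vc: "colv xs k \<in> carrier_mat ?N 1" for xs k by (simp add: colv_def)
    define Ws where "Ws = (\<Union>xs\<in>{xs\<in>S. near xs}. (\<lambda>k. Q * colv xs k) ` G xs)"
    have finG: "finite (G xs)" for xs by (simp add: G_def)
    have fW: "finite Ws" unfolding Ws_def using S(1) finG by auto
    have Wsc: "Ws \<subseteq> carrier_mat ?N 1" unfolding Ws_def using Qc vc by (auto intro!: mult_carrier_mat)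
    \<comment> \<open>The exponent combines 2 \<open>\<delta>\<close> from the entropy bound of near
      words and one \<open>\<delta>\<close> from typicality.\<close>
    have cardW: "real (card Ws) \<le> real M * 2 powr (real n * (3 * \<delta> - a))"
    proof -
      have "card Ws \<le> (\<Sum>xs\<in>{xs\<in>S. near xs}. card ((\<lambda>k. Q * colv xs k) ` G xs))"
        unfolding Ws_def using S(1) by (intro card_UN_le) auto
      also have "\<dots> \<le> (\<Sum>xs\<in>{xs\<in>S. near xs}. card (G xs))" by (intro sum_mono card_image_le finG)
      finally have "real (card Ws) \<le> (\<Sum>xs\<in>{xs\<in>S. near xs}. real (card (G xs)))"
        by (metis of_nat_le_iff of_nat_sum)
      also have "\<dots> \<le> (\<Sum>xs\<in>{xs\<in>S. near xs}. 2 powr (real n * (3 * \<delta> - a)))"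
      proof (rule sum_mono)
        fix xs assume xs: "xs \<in> {xs\<in>S. near xs}"
        hence "real (card (G xs)) \<le> 2 powr (Hs xs + real n * \<delta>)" using S(2) by (intro cG) auto
        also have "\<dots> \<le> 2 powr (real n * (3 * \<delta> - a))"
          using xs by (intro powr_mono) (auto simp: near_def algebra_simps)
        finally show "real (card (G xs)) \<le> 2 powr (real n * (3 * \<delta> - a))" .
      qed
      also have "\<dots> = real (card {xs\<in>S. near xs}) * 2 powr (real n * (3 * \<delta> - a))" by simp
      also have "\<dots> \<le> real M * 2 powr (real n * (3 * \<delta> - a))"
        using S card_mono[OF S(1), of "{xs\<in>S. near xs}"] by (intro mult_right_mono) auto
      finally show ?thesis .
    qed
    obtain P where P: "projector ?N P" "Re (ctrace P) \<le> real (card Ws)" "\<And>w. w \<in> Ws \<Longrightarrow> P * w = w"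
      and PQ': "\<And>Q. Q \<in> carrier_mat ?N ?N \<Longrightarrow> (\<And>w. w \<in> Ws \<Longrightarrow> Q * w = w) \<Longrightarrow> Q * P = P"
      using span_projector_exists[OF fW Wsc] by blast
    note Pc = projectorD[OF P(1)]
    have QP: "Q * P = P"
    proof (rule PQ'[OF Qc(1)])
      fix w assume "w \<in> Ws"
      then obtain xs k where w: "w = Q * colv xs k" by (auto simp: Ws_def)
      have "Q * w = (Q * Q) * colv xs k" unfolding w
        using Qc(1) vc[of xs k] by (simp add: mat_assoc)
      thus "Q * w = w" by (simp add: Qc(3) w)
    qed
    have PQ: "P * Q = P"
    proof -
      have "adj (Q * P) = adj P" using QP by simp
      thus ?thesis using Qc Pc by (simp add: adj_mult_dim)
    qed
    define E where "E = Q - P"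
    have E: "projector ?N E" unfolding E_def by (rule projector_minus[OF Q P(1) QP])
    have trP0: "0 \<le> Re (ctrace (P * tensor_word W xs))" if xs: "xs \<in> words n" for xs
      unfolding Re_ctrace_spec_decomp[OF tensor_word_carrier_words[of W, OF cW xs] Pc(1) sUw]
      using mu0[OF xs] projector_conj_diag_bounds(1)[OF P(1) uUw[OF xs]]
      by (intro sum_nonneg mult_nonneg_nonneg) auto
    have trE: "Re (ctrace (E * X)) = Re (ctrace (Q * X)) - Re (ctrace (P * X))" if X: "X \<in> carrier_mat ?N ?N" for X
    proof -
      have "E * X = Q * X - P * X" unfolding E_def using Qc(1) Pc(1) X by (simp add: minus_mult_dim)
      thus ?thesis using ctrace_minus[of "Q * X" ?N "P * X"] Qc(1) Pc(1) X by simp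
    qed
    \<comment> \<open>A word that is not near is rejected by Q already. For a near word E
      annihilates all typical eigenvectors, so only the atypical weight remains.\<close>
    have EW: "Re (ctrace (E * tensor_word W xs)) \<le> ?e" if xs: "xs \<in> S" for xs
    proof (cases "near xs")
      case False
      have xw: "xs \<in> words n" using xs S by auto
      show ?thesis using trE[OF tensor_word_carrier_words[of W, OF cW xw]] far[OF xw False] trP0[OF xw] by simp
    next
      case True
      have xw: "xs \<in> words n" using xs S by auto
      have zero: "(adj (Uw xs) * E * Uw xs) $$ (k,k) = 0" if k: "k \<in> G xs" for k
      proof -
        have kN: "k < ?N" using k by (simp add: G_def)
        have "Q * colv xs k \<in> Ws" using xs True k by (auto simp: Ws_def)
        hence "P * (Q * colv xs k) = Q * colv xs k" by (rule P(3))
        moreover have "P * (Q * colv xs k) = (P * Q) * colv xs k"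
          using Qc(1) Pc(1) vc[of xs k] by (simp add: mat_assoc)
        ultimately have "Q * colv xs k = P * colv xs k" using PQ by simp
        hence Ev: "E * colv xs k = 0\<^sub>m ?N 1" unfolding E_def
          using Qc(1) Pc(1) vc[of xs k] by (simp add: minus_mult_dim)
        have "(E * Uw xs) $$ (i,k) = 0" if i: "i < ?N" for i
        proof -
          have "(E * Uw xs) $$ (i,k) = (\<Sum>l<?N. E $$ (i,l) * Uw xs $$ (l,k))"
            by (rule mult_mat_index[OF projectorD(1)[OF E] unitaryD(1)[OF uUw[OF xw]] i kN])
          also have "\<dots> = (\<Sum>l<?N. E $$ (i,l) * colv xs k $$ (l,0))" by (simp add: colv_def)
          also have "\<dots> = (E * colv xs k) $$ (i,0)"
            by (rule mult_mat_index[OF projectorD(1)[OF E] vc i, symmetric]) simp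
          finally show ?thesis using i by (simp add: Ev)
        qed
        thus ?thesis unfolding projector_conj_diag[OF E uUw[OF xw] kN] by simp
      qed
      have "Re (ctrace (E * tensor_word W xs)) = (\<Sum>k<?N. tprod d mu xs k * Re ((adj (Uw xs) * E * Uw xs) $$ (k,k)))"
        by (rule Re_ctrace_spec_decomp[OF tensor_word_carrier_words[of W, OF cW xw] projectorD(1)[OF E] sUw])
      also have "\<dots> = (\<Sum>k\<in>{..<?N} - G xs. tprod d mu xs k * Re ((adj (Uw xs) * E * Uw xs) $$ (k,k)))"
        by (rule sum.mono_neutral_right) (auto simp: zero simp del: index_mult_mat(1))
      also have "\<dots> \<le> (\<Sum>k\<in>{..<?N} - G xs. tprod d mu xs k * 1)"
        using mu0[OF xw] projector_conj_diag_bounds(2)[OF E uUw[OF xw]]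
        by (intro sum_mono mult_left_mono) auto
      also have "\<dots> \<le> ?e" using bad[OF xw] by simp
      finally show ?thesis .
    qed
    have E\<sigma>: "Re (ctrace (E * \<sigma>)) \<le> ?e"
    proof -
      have "Re (ctrace (E * \<sigma>)) = (\<Sum>xs\<in>words n. q xs * Re (ctrace (E * tensor_word W xs)))"
        unfolding \<sigma>_def ctrace_mult_avg_state_n[of W, OF cW projectorD(1)[OF E]] by simp
      also have "\<dots> \<le> (\<Sum>xs\<in>words n. q xs * ?e)"
      proof (rule sum_mono)
        fix xs
        show "q xs * Re (ctrace (E * tensor_word W xs)) \<le> q xs * ?e"
        proof (cases "q xs = 0")
          case False
          hence "0 < q xs" using qn by (auto simp: prob_dist_n_def order_less_le)
          thus ?thesis using EW[of xs] by (intro mult_left_mono) (auto simp: S_def)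
        qed simp
      qed
      also have "\<dots> = ?e" using qn by (simp add: prob_dist_n_def flip: sum_distrib_right)
      finally show ?thesis .
    qed
    have P\<rho>: "Re (ctrace (P * \<rho>n)) \<le> ?e + real M * 2 powr (real n * (4 * \<delta> - a - h))"
    proof -
      \<comment> \<open>Eigenvalues of the target above this size are atypical and have total weight
        at most \<open>?e\<close>. The factor 2^(n \<open>\<delta>\<close>) in \<open>lam\<close>
        raises 3 \<open>\<delta>\<close> to 4 \<open>\<delta>\<close>.\<close>
      define lam where "lam = 2 powr (- (real n * (h - \<delta>)))"
      define R where "R = tprod d (\<lambda>_::'x. r) ys"
      have sd: "spec_decomp \<rho>n (tensor_word (\<lambda>_. V) ys) R" unfolding \<rho>n_def R_def
        by (rule spec_decomp_tensor_word) (use s\<rho> in auto)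
      have R0: "0 \<le> R k" if "k < ?N" for k unfolding R_def using that r by (intro tprod_nonneg) (auto simp: ly)
      have "Re (ctrace (P * \<rho>n)) \<le> (\<Sum>k\<in>{k. k < ?N \<and> R k > lam}. R k) + lam * (real M * 2 powr (real n * (3 * \<delta> - a)))"
        by (rule projector_ctrace_le[OF c\<rho> sd R0 P(1)]) (use P(2) cardW in \<open>auto simp: lam_def\<close>)
      also have "lam * (real M * 2 powr (real n * (3 * \<delta> - a))) = real M * 2 powr (real n * (4 * \<delta> - a - h))"
        unfolding lam_def by (simp add: mult.left_commute algebra_simps flip: powr_add)
      also have "(\<Sum>k\<in>{k. k < ?N \<and> R k > lam}. R k) \<le>
        (\<Sum>k\<in>{k. k < d ^ length ys \<and> - (real n * (h - \<delta>)) \<le> tsum d (\<lambda>_ i. log 2 (r i)) ys k}. R k)"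
      proof (rule sum_mono2)
        show "{k. k < ?N \<and> R k > lam} \<subseteq> {k. k < d ^ length ys \<and> - (real n * (h - \<delta>)) \<le> tsum d (\<lambda>_ i. log 2 (r i)) ys k}"
        proof safe
          fix k assume k: "k < ?N" "lam < R k"
          have pos: "0 < R k" using k(2) by (simp add: lam_def) (metis less_trans powr_gt_zero zero_less_numeral zero_neq_numeral)
          have "log 2 (R k) = tsum d (\<lambda>_ i. log 2 (r i)) ys k" unfolding R_def
            by (rule log_tprod) (use r k pos in \<open>auto simp: ly R_def\<close>)
          moreover have "- (real n * (h - \<delta>)) < log 2 (R k)"
            using k(2) pos unfolding lam_def by (simp add: less_log_iff)
          ultimately show "- (real n * (h - \<delta>)) \<le> tsum d (\<lambda>_ i. log 2 (r i)) ys k" by simp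
        qed (auto simp: ly)
      qed (auto intro!: R0 simp: ly)
      also have "\<dots> \<le> exp (- (\<delta>\<^sup>2 / (4 * B\<^sup>2)) * real (length ys))" unfolding R_def
      proof (rule chernoff_tprod)
        have "(\<Sum>i<d. r i * log 2 (r i)) = - h"
          using vn_entropy_spec[OF avg_state_carrier s\<rho> r(1)] h by simp
        thus "(\<Sum>x\<leftarrow>ys. \<Sum>i<d. r i * log 2 (r i)) + real (length ys) * \<delta> \<le> - (real n * (h - \<delta>))"
          by (simp add: ys_def sum_list_replicate algebra_simps)
      qed (use r \<delta> B Br in auto)
      finally show ?thesis by (simp add: ly c_def)
    qed
    have X: "\<rho>n - \<sigma> \<in> carrier_mat ?N ?N" using c\<sigma> by auto
    have "hermitian (\<rho>n - \<sigma>)"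
    proof (rule hermitianI[OF X])
      have "adj \<rho>n = \<rho>n" "adj \<sigma> = \<sigma>"
        using hermitian_avg_state_n[of d W, OF DW] \<rho>n unfolding \<sigma>_def by (auto dest!: hermitianD simp: hermitian_def)
      thus "adj (\<rho>n - \<sigma>) = \<rho>n - \<sigma>" using adj_minus[OF c\<rho> c\<sigma>] by simp
    qed
    moreover have "Re (ctrace (\<rho>n - \<sigma>)) = 0"
      unfolding ctrace_minus[OF c\<rho> c\<sigma>]
      using ctrace_avg_state_n[of W, OF cW trW qn] ctrace_avg_state_n[of W, OF cW trW prob_dist_n_iid[OF p, of n]]
      by (simp add: \<rho>n \<sigma>_def)
    ultimately have "2 * Re (ctrace (E * (\<rho>n - \<sigma>))) \<le> trace_norm (\<rho>n - \<sigma>)"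
      by (intro trace_norm_ge_test[OF X _ _ E])
    moreover have "Re (ctrace (E * (\<rho>n - \<sigma>))) = Re (ctrace (E * \<rho>n)) - Re (ctrace (E * \<sigma>))"
    proof -
      have "E * (\<rho>n - \<sigma>) = E * \<rho>n - E * \<sigma>"
        by (rule mult_minus_distrib_mat[OF projectorD(1)[OF E] c\<rho> c\<sigma>])
      thus ?thesis using ctrace_minus[of "E * \<rho>n" ?N "E * \<sigma>"] projectorD(1)[OF E] c\<rho> c\<sigma> by simp
    qed
    ultimately have "1 - trace_norm (\<rho>n - \<sigma>) / 2 \<le> 1 - Re (ctrace (E * \<rho>n)) + Re (ctrace (E * \<sigma>))" by simp
    \<comment> \<open>One exponential each from Q missing the target, from the atypical weight of
      the target under P, and from the codebook state passing E.\<close>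
    also have "\<dots> \<le> 3 * ?e + real M * 2 powr (real n * (4 * \<delta> - a - h))"
      using trE[OF c\<rho>] trQ\<rho> P\<rho> E\<sigma> by simp
    finally show ?thesis unfolding \<rho>n \<sigma>_def .
  qed
  thus ?thesis using c by blast
qed

subsection \<open>Covering\<close>

lemma exists_le_average:
  fixes f w :: "'a \<Rightarrow> real"
  assumes "finite S" "\<And>x. x \<in> S \<Longrightarrow> 0 \<le> w x" "(\<Sum>x\<in>S. w x) = 1"
  shows "\<exists>x\<in>S. f x \<le> (\<Sum>x\<in>S. w x * f x)"
proof (rule ccontr)
  assume "\<not> ?thesis"
  hence gt: "\<And>x. x \<in> S \<Longrightarrow> (\<Sum>x\<in>S. w x * f x) < f x" by force
  obtain x0 where x0: "x0 \<in> S" "0 < w x0"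
    using assms by (metis less_eq_real_def sum.neutral zero_neq_one)
  have "(\<Sum>x\<in>S. w x * (\<Sum>x\<in>S. w x * f x)) < (\<Sum>x\<in>S. w x * f x)"
  proof (rule sum_strict_mono_ex1[OF assms(1)])
    show "\<forall>x\<in>S. w x * (\<Sum>x\<in>S. w x * f x) \<le> w x * f x"
      using gt assms(2) by (intro ballI mult_left_mono) (auto intro: less_imp_le)
    show "\<exists>a\<in>S. w a * (\<Sum>x\<in>S. w x * f x) < w a * f a" using x0 gt by (intro bexI[of _ x0] mult_strict_left_mono) auto
  qed
  moreover have "(\<Sum>x\<in>S. w x * (\<Sum>x\<in>S. w x * f x)) = (\<Sum>x\<in>S. w x * f x)"
    unfolding sum_distrib_right[symmetric] assms(3) by simp
  ultimately show False by linarith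
qed

lemma cmod_add_power2: "(cmod (a + b))\<^sup>2 = (cmod a)\<^sup>2 + 2 * Re (cnj a * b) + (cmod b)\<^sup>2"
  unfolding cmod_power2 by (simp add: power2_eq_square algebra_simps)

text \<open>Derandomised form of the second moment bound for an i.i.d. codebook: the codewords are chosen
  one after the other by the method of conditional expectations.\<close>

lemma greedy_codebook:
  fixes Y :: "'a \<Rightarrow> 'i \<Rightarrow> complex" and w L :: "'a \<Rightarrow> real"
  assumes S: "finite S" and w: "\<And>x. x \<in> S \<Longrightarrow> 0 \<le> w x" "(\<Sum>x\<in>S. w x) = 1" and I: "finite I" and C: "0 \<le> C"
  defines "m \<equiv> \<lambda>i. \<Sum>x\<in>S. complex_of_real (w x) * Y x i"
  shows "\<exists>cs. length cs = M \<and> set cs \<subseteq> S \<and>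
    C * (\<Sum>i\<in>I. (cmod (\<Sum>x\<leftarrow>cs. Y x i - m i))\<^sup>2) + (\<Sum>x\<leftarrow>cs. L x)
      \<le> real M * (C * (\<Sum>x\<in>S. w x * (\<Sum>i\<in>I. (cmod (Y x i))\<^sup>2)) + (\<Sum>x\<in>S. w x * L x))"
proof (induction M)
  case 0
  show ?case by (intro exI[of _ "[]"]) simp
next
  case (Suc M)
  define V where "V = C * (\<Sum>x\<in>S. w x * (\<Sum>i\<in>I. (cmod (Y x i))\<^sup>2)) + (\<Sum>x\<in>S. w x * L x)"
  obtain cs where cs: "length cs = M" "set cs \<subseteq> S"
    and le: "C * (\<Sum>i\<in>I. (cmod (\<Sum>x\<leftarrow>cs. Y x i - m i))\<^sup>2) + (\<Sum>x\<leftarrow>cs. L x) \<le> real M * V"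
    using Suc.IH unfolding V_def by blast
  define s where "s i = (\<Sum>x\<leftarrow>cs. Y x i - m i)" for i
  \<comment> \<open>The part of the left side that depends on the next codeword. Besides the squared
    error it carries a linear cost \<open>L\<close>, so that one codebook is good for several
    criteria at once.\<close>
  define f where "f x = C * (\<Sum>i\<in>I. (cmod (s i + (Y x i - m i)))\<^sup>2) + L x" for x
  obtain x where x: "x \<in> S" "f x \<le> (\<Sum>x\<in>S. w x * f x)"
    using exists_le_average[of S w f] S w by blast
  \<comment> \<open>The average over x adds only the variance of Y to |s_i|^2, as Y - m has mean 0;
    the variance is bounded by the second moment.\<close>
  have var: "(\<Sum>x\<in>S. w x * (cmod (s i + (Y x i - m i)))\<^sup>2) \<le> (cmod (s i))\<^sup>2 + (\<Sum>x\<in>S. w x * (cmod (Y x i))\<^sup>2)" for i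
  proof -
    define t where "t = s i - m i"
    have "(\<Sum>x\<in>S. w x * (cmod (s i + (Y x i - m i)))\<^sup>2)
      = (\<Sum>x\<in>S. w x * (cmod t)\<^sup>2 + 2 * Re (cnj t * (complex_of_real (w x) * Y x i)) + w x * (cmod (Y x i))\<^sup>2)"
    proof (rule sum.cong[OF refl])
      fix x
      have "s i + (Y x i - m i) = t + Y x i" by (simp add: t_def)
      thus "w x * (cmod (s i + (Y x i - m i)))\<^sup>2 = w x * (cmod t)\<^sup>2 + 2 * Re (cnj t * (complex_of_real (w x) * Y x i)) + w x * (cmod (Y x i))\<^sup>2"
        by (simp only: cmod_add_power2) (simp add: algebra_simps)
    qed
    also have "\<dots> = (\<Sum>x\<in>S. w x) * (cmod t)\<^sup>2 + 2 * Re (cnj t * m i) + (\<Sum>x\<in>S. w x * (cmod (Y x i))\<^sup>2)"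
      unfolding m_def sum.distrib sum_distrib_right sum_distrib_left Re_sum by simp
    also have "(\<Sum>x\<in>S. w x) * (cmod t)\<^sup>2 + 2 * Re (cnj t * m i) = (cmod (t + m i))\<^sup>2 - (cmod (m i))\<^sup>2"
      unfolding cmod_add_power2 w(2) by simp
    also have "t + m i = s i" by (simp add: t_def)
    finally show ?thesis by simp
  qed
  have "(\<Sum>x\<in>S. w x * f x) = C * (\<Sum>i\<in>I. \<Sum>x\<in>S. w x * (cmod (s i + (Y x i - m i)))\<^sup>2) + (\<Sum>x\<in>S. w x * L x)"
    unfolding f_def distrib_left sum.distrib sum_distrib_left
    by (subst sum.swap) (simp add: mult.left_commute)
  also have "\<dots> \<le> C * (\<Sum>i\<in>I. (cmod (s i))\<^sup>2 + (\<Sum>x\<in>S. w x * (cmod (Y x i))\<^sup>2)) + (\<Sum>x\<in>S. w x * L x)"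
    by (intro add_right_mono mult_left_mono sum_mono var C)
  also have "\<dots> = C * (\<Sum>i\<in>I. (cmod (s i))\<^sup>2) + V"
  proof -
    have "(\<Sum>i\<in>I. \<Sum>x\<in>S. w x * (cmod (Y x i))\<^sup>2) = (\<Sum>x\<in>S. w x * (\<Sum>i\<in>I. (cmod (Y x i))\<^sup>2))"
      unfolding sum_distrib_left by (rule sum.swap)
    thus ?thesis by (simp add: sum.distrib V_def algebra_simps)
  qed
  finally have "f x \<le> C * (\<Sum>i\<in>I. (cmod (s i))\<^sup>2) + V" using x(2) by simp
  hence "C * (\<Sum>i\<in>I. (cmod (\<Sum>x\<leftarrow>x # cs. Y x i - m i))\<^sup>2) + (\<Sum>x\<leftarrow>x # cs. L x)
     \<le> C * (\<Sum>i\<in>I. (cmod (s i))\<^sup>2) + (\<Sum>x\<leftarrow>cs. L x) + V"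
    unfolding f_def by (simp add: s_def add.commute)
  also have "\<dots> \<le> real (Suc M) * V" using le unfolding s_def by (simp add: algebra_simps)
  finally show ?case using cs x(1) unfolding V_def by (intro exI[of _ "x # cs"]) simp
qed

lemma sum_count_list_mult:
  fixes F :: "'a \<Rightarrow> 'b::comm_semiring_1"
  assumes "finite S" "set cs \<subseteq> S"
  shows "(\<Sum>x\<in>S. of_nat (count_list cs x) * F x) = (\<Sum>x\<leftarrow>cs. F x)"
  using assms(2)
proof (induction cs)
  case (Cons c cs)
  have "(\<Sum>x\<in>S. of_nat (count_list (c # cs) x) * F x) = (\<Sum>x\<in>S. (if x = c then F c else 0) + of_nat (count_list cs x) * F x)"
    by (intro sum.cong) (auto simp: algebra_simps)
  thus ?case using Cons assms(1) by (simp add: sum.distrib)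
qed simp

definition code_dist :: "'x list list \<Rightarrow> 'x list \<Rightarrow> real" where
  "code_dist cs xs = real (count_list cs xs) / real (length cs)"

lemma code_dist_types_M:
  fixes cs :: "'x::finite list list"
  assumes "length cs = M" "0 < M" "set cs \<subseteq> words n"
  shows "code_dist cs \<in> types_M n M"
proof -
  have "(\<Sum>xs\<in>words n. code_dist cs xs) = 1"
    unfolding code_dist_def sum_divide_distrib[symmetric]
    using sum_count_list_mult[of "words n" cs "\<lambda>_. 1::real"] assms by (simp add: sum_list_triv)
  moreover have "code_dist cs xs = 0" if "xs \<notin> words n" for xs
    using that assms(3) by (auto simp: code_dist_def count_list_0_iff)
  moreover have "real M * code_dist cs xs \<in> \<int>" for xs using assms by (simp add: code_dist_def)
  ultimately show ?thesis by (auto simp: types_M_def prob_dist_n_def code_dist_def)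
qed

lemma sum_code_dist:
  fixes F :: "'x::finite list \<Rightarrow> real"
  assumes "set cs \<subseteq> words n"
  shows "(\<Sum>xs\<in>words n. code_dist cs xs * F xs) = (\<Sum>xs\<leftarrow>cs. F xs) / real (length cs)"
  using sum_count_list_mult[of "words n" cs F] assms
  by (simp add: code_dist_def sum_divide_distrib[symmetric])

section \<open>Trace norm and Hilbert-Schmidt estimates\<close>

lemma unitary_column_norm:
  assumes U: "unitary n U" and k: "k < n"
  shows "(\<Sum>i<n. (cmod (U $$ (i,k)))\<^sup>2) = 1"
proof -
  note c = unitaryD(1)[OF U]
  have "complex_of_real (\<Sum>i<n. (cmod (U $$ (i,k)))\<^sup>2) = (\<Sum>i<n. adj U $$ (k,i) * U $$ (i,k))"
    using k c by (auto simp: complex_norm_square mult.commute simp del: of_real_power intro!: sum.cong)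
  also have "\<dots> = (adj U * U) $$ (k,k)" by (rule mult_mat_index[symmetric]) (use k c in auto)
  also have "\<dots> = 1" using k by (simp add: unitaryD(3)[OF U])
  finally show ?thesis by (simp only: of_real_eq_1_iff)
qed

text \<open>Stands in for the Cauchy-Schwarz inequality and avoids square roots. The price is the
  free weight t, which survives into the covering bound and is fixed only in the limit.\<close>

lemma weighted_amgm:
  fixes x y t :: real
  assumes "0 < t"
  shows "x * y \<le> t / 2 * x\<^sup>2 + y\<^sup>2 / (2 * t)"
proof -
  have "0 \<le> (t * x - y)\<^sup>2 / (2 * t)" using assms by simp
  also have "\<dots> = t / 2 * x\<^sup>2 + y\<^sup>2 / (2 * t) - x * y"
    using assms by (simp add: power2_eq_square field_simps)
  finally show ?thesis by simp
qed

text \<open>The entry is the inner product of T u_k with P u_k. The first vector has norm 1, and the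
  squared norm of the second is the diagonal entry of P; weighting favours the case where P rarely
  accepts u_k.\<close>

lemma conj_diag_unitary_projector_le:
  assumes T: "unitary n T" "adj T = T" and P: "projector n P" and U: "unitary n U" and k: "k < n" and t: "0 < t"
  shows "\<bar>Re ((adj U * (T * P) * U) $$ (k,k))\<bar> \<le> t / 2 + Re ((adj U * P * U) $$ (k,k)) / (2 * t)"
proof -
  note c = unitaryD(1)[OF U] unitaryD(1)[OF T(1)] projectorD[OF P]
  have TU: "T * U \<in> carrier_mat n n" and PU: "P * U \<in> carrier_mat n n" using c by auto
  have "adj U * (T * P) * U = adj (T * U) * (P * U)"
    using c T(2) by (simp add: adj_mult_dim mat_assoc)
  hence "(adj U * (T * P) * U) $$ (k,k) = (\<Sum>i<n. adj (T * U) $$ (k,i) * (P * U) $$ (i,k))"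
    using k TU PU by (simp only:) (rule mult_mat_index; simp)
  also have "\<dots> = (\<Sum>i<n. cnj ((T * U) $$ (i,k)) * (P * U) $$ (i,k))"
    using k c by (intro sum.cong) (auto simp del: index_mult_mat(1))
  finally have "cmod ((adj U * (T * P) * U) $$ (k,k)) \<le> (\<Sum>i<n. cmod ((T * U) $$ (i,k)) * cmod ((P * U) $$ (i,k)))"
    using norm_sum[of "\<lambda>i. cnj ((T * U) $$ (i,k)) * (P * U) $$ (i,k)" "{..<n}"] by (simp add: norm_mult del: index_mult_mat(1))
  also have "\<dots> \<le> (\<Sum>i<n. t / 2 * (cmod ((T * U) $$ (i,k)))\<^sup>2 + (cmod ((P * U) $$ (i,k)))\<^sup>2 / (2 * t))"
    by (intro sum_mono weighted_amgm t)
  also have "\<dots> = t / 2 * (\<Sum>i<n. (cmod ((T * U) $$ (i,k)))\<^sup>2) + (\<Sum>i<n. (cmod ((P * U) $$ (i,k)))\<^sup>2) / (2 * t)"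
    by (simp only: sum.distrib sum_distrib_left sum_divide_distrib)
  also have "(\<Sum>i<n. (cmod ((T * U) $$ (i,k)))\<^sup>2) = 1"
    by (rule unitary_column_norm[OF unitary_mult[OF T(1) U] k])
  also have "(\<Sum>i<n. (cmod ((P * U) $$ (i,k)))\<^sup>2) = Re ((adj U * P * U) $$ (k,k))"
    unfolding projector_conj_diag[OF P U k] by simp
  finally show ?thesis using abs_Re_le_cmod order_trans by fastforce
qed

text \<open>T is the sign of X. Zero eigenvalues get sign +1, so that T remains unitary.\<close>

lemma trace_norm_eq_unitary:
  assumes X: "X \<in> carrier_mat n n" "hermitian X"
  shows "\<exists>T. unitary n T \<and> adj T = T \<and> trace_norm X = Re (ctrace (T * X))"
proof -
  obtain U x where sd: "spec_decomp X U x" using hermitian_spec_decomp_exists[OF X] by blast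
  hence U: "unitary n U" using spec_decomp_iff[OF X(1)] by blast
  note c = unitaryD(1)[OF U]
  define s where "s k = (if 0 \<le> x k then 1 else -1 :: real)" for k
  let ?D = "mat_diag n (\<lambda>k. complex_of_real (s k))"
  define T where "T = U * ?D * adj U"
  have cT: "T \<in> carrier_mat n n" using c by (auto simp: T_def)
  have sT: "spec_decomp T U s" unfolding spec_decomp_iff[OF cT] using U by (simp add: T_def)
  have aT: "adj T = T" by (rule hermitianD[OF spec_decomp_hermitian[OF cT sT]])
  have "complex_of_real (s k) * complex_of_real (s k) = 1" for k by (simp add: s_def)
  hence "?D * ?D = 1\<^sub>m n" by (simp add: mat_diag_diag)
  hence DD: "?D * (?D * Z) = Z" if "dim_row Z = n" for Z
    using that by (simp add: mat_assoc[symmetric] left_mult_one_mat')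
  have "T * T = 1\<^sub>m n" unfolding T_def
    by (simp add: mat_assoc unitary_dim[OF U] unitary_cancel[OF U] DD unitaryD(2)[OF U])
  hence uT: "unitary n T" by (intro unitaryI[OF cT]) (simp add: aT)
  have "Re (ctrace (T * X)) = (\<Sum>k<n. x k * Re ((adj U * T * U) $$ (k,k)))"
    by (rule Re_ctrace_spec_decomp[OF X(1) cT sd])
  also have "\<dots> = (\<Sum>k<n. \<bar>x k\<bar>)"
    unfolding spec_decomp_conj[OF cT sT] by (intro sum.cong) (auto simp: mat_diag_def s_def)
  finally have "trace_norm X = Re (ctrace (T * X))" using trace_norm_spec[OF X(1) sd] by simp
  thus ?thesis using uT aT by blast
qed

lemma sum_cmod2_eq_ctrace:
  assumes "A \<in> carrier_mat n m"
  shows "(\<Sum>i<n. \<Sum>j<m. (cmod (A $$ (i,j)))\<^sup>2) = Re (ctrace (A * adj A))"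
proof -
  have "ctrace (A * adj A) = (\<Sum>i<n. \<Sum>j<m. A $$ (i,j) * adj A $$ (j,i))"
    by (rule ctrace_mult_entries) (use assms in auto)
  also have "\<dots> = (\<Sum>i<n. \<Sum>j<m. complex_of_real ((cmod (A $$ (i,j)))\<^sup>2))"
    using assms by (intro sum.cong refl) (auto simp: complex_norm_square simp del: of_real_power)
  finally show ?thesis by simp
qed

lemma sum_cmod2_spec:
  assumes A: "A \<in> carrier_mat n n" "spec_decomp A U z"
  shows "(\<Sum>i<n. \<Sum>j<n. (cmod (A $$ (i,j)))\<^sup>2) = (\<Sum>k<n. (z k)\<^sup>2)"
proof -
  have "adj A = A" by (rule hermitianD[OF spec_decomp_hermitian[OF A]])
  hence "(\<Sum>i<n. \<Sum>j<n. (cmod (A $$ (i,j)))\<^sup>2) = Re (ctrace (A * A))"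
    using sum_cmod2_eq_ctrace[OF A(1)] by simp
  also have "\<dots> = (\<Sum>k<n. z k * Re ((adj U * A * U) $$ (k,k)))"
    by (rule Re_ctrace_spec_decomp[OF A(1) A(1) A(2)])
  also have "\<dots> = (\<Sum>k<n. (z k)\<^sup>2)"
    unfolding spec_decomp_conj[OF A] by (intro sum.cong) (auto simp: mat_diag_def power2_eq_square)
  finally show ?thesis .
qed

text \<open>The squared Hilbert-Schmidt norm of T P is the rank of P; this is where the dimension of
  the typical subspace enters the covering bound.\<close>

lemma unitary_projector_cmod2:
  assumes T: "unitary n T" and P: "projector n P"
  shows "(\<Sum>i<n. \<Sum>j<n. (cmod ((T * P) $$ (i,j)))\<^sup>2) = Re (ctrace P)"
proof -
  note c = unitaryD(1)[OF T] projectorD[OF P]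
  have "(\<Sum>i<n. \<Sum>j<n. (cmod ((T * P) $$ (i,j)))\<^sup>2) = Re (ctrace ((T * P) * adj (T * P)))"
    by (rule sum_cmod2_eq_ctrace) (use c in auto)
  also have "ctrace ((T * P) * adj (T * P)) = ctrace (adj (T * P) * (T * P))"
    by (rule ctrace_comm) (use c in auto)
  also have "adj (T * P) * (T * P) = P"
    using c by (simp add: adj_mult_dim mat_assoc unitary_cancel[OF T])
  finally show ?thesis .
qed

text \<open>The deviation of the codebook average is measured by T, the sign of the difference. Its
  squared Hilbert-Schmidt size after truncation is at most lam/M, and the typical subspace has
  dimension at most D; their product D lam / M gives the main term, with D lam = 2^(n (h - hc + 2
  \<open>\<delta>\<close>)). The rest is cut off at exponentially small cost.\<close>

lemma covering_one_shot:
  fixes W :: "'x::finite \<Rightarrow> complex mat"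
  assumes W: "cq_channel d W" and q: "prob_dist q"
    and h: "h = vn_entropy (avg_state d W q)" and hc: "hc = (\<Sum>x\<in>UNIV. q x * vn_entropy (W x))"
    and \<delta>: "0 < \<delta>"
  shows "\<exists>c>0. \<forall>n M t. 0 < M \<longrightarrow> 0 < t \<longrightarrow> (\<exists>q'\<in>types_M n M.
     trace_norm (avg_state_n d n W (iid q n) - avg_state_n d n W q')
       \<le> 3 / 2 * t + 2 powr (real n * (h - hc + 2 * \<delta>)) / (2 * t * real M) + (2 + 1 / t) * exp (- c * real n))"
proof -
  let ?\<rho> = "avg_state d W q"
  have DW: "density d (W x)" for x using W by (simp add: cq_channel_def)
  have cW: "W x \<in> carrier_mat d d" for x using DW[of x] by (simp add: density_def)
  have D\<rho>: "density d ?\<rho>" by (rule density_avg_state[OF W q])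
  have "\<forall>x. \<exists>U mu. spec_decomp (W x) U mu \<and> (\<forall>k<d. 0 \<le> mu k) \<and> (\<Sum>k<d. mu k) = 1"
    using density_spec_decomp[OF DW] by blast
  then obtain U mu where sW: "\<And>x. spec_decomp (W x) (U x) (mu x)" and mu: "\<And>x i. i < d \<Longrightarrow> 0 \<le> mu x i" "\<And>x. (\<Sum>i<d. mu x i) = 1"
    by metis
  obtain V r where s\<rho>: "spec_decomp ?\<rho> V r" and r: "\<And>i. i < d \<Longrightarrow> 0 \<le> r i" "(\<Sum>i<d. r i) = 1"
    using density_spec_decomp[OF D\<rho>] by blast
  have uU: "unitary d (U x)" for x using sW[of x] spec_decomp_iff[OF cW] by blast
  have uV: "unitary d V" using s\<rho> spec_decomp_iff[OF avg_state_carrier] by blast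
  define B where "B = \<delta> + (\<Sum>i<d. \<bar>log 2 (r i)\<bar>) + (\<Sum>x\<in>UNIV. \<Sum>i<d. \<bar>log 2 (mu x i)\<bar>)"
  have B: "\<delta> \<le> B" and Br: "\<And>i. i < d \<Longrightarrow> \<bar>log 2 (r i)\<bar> \<le> B"
    and Bmu: "\<And>x i. i < d \<Longrightarrow> \<bar>log 2 (mu x i)\<bar> \<le> B"
  proof -
    have nn: "0 \<le> (\<Sum>i<d. \<bar>log 2 (r i)\<bar>)" "0 \<le> (\<Sum>x\<in>UNIV. \<Sum>i<d. \<bar>log 2 (mu x i)\<bar>)"
      by (auto intro!: sum_nonneg)
    show "\<delta> \<le> B" unfolding B_def using nn by linarith
    show "\<bar>log 2 (r i)\<bar> \<le> B" if "i < d" for i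
    proof -
      have "\<bar>log 2 (r i)\<bar> \<le> (\<Sum>i<d. \<bar>log 2 (r i)\<bar>)" using that by (intro member_le_sum) auto
      thus ?thesis unfolding B_def using nn \<delta> by linarith
    qed
    show "\<bar>log 2 (mu x i)\<bar> \<le> B" if "i < d" for x i
    proof -
      have "\<bar>log 2 (mu x i)\<bar> \<le> (\<Sum>i<d. \<bar>log 2 (mu x i)\<bar>)" using that by (intro member_le_sum) auto
      also have "\<dots> \<le> (\<Sum>x\<in>UNIV. \<Sum>i<d. \<bar>log 2 (mu x i)\<bar>)"
        by (rule member_le_sum) (auto intro!: sum_nonneg)
      finally show ?thesis unfolding B_def using nn \<delta> by linarith
    qed
  qed
  define c where "c = \<delta>\<^sup>2 / (4 * B\<^sup>2)"
  have c: "0 < c" using \<delta> B by (simp add: c_def)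
  have "\<exists>q'\<in>types_M n M. trace_norm (avg_state_n d n W (iid q n) - avg_state_n d n W q')
       \<le> 3 / 2 * t + 2 powr (real n * (h - hc + 2 * \<delta>)) / (2 * t * real M) + (2 + 1 / t) * exp (- c * real n)"
    if M: "0 < M" and t: "0 < t" for n M and t :: real
  proof -
    let ?N = "d ^ n"
    let ?e = "exp (- c * real n)"
    define ys :: "'x list" where "ys = replicate n undefined"
    have ly: "length ys = n" by (simp add: ys_def)
    define \<rho>n where "\<rho>n = tensor_word (\<lambda>_. ?\<rho>) ys"
    have \<rho>n: "avg_state_n d n W (iid q n) = \<rho>n" unfolding \<rho>n_def by (rule avg_state_n_iid[OF cW ly])
    have c\<rho>: "\<rho>n \<in> carrier_mat ?N ?N" using \<rho>n avg_state_n_carrier by metis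
    define Q where "Q = iid q n"
    have Q: "\<And>xs. 0 \<le> Q xs" "(\<Sum>xs\<in>words n. Q xs) = 1"
      using prob_dist_n_iid[OF q, of n] by (auto simp: prob_dist_n_def Q_def)
    define Uw where "Uw xs = tensor_word U xs" for xs
    define z where "z xs = tprod d mu xs" for xs
    have cT: "tensor_word W xs \<in> carrier_mat ?N ?N" if "xs \<in> words n" for xs
      by (rule tensor_word_carrier_words[of W, OF cW that])
    have uUw: "unitary ?N (Uw xs)" if "xs \<in> words n" for xs
      using unitary_tensor_word[of d U xs, OF uU] that by (simp add: Uw_def words_def)
    have sUw: "spec_decomp (tensor_word W xs) (Uw xs) (z xs)" for xs
      unfolding Uw_def z_def by (rule spec_decomp_tensor_word[OF cW sW])
    have z0: "0 \<le> z xs k" if "xs \<in> words n" "k < ?N" for xs k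
      unfolding z_def using that by (intro tprod_nonneg mu) (auto simp: words_def)
    have z1: "(\<Sum>k<?N. z xs k) = 1" if "xs \<in> words n" for xs
      using tensor_word_spec_states(1)[of W d U mu xs, OF cW sW mu] that by (simp add: words_def z_def)
    \<comment> \<open>Typical eigenvalues of a random codeword state are about 2^(-n hc); larger
      ones than \<open>lam\<close> are cut off.\<close>
    define lam where "lam = 2 powr (- (real n * (hc - \<delta>)))"
    have lam: "0 < lam" by (simp add: lam_def)
    \<comment> \<open>\<open>zs\<close> keeps the eigenvalues up to \<open>lam\<close> and
      \<open>zb\<close> the exceptional large ones, of total weight \<open>b xs\<close>.\<close>
    define zs where "zs xs k = (if z xs k \<le> lam then z xs k else 0)" for xs k
    define zb where "zb xs k = (if z xs k \<le> lam then 0 else z xs k)" for xs k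
    define b where "b xs = (\<Sum>k<?N. zb xs k)" for xs
    have zz: "z xs k = zs xs k + zb xs k" for xs k by (simp add: zs_def zb_def)
    have Eb: "(\<Sum>xs\<in>words n. Q xs * b xs) \<le> ?e"
    proof -
      have "b xs \<le> (\<Sum>k\<in>{k. k < ?N \<and> - (real n * (hc - \<delta>)) \<le> tsum d (\<lambda>x i. log 2 (mu x i)) xs k}. tprod d mu xs k)"
        if xs: "xs \<in> words n" for xs
      proof -
        have "b xs = (\<Sum>k\<in>{k. k < ?N \<and> lam < z xs k}. z xs k)" unfolding b_def zb_def
          by (rule sum.mono_neutral_cong_right) auto
        also have "\<dots> \<le> (\<Sum>k\<in>{k. k < ?N \<and> - (real n * (hc - \<delta>)) \<le> tsum d (\<lambda>x i. log 2 (mu x i)) xs k}. z xs k)"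
        proof (rule sum_mono2)
          show "{k. k < ?N \<and> lam < z xs k} \<subseteq> {k. k < ?N \<and> - (real n * (hc - \<delta>)) \<le> tsum d (\<lambda>x i. log 2 (mu x i)) xs k}"
          proof safe
            fix k assume k: "k < ?N" "lam < z xs k"
            have pos: "0 < z xs k" using k(2) lam by linarith
            have "log 2 (z xs k) = tsum d (\<lambda>x i. log 2 (mu x i)) xs k" unfolding z_def
              by (rule log_tprod) (use mu k pos xs in \<open>auto simp: z_def words_def\<close>)
            moreover have "- (real n * (hc - \<delta>)) < log 2 (z xs k)"
              using k(2) pos unfolding lam_def by (simp add: less_log_iff)
            ultimately show "- (real n * (hc - \<delta>)) \<le> tsum d (\<lambda>x i. log 2 (mu x i)) xs k" by simp
          qed
        qed (auto intro!: z0[OF xs])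
        finally show ?thesis by (simp add: z_def)
      qed
      hence "(\<Sum>xs\<in>words n. Q xs * b xs) \<le> (\<Sum>xs\<in>words n. Q xs *
        (\<Sum>k\<in>{k. k < ?N \<and> - (real n * (hc - \<delta>)) \<le> tsum d (\<lambda>x i. log 2 (mu x i)) xs k}. tprod d mu xs k))"
        by (intro sum_mono mult_left_mono Q)
      also have "\<dots> \<le> exp (- (\<delta>\<^sup>2 / (4 * B\<^sup>2)) * real n)" unfolding Q_def
      proof (rule chernoff_iid_tprod[OF q mu])
        have "(\<Sum>i<d. mu x i * log 2 (mu x i)) = - vn_entropy (W x)" for x
          using vn_entropy_spec[OF cW sW mu(1)] by simp
        hence "(\<Sum>x\<in>UNIV. q x * (\<Sum>i<d. mu x i * log 2 (mu x i))) = - hc" by (simp add: hc sum_negf)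
        thus "real n * ((\<Sum>x\<in>UNIV. q x * (\<Sum>i<d. mu x i * log 2 (mu x i))) + \<delta>) \<le> - (real n * (hc - \<delta>))"
          by (simp add: algebra_simps)
      qed (use \<delta> B Bmu in auto)
      finally show ?thesis by (simp add: c_def)
    qed
    define Vn where "Vn = tensor_word (\<lambda>_::'x. V) ys"
    have uVn: "unitary ?N Vn" unfolding Vn_def ly[symmetric] by (rule unitary_tensor_word[OF uV])
    define R where "R = tprod d (\<lambda>_::'x. r) ys"
    have sR: "spec_decomp \<rho>n Vn R" unfolding \<rho>n_def R_def Vn_def
      by (rule spec_decomp_tensor_word) (use s\<rho> in auto)
    have R0: "0 \<le> R k" if "k < ?N" for k unfolding R_def using that r by (intro tprod_nonneg) (auto simp: ly)
    have R1: "(\<Sum>k<?N. R k) = 1"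
      using sum_tprod[of d "\<lambda>_::'x. r" ys] by (simp add: ly r(2) map_replicate_const R_def)
    define D where "D = 2 powr (real n * (h + \<delta>))"
    have D0: "0 < D" by (simp add: D_def)
    define K where "K k \<longleftrightarrow> 1 / D \<le> R k" for k
    define Pg where "Pg = Vn * mat_diag ?N (\<lambda>k. if K k then 1 else 0) * adj Vn"
    have Pg: "projector ?N Pg" unfolding Pg_def by (rule projector_mat_diag_conj[OF uVn])
    note Pgc = projectorD[OF Pg]
    have sPg: "spec_decomp Pg Vn (\<lambda>k. if K k then 1 else 0)" unfolding Pg_def
      by (rule spec_decomp_indicator[OF uVn])
    define Pb where "Pb = 1\<^sub>m ?N - Pg"
    have Pb: "projector ?N Pb" unfolding Pb_def by (rule projector_compl[OF Pg])
    note Pbc = projectorD[OF Pb]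
    \<comment> \<open>Each selected eigenvalue is at least 1/D and together they sum to at most
      1.\<close>
    have trPg: "Re (ctrace Pg) \<le> D"
    proof -
      have "Re (ctrace Pg) = (\<Sum>k<?N. if K k then 1 else 0)" using ctrace_eq_sum_spec[OF Pgc(1) sPg] by simp
      also have "\<dots> \<le> (\<Sum>k<?N. D * R k)"
        using R0 D0 by (intro sum_mono) (auto simp: K_def field_simps)
      also have "\<dots> = D" by (simp add: R1 flip: sum_distrib_left)
      finally show ?thesis .
    qed
    define g where "g xs = Re (ctrace (Pb * tensor_word W xs))" for xs
    have Eg: "(\<Sum>xs\<in>words n. Q xs * g xs) \<le> ?e"
    proof -
      have "(\<Sum>xs\<in>words n. Q xs * g xs) = Re (ctrace (Pb * \<rho>n))"
        unfolding \<rho>n[symmetric] ctrace_mult_avg_state_n[of W, OF cW Pbc(1)] g_def Q_def by simp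
      also have "Pb * \<rho>n = \<rho>n - Pg * \<rho>n" unfolding Pb_def using c\<rho> Pgc(1) by (simp add: minus_mult_dim left_mult_one_mat')
      also have "ctrace \<dots> = ctrace \<rho>n - ctrace (\<rho>n * Pg)"
        using ctrace_minus[of \<rho>n ?N "Pg * \<rho>n"] c\<rho> Pgc(1) ctrace_comm[OF Pgc(1) c\<rho>] by simp
      also have "Re \<dots> = (\<Sum>k<?N. R k) - (\<Sum>k<?N. (if K k then 1 else 0) * Re ((adj Vn * \<rho>n * Vn) $$ (k,k)))"
        using ctrace_eq_sum_spec[OF c\<rho> sR] Re_ctrace_spec_decomp[OF Pgc(1) c\<rho> sPg] by simp
      also have "\<dots> = (\<Sum>k<?N. if K k then 0 else R k)"
        unfolding spec_decomp_conj[OF c\<rho> sR] sum_subtractf[symmetric] by (intro sum.cong) (auto simp: mat_diag_def)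
      also have "\<dots> = (\<Sum>k\<in>{k. k < ?N \<and> \<not> K k \<and> R k \<noteq> 0}. R k)"
        by (rule sum.mono_neutral_cong_right) auto
      also have "\<dots> \<le> (\<Sum>k\<in>{k. k < d ^ length ys \<and> real n * (h + \<delta>) \<le> tsum d (\<lambda>_ i. - log 2 (r i)) ys k}. R k)"
      proof (rule sum_mono2)
        show "{k. k < ?N \<and> \<not> K k \<and> R k \<noteq> 0} \<subseteq> {k. k < d ^ length ys \<and> real n * (h + \<delta>) \<le> tsum d (\<lambda>_ i. - log 2 (r i)) ys k}"
        proof safe
          fix k assume k: "k < ?N" "\<not> K k" "R k \<noteq> 0"
          have pos: "0 < R k" using k(3) R0[OF k(1)] by simp
          have "log 2 (R k) = tsum d (\<lambda>_ i. log 2 (r i)) ys k" unfolding R_def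
            by (rule log_tprod) (use r k pos in \<open>auto simp: ly R_def\<close>)
          moreover have "R k < 2 powr (- (real n * (h + \<delta>)))"
            using k(2) unfolding K_def D_def powr_minus by (simp add: field_simps)
          hence "log 2 (R k) < - (real n * (h + \<delta>))" using pos by (simp add: log_less_iff)
          ultimately show "real n * (h + \<delta>) \<le> tsum d (\<lambda>_ i. - log 2 (r i)) ys k" by (simp add: tsum_uminus)
        qed (auto simp: ly)
      qed (auto intro!: R0 simp: ly)
      also have "\<dots> \<le> exp (- (\<delta>\<^sup>2 / (4 * B\<^sup>2)) * real (length ys))" unfolding R_def
      proof (rule chernoff_tprod)
        have "(\<Sum>i<d. r i * - log 2 (r i)) = h"
          using vn_entropy_spec[OF avg_state_carrier s\<rho> r(1)] h by (simp add: sum_negf)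
        thus "(\<Sum>x\<leftarrow>ys. \<Sum>i<d. r i * - log 2 (r i)) + real (length ys) * \<delta> \<le> real n * (h + \<delta>)"
          by (simp add: ys_def sum_list_replicate algebra_simps)
      qed (use r \<delta> B Br in auto)
      finally show ?thesis by (simp add: ly c_def)
    qed
    define Ws where "Ws xs = Uw xs * mat_diag ?N (\<lambda>k. complex_of_real (zs xs k)) * adj (Uw xs)" for xs
    define Wb where "Wb xs = Uw xs * mat_diag ?N (\<lambda>k. complex_of_real (zb xs k)) * adj (Uw xs)" for xs
    have cWs: "Ws xs \<in> carrier_mat ?N ?N" and cWb: "Wb xs \<in> carrier_mat ?N ?N" if "xs \<in> words n" for xs
      using unitaryD(1)[OF uUw[OF that]] by (auto simp: Ws_def Wb_def)
    have sWs: "spec_decomp (Ws xs) (Uw xs) (zs xs)" and sWb: "spec_decomp (Wb xs) (Uw xs) (zb xs)" if xs: "xs \<in> words n" for xs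
      using spec_decomp_iff[OF cWs[OF xs]] spec_decomp_iff[OF cWb[OF xs]] uUw[OF xs] by (auto simp: Ws_def Wb_def)
    let ?I = "{..<?N} \<times> {..<?N}"
    define m where "m i = (\<Sum>xs\<in>words n. complex_of_real (Q xs) * Ws xs $$ i)" for i
    \<comment> \<open>Chosen so that C M^2 = M D/(2t): after division by M, the greedy bound
      controls exactly the quadratic term that arises for F3. Likewise \<open>L\<close> carries the
      combination of b and g needed for F1 and F2.\<close>
    define C where "C = D / (2 * t * real M)"
    define L where "L xs = b xs + g xs / (2 * t)" for xs
    have C0: "0 \<le> C" using D0 t by (simp add: C_def)
    obtain cs where cs: "length cs = M" "set cs \<subseteq> words n"
      and csb: "C * (\<Sum>i\<in>?I. (cmod (\<Sum>x\<leftarrow>cs. Ws x $$ i - m i))\<^sup>2) + (\<Sum>x\<leftarrow>cs. L x)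
        \<le> real M * (C * (\<Sum>x\<in>words n. Q x * (\<Sum>i\<in>?I. (cmod (Ws x $$ i))\<^sup>2)) + (\<Sum>x\<in>words n. Q x * L x))"
      using greedy_codebook[where S = "words n" and w = Q and I = ?I and C = C and Y = "\<lambda>xs i. Ws xs $$ i" and M = M and L = L]
        Q C0 unfolding m_def by auto
    \<comment> \<open>Deviation of the codebook average from the mean. The greedy bound concerns the
      sum of M deviations and grows like M, so passing to the average gains a factor 1/M.\<close>
    define Xt where "Xt i = (\<Sum>x\<leftarrow>cs. Ws x $$ i) / of_nat M - m i" for i
    have Xt: "(\<Sum>x\<leftarrow>cs. Ws x $$ i - m i) = of_nat M * Xt i" for i
    proof -
      have "(\<Sum>x\<leftarrow>cs. Ws x $$ i - m i) = (\<Sum>x\<leftarrow>cs. Ws x $$ i) - of_nat M * m i"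
        using sum_list_subtractf[of "\<lambda>x. Ws x $$ i" "\<lambda>_. m i" cs] by (simp add: sum_list_triv cs(1))
      thus ?thesis using M by (simp add: Xt_def right_diff_distrib)
    qed
    \<comment> \<open>The purpose of the truncation: the squared eigenvalues sum to at most
      \<open>lam\<close> times their total weight 1.\<close>
    have Ws2: "(\<Sum>i\<in>?I. (cmod (Ws xs $$ i))\<^sup>2) \<le> lam" if xs: "xs \<in> words n" for xs
    proof -
      have "(\<Sum>i\<in>?I. (cmod (Ws xs $$ i))\<^sup>2) = (\<Sum>i<?N. \<Sum>j<?N. (cmod (Ws xs $$ (i,j)))\<^sup>2)"
        by (simp add: sum.cartesian_product case_prod_unfold)
      also have "\<dots> = (\<Sum>k<?N. (zs xs k)\<^sup>2)" by (rule sum_cmod2_spec[OF cWs[OF xs] sWs[OF xs]])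
      also have "\<dots> \<le> (\<Sum>k<?N. lam * z xs k)"
        using z0[OF xs] lam by (intro sum_mono) (auto simp: zs_def power2_eq_square intro: mult_right_mono)
      also have "\<dots> = lam" by (simp add: z1[OF xs] flip: sum_distrib_left)
      finally show ?thesis .
    qed
    have main: "D / (2 * t) * (\<Sum>i\<in>?I. (cmod (Xt i))\<^sup>2) + (\<Sum>x\<leftarrow>cs. L x) / real M
        \<le> D * lam / (2 * t * real M) + (1 + 1 / (2 * t)) * ?e"
    proof -
      have "(\<Sum>x\<in>words n. Q x * (\<Sum>i\<in>?I. (cmod (Ws x $$ i))\<^sup>2)) \<le> (\<Sum>x\<in>words n. Q x * lam)"
        by (intro sum_mono mult_left_mono Ws2 Q) auto
      also have "\<dots> = lam" by (simp add: Q(2) flip: sum_distrib_right)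
      finally have 1: "C * (\<Sum>x\<in>words n. Q x * (\<Sum>i\<in>?I. (cmod (Ws x $$ i))\<^sup>2)) \<le> C * lam"
        by (intro mult_left_mono C0)
      have "(\<Sum>x\<in>words n. Q x * L x) = (\<Sum>x\<in>words n. Q x * b x) + (\<Sum>x\<in>words n. Q x * g x) / (2 * t)"
        by (simp add: L_def distrib_left sum.distrib sum_divide_distrib)
      also have "\<dots> \<le> ?e + ?e / (2 * t)" using Eb Eg t by (intro add_mono divide_right_mono) auto
      also have "\<dots> = (1 + 1 / (2 * t)) * ?e" by (simp add: algebra_simps)
      finally have 2: "(\<Sum>x\<in>words n. Q x * L x) \<le> (1 + 1 / (2 * t)) * ?e" .
      have "(\<Sum>i\<in>?I. (cmod (\<Sum>x\<leftarrow>cs. Ws x $$ i - m i))\<^sup>2) = (real M)\<^sup>2 * (\<Sum>i\<in>?I. (cmod (Xt i))\<^sup>2)"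
        unfolding Xt by (simp add: norm_mult power_mult_distrib sum_distrib_left)
      hence "C * ((real M)\<^sup>2 * (\<Sum>i\<in>?I. (cmod (Xt i))\<^sup>2)) + (\<Sum>x\<leftarrow>cs. L x) \<le> real M * (C * lam + (1 + 1 / (2 * t)) * ?e)"
        using order_trans[OF csb mult_left_mono[OF add_mono[OF 1 2]]] by simp
      moreover have "C * ((real M)\<^sup>2 * (\<Sum>i\<in>?I. (cmod (Xt i))\<^sup>2)) = real M * (D / (2 * t) * (\<Sum>i\<in>?I. (cmod (Xt i))\<^sup>2))"
        using M t by (simp add: C_def power2_eq_square)
      ultimately have "real M * (D / (2 * t) * (\<Sum>i\<in>?I. (cmod (Xt i))\<^sup>2) + (\<Sum>x\<leftarrow>cs. L x) / real M)
         \<le> real M * (C * lam + (1 + 1 / (2 * t)) * ?e)"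
        using M by (simp add: distrib_left)
      hence "D / (2 * t) * (\<Sum>i\<in>?I. (cmod (Xt i))\<^sup>2) + (\<Sum>x\<leftarrow>cs. L x) / real M \<le> C * lam + (1 + 1 / (2 * t)) * ?e"
        using M by (simp only: mult_le_cancel_left_pos of_nat_0_less_iff)
      thus ?thesis by (simp add: C_def)
    qed
    define q' where "q' = code_dist cs"
    have q': "q' \<in> types_M n M" unfolding q'_def by (rule code_dist_types_M[OF cs(1) M cs(2)])
    define \<sigma> where "\<sigma> = avg_state_n d n W q'"
    have c\<sigma>: "\<sigma> \<in> carrier_mat ?N ?N" by (simp add: \<sigma>_def)
    have X: "\<rho>n - \<sigma> \<in> carrier_mat ?N ?N" using c\<sigma> by auto
    have "hermitian (\<rho>n - \<sigma>)"
    proof (rule hermitianI[OF X])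
      have "adj \<rho>n = \<rho>n" "adj \<sigma> = \<sigma>"
        using hermitian_avg_state_n[of d W, OF DW] \<rho>n unfolding \<sigma>_def by (auto dest!: hermitianD simp: hermitian_def)
      thus "adj (\<rho>n - \<sigma>) = \<rho>n - \<sigma>" using adj_minus[OF c\<rho> c\<sigma>] by simp
    qed
    from trace_norm_eq_unitary[OF X this] obtain T where T: "unitary ?N T" "adj T = T"
      and tn: "trace_norm (\<rho>n - \<sigma>) = Re (ctrace (T * (\<rho>n - \<sigma>)))" by blast
    note cTT = unitaryD(1)[OF T(1)]
    \<comment> \<open>Three contributions of a codeword to Tr(T ...): its exceptional eigenvalues,
      the truncated state off the typical subspace, and the truncated state on it. The first two are
      small on average, so only the third needs cancellation between codebook and mean.\<close>
    define F1 where "F1 xs = Re (ctrace (T * Wb xs))" for xs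
    define F2 where "F2 xs = Re (ctrace (T * Pb * Ws xs))" for xs
    define F3 where "F3 xs = Re (ctrace (T * Pg * Ws xs))" for xs
    define av where "av F = (\<Sum>xs\<leftarrow>cs. F xs) / real M" for F :: "'x list \<Rightarrow> real"
    define ex where "ex F = (\<Sum>xs\<in>words n. Q xs * F xs)" for F :: "'x list \<Rightarrow> real"
    have av_eq: "av F = (\<Sum>xs\<in>words n. q' xs * F xs)" for F
      unfolding q'_def av_def sum_code_dist[OF cs(2)] cs(1) ..
    have q'0: "0 \<le> q' xs" for xs by (simp add: q'_def code_dist_def)
    have q'1: "(\<Sum>xs\<in>words n. q' xs) = 1" using q' by (simp add: types_M_def prob_dist_n_def)
    have split: "Re (ctrace (T * tensor_word W xs)) = F1 xs + F2 xs + F3 xs" if xs: "xs \<in> words n" for xs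
    proof -
      have D: "mat_diag ?N (\<lambda>k. complex_of_real (z xs k)) = mat_diag ?N (\<lambda>k. complex_of_real (zs xs k)) + mat_diag ?N (\<lambda>k. complex_of_real (zb xs k))"
        by (rule eq_matI) (auto simp: mat_diag_def zz)
      note cU = unitaryD(1)[OF uUw[OF xs]]
      have "tensor_word W xs = Uw xs * mat_diag ?N (\<lambda>k. complex_of_real (z xs k)) * adj (Uw xs)"
        using sUw[of xs] spec_decomp_iff[OF cT[OF xs]] by blast
      also have "\<dots> = Ws xs + Wb xs" unfolding D Ws_def Wb_def
        using cU by (simp add: mult_add_distrib_mat[of _ ?N ?N _ ?N] add_mult_distrib_mat[of _ ?N ?N _ _ ?N] mult_carrier_mat[of _ ?N ?N _ ?N])
      finally have e: "tensor_word W xs = Ws xs + Wb xs" .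
      have "T * tensor_word W xs = T * Ws xs + T * Wb xs"
        unfolding e by (rule mult_add_distrib_mat[OF cTT cWs[OF xs] cWb[OF xs]])
      hence 1: "ctrace (T * tensor_word W xs) = ctrace (T * Ws xs) + ctrace (T * Wb xs)"
        using ctrace_add[of "T * Ws xs" ?N "T * Wb xs"] cTT cWs[OF xs] cWb[OF xs] by simp
      have "T * Pb = T - T * Pg" unfolding Pb_def using cTT Pgc(1) by (simp add: mult_minus_dim right_mult_one_mat')
      hence "T * Pb * Ws xs = T * Ws xs - T * Pg * Ws xs"
        using cTT Pgc(1) cWs[OF xs] by (simp add: minus_mult_dim)
      hence "ctrace (T * Pb * Ws xs) = ctrace (T * Ws xs) - ctrace (T * Pg * Ws xs)"
        using ctrace_minus[of "T * Ws xs" ?N "T * Pg * Ws xs"] cTT Pgc(1) cWs[OF xs] by simp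
      thus ?thesis using 1 by (simp add: F1_def F2_def F3_def)
    qed
    have "ctrace (T * (\<rho>n - \<sigma>)) = ctrace (T * \<rho>n) - ctrace (T * \<sigma>)"
      using mult_minus_distrib_mat[OF cTT c\<rho> c\<sigma>] ctrace_minus[of "T * \<rho>n" ?N "T * \<sigma>"] cTT c\<rho> c\<sigma> by simp
    moreover have "Re (ctrace (T * \<rho>n)) = ex (\<lambda>xs. Re (ctrace (T * tensor_word W xs)))"
      unfolding \<rho>n[symmetric] ctrace_mult_avg_state_n[of W, OF cW cTT] ex_def Q_def by simp
    moreover have "Re (ctrace (T * \<sigma>)) = av (\<lambda>xs. Re (ctrace (T * tensor_word W xs)))"
      unfolding \<sigma>_def ctrace_mult_avg_state_n[of W, OF cW cTT] av_eq by simp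
    moreover have "ex (\<lambda>xs. Re (ctrace (T * tensor_word W xs))) = ex F1 + ex F2 + ex F3"
      unfolding ex_def sum.distrib[symmetric] distrib_left[symmetric] by (intro sum.cong) (simp_all add: split)
    moreover have "av (\<lambda>xs. Re (ctrace (T * tensor_word W xs))) = av F1 + av F2 + av F3"
      unfolding av_eq sum.distrib[symmetric] distrib_left[symmetric] by (intro sum.cong) (simp_all add: split)
    ultimately have tn': "trace_norm (\<rho>n - \<sigma>) = (ex F1 - av F1) + (ex F2 - av F2) + (ex F3 - av F3)"
      unfolding tn by simp
    have F1: "\<bar>F1 xs\<bar> \<le> b xs" if xs: "xs \<in> words n" for xs
    proof -
      have one: "projector ?N (1\<^sub>m ?N)" by (auto simp: projector_def)
      \<comment> \<open>The case P = 1, t = 1 of the general estimate: 1/2 + 1/2.\<close>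
      have le1: "\<bar>Re ((adj (Uw xs) * T * Uw xs) $$ (k,k))\<bar> \<le> 1" if k: "k < ?N" for k
        using conj_diag_unitary_projector_le[OF T one uUw[OF xs] k, of 1]
          projector_conj_diag_bounds(2)[OF one uUw[OF xs] k] right_mult_one_mat[OF cTT] by (simp del: index_mult_mat(1))
      have zb0: "0 \<le> zb xs k" if "k < ?N" for k using z0[OF xs that] by (simp add: zb_def)
      have "F1 xs = (\<Sum>k<?N. zb xs k * Re ((adj (Uw xs) * T * Uw xs) $$ (k,k)))"
        unfolding F1_def by (rule Re_ctrace_spec_decomp[OF cWb[OF xs] cTT sWb[OF xs]])
      hence "\<bar>F1 xs\<bar> \<le> (\<Sum>k<?N. \<bar>zb xs k * Re ((adj (Uw xs) * T * Uw xs) $$ (k,k))\<bar>)" by (simp only: sum_abs)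
      also have "\<dots> \<le> (\<Sum>k<?N. zb xs k * 1)"
        unfolding abs_mult using zb0 le1 by (intro sum_mono mult_mono) auto
      finally show ?thesis by (simp add: b_def)
    qed
    have F2: "\<bar>F2 xs\<bar> \<le> t / 2 + g xs / (2 * t)" if xs: "xs \<in> words n" for xs
    proof -
      define G where "G k = Re ((adj (Uw xs) * Pb * Uw xs) $$ (k,k))" for k
      have G0: "0 \<le> G k" if "k < ?N" for k
        using projector_conj_diag_bounds(1)[OF Pb uUw[OF xs] that] by (simp add: G_def)
      have zs0: "0 \<le> zs xs k" "zs xs k \<le> z xs k" if "k < ?N" for k using z0[OF xs that] by (auto simp: zs_def)
      have cTP: "T * Pb \<in> carrier_mat ?N ?N" using cTT Pbc by auto
      have "F2 xs = (\<Sum>k<?N. zs xs k * Re ((adj (Uw xs) * (T * Pb) * Uw xs) $$ (k,k)))"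
        unfolding F2_def by (rule Re_ctrace_spec_decomp[OF cWs[OF xs] cTP sWs[OF xs]])
      hence "\<bar>F2 xs\<bar> \<le> (\<Sum>k<?N. \<bar>zs xs k * Re ((adj (Uw xs) * (T * Pb) * Uw xs) $$ (k,k))\<bar>)" by (simp only: sum_abs)
      also have "\<dots> \<le> (\<Sum>k<?N. z xs k * (t / 2 + G k / (2 * t)))"
        unfolding abs_mult G_def using zs0 conj_diag_unitary_projector_le[OF T Pb uUw[OF xs] _ t]
        by (intro sum_mono mult_mono) (auto simp del: index_mult_mat(1) intro: z0[OF xs])
      also have "\<dots> = t / 2 * (\<Sum>k<?N. z xs k) + (\<Sum>k<?N. z xs k * G k) / (2 * t)"
        by (simp add: distrib_left sum.distrib sum_distrib_left sum_divide_distrib mult.commute)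
      also have "(\<Sum>k<?N. z xs k * G k) = g xs"
        unfolding g_def G_def by (rule Re_ctrace_spec_decomp[OF cT[OF xs] Pbc(1) sUw, symmetric])
      finally show ?thesis by (simp add: z1[OF xs])
    qed
    have avm: "av F \<le> av G" if "\<And>xs. xs \<in> words n \<Longrightarrow> F xs \<le> G xs" for F G
      unfolding av_eq by (intro sum_mono mult_left_mono q'0 that)
    have exm: "ex F \<le> ex G" if "\<And>xs. xs \<in> words n \<Longrightarrow> F xs \<le> G xs" for F G
      unfolding ex_def by (intro sum_mono mult_left_mono Q that)
    have b1: "ex F1 - av F1 \<le> ex b + av b"
    proof -
      have "ex F1 \<le> ex b" using F1 by (intro exm) (simp add: abs_le_iff)
      moreover have "av (\<lambda>xs. - F1 xs) \<le> av b" using F1 by (intro avm) (simp add: abs_le_iff)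
      moreover have "av (\<lambda>xs. - F1 xs) = - av F1" by (simp add: av_eq sum_negf)
      ultimately show ?thesis by simp
    qed
    have b2: "ex F2 - av F2 \<le> t + (ex g + av g) / (2 * t)"
    proof -
      have "ex F2 \<le> ex (\<lambda>xs. t / 2 + g xs / (2 * t))" using F2 by (intro exm) (simp add: abs_le_iff)
      moreover have "ex (\<lambda>xs. t / 2 + g xs / (2 * t)) = t / 2 + ex g / (2 * t)"
        unfolding ex_def distrib_left sum.distrib sum_distrib_right[symmetric] Q(2) by (simp add: sum_divide_distrib)
      moreover have "av (\<lambda>xs. - F2 xs) \<le> av (\<lambda>xs. t / 2 + g xs / (2 * t))" using F2 by (intro avm) (simp add: abs_le_iff)
      moreover have "av (\<lambda>xs. t / 2 + g xs / (2 * t)) = t / 2 + av g / (2 * t)"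
        unfolding av_eq distrib_left sum.distrib sum_distrib_right[symmetric] q'1 by (simp add: sum_divide_distrib)
      moreover have "av (\<lambda>xs. - F2 xs) = - av F2" by (simp add: av_eq sum_negf)
      ultimately show ?thesis by (simp add: add_divide_distrib)
    qed
    have b3: "ex F3 - av F3 \<le> t / 2 + D / (2 * t) * (\<Sum>i\<in>?I. (cmod (Xt i))\<^sup>2)"
    proof -
      define A where "A = T * Pg"
      have cA: "A \<in> carrier_mat ?N ?N" using cTT Pgc by (auto simp: A_def)
      \<comment> \<open>The indices of A are swapped because the trace pairs A_ij with
        Ws_ji.\<close>
      have F3e: "F3 xs = Re (\<Sum>i\<in>?I. A $$ (snd i, fst i) * Ws xs $$ i)" if "xs \<in> words n" for xs
      proof -
        have "ctrace (A * Ws xs) = (\<Sum>i<?N. \<Sum>j<?N. A $$ (i,j) * Ws xs $$ (j,i))"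
          by (rule ctrace_mult_entries[OF cA cWs[OF that]])
        also have "\<dots> = (\<Sum>j<?N. \<Sum>i<?N. A $$ (i,j) * Ws xs $$ (j,i))" by (rule sum.swap)
        also have "\<dots> = (\<Sum>i\<in>?I. A $$ (snd i, fst i) * Ws xs $$ i)"
          by (simp add: sum.cartesian_product case_prod_unfold)
        finally show ?thesis by (simp add: F3_def A_def)
      qed
      have "ex F3 = Re (\<Sum>i\<in>?I. A $$ (snd i, fst i) * m i)"
      proof -
        have "ex F3 = Re (\<Sum>xs\<in>words n. complex_of_real (Q xs) * (\<Sum>i\<in>?I. A $$ (snd i, fst i) * Ws xs $$ i))"
          unfolding ex_def Re_sum[of _ "words n"] by (rule sum.cong) (simp_all add: F3e del: Re_sum)
        also have "(\<Sum>xs\<in>words n. complex_of_real (Q xs) * (\<Sum>i\<in>?I. A $$ (snd i, fst i) * Ws xs $$ i))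
          = (\<Sum>i\<in>?I. A $$ (snd i, fst i) * m i)"
          unfolding m_def sum_distrib_left by (subst sum.swap) (simp add: mult_ac)
        finally show ?thesis .
      qed
      moreover have "av F3 = Re (\<Sum>i\<in>?I. A $$ (snd i, fst i) * ((\<Sum>x\<leftarrow>cs. Ws x $$ i) / of_nat M))"
      proof -
        have "(\<Sum>xs\<leftarrow>cs'. F3 xs) = Re (\<Sum>i\<in>?I. A $$ (snd i, fst i) * (\<Sum>x\<leftarrow>cs'. Ws x $$ i))"
          if "set cs' \<subseteq> words n" for cs'
          using that
        proof (induction cs')
          case (Cons y cs')
          have "(\<Sum>i\<in>?I. A $$ (snd i, fst i) * (\<Sum>x\<leftarrow>y # cs'. Ws x $$ i))
            = (\<Sum>i\<in>?I. A $$ (snd i, fst i) * Ws y $$ i) + (\<Sum>i\<in>?I. A $$ (snd i, fst i) * (\<Sum>x\<leftarrow>cs'. Ws x $$ i))"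
            by (simp add: distrib_left sum.distrib)
          moreover have "(\<Sum>xs\<leftarrow>y # cs'. F3 xs) = F3 y + (\<Sum>xs\<leftarrow>cs'. F3 xs)" by simp
          moreover have "(\<Sum>xs\<leftarrow>cs'. F3 xs) = Re (\<Sum>i\<in>?I. A $$ (snd i, fst i) * (\<Sum>x\<leftarrow>cs'. Ws x $$ i))"
            using Cons by auto
          moreover have "F3 y = Re (\<Sum>i\<in>?I. A $$ (snd i, fst i) * Ws y $$ i)" using Cons.prems by (intro F3e) auto
          ultimately show ?case by (simp only: plus_complex.sel)
        qed simp
        from this[OF cs(2)] have "av F3 = Re (\<Sum>i\<in>?I. A $$ (snd i, fst i) * (\<Sum>x\<leftarrow>cs. Ws x $$ i)) / real M"
          by (simp add: av_def)
        also have "\<dots> = Re ((\<Sum>i\<in>?I. A $$ (snd i, fst i) * (\<Sum>x\<leftarrow>cs. Ws x $$ i)) / of_nat M)"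
          by (rule Re_divide_of_nat[symmetric])
        finally show ?thesis by (simp only: sum_divide_distrib times_divide_eq_right)
      qed
      ultimately have "ex F3 - av F3 = Re (\<Sum>i\<in>?I. A $$ (snd i, fst i) * - Xt i)"
        unfolding Xt_def minus_diff_eq right_diff_distrib sum_subtractf minus_complex.sel by simp
      also have "\<dots> \<le> cmod (\<Sum>i\<in>?I. A $$ (snd i, fst i) * - Xt i)" by (rule complex_Re_le_cmod)
      also have "\<dots> \<le> (\<Sum>i\<in>?I. cmod (A $$ (snd i, fst i)) * cmod (Xt i))"
        using norm_sum[of "\<lambda>i. A $$ (snd i, fst i) * - Xt i" ?I] by (simp add: norm_mult)
      \<comment> \<open>The weight t/D compensates the squared norm of A, which is at most D, so the
        first term ends up as t/2.\<close>
      also have "\<dots> \<le> (\<Sum>i\<in>?I. (t / D) / 2 * (cmod (A $$ (snd i, fst i)))\<^sup>2 + (cmod (Xt i))\<^sup>2 / (2 * (t / D)))"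
        using t D0 by (intro sum_mono weighted_amgm) auto
      also have "\<dots> = (t / D) / 2 * (\<Sum>i\<in>?I. (cmod (A $$ (snd i, fst i)))\<^sup>2) + (\<Sum>i\<in>?I. (cmod (Xt i))\<^sup>2) / (2 * (t / D))"
        by (simp only: sum.distrib sum_distrib_left sum_divide_distrib)
      also have "(\<Sum>i\<in>?I. (cmod (A $$ (snd i, fst i)))\<^sup>2) = (\<Sum>j<?N. \<Sum>i<?N. (cmod (A $$ (i,j)))\<^sup>2)"
        by (simp add: sum.cartesian_product case_prod_unfold)
      also have "\<dots> = (\<Sum>i<?N. \<Sum>j<?N. (cmod (A $$ (i,j)))\<^sup>2)" by (rule sum.swap)
      also have "\<dots> = Re (ctrace Pg)" unfolding A_def by (rule unitary_projector_cmod2[OF T(1) Pg])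
      also have "(t / D) / 2 * Re (ctrace Pg) \<le> (t / D) / 2 * D"
        using t D0 trPg by (intro mult_left_mono) auto
      finally show ?thesis using D0 by (simp add: mult.commute[of D])
    qed
    have exb: "ex b \<le> ?e" and exg: "ex g \<le> ?e" using Eb Eg by (simp_all add: ex_def)
    have avL: "av b + av g / (2 * t) = (\<Sum>x\<leftarrow>cs. L x) / real M"
    proof -
      have "(\<Sum>x\<leftarrow>cs. L x) = (\<Sum>x\<leftarrow>cs. b x) + (\<Sum>x\<leftarrow>cs. g x) / (2 * t)"
        unfolding L_def by (induction cs) (auto simp: add_divide_distrib)
      thus ?thesis by (simp add: av_def add_divide_distrib mult.commute)
    qed
    have "trace_norm (\<rho>n - \<sigma>) \<le> 3 / 2 * t + ex b + ex g / (2 * t)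
       + (D / (2 * t) * (\<Sum>i\<in>?I. (cmod (Xt i))\<^sup>2) + (\<Sum>x\<leftarrow>cs. L x) / real M)"
      unfolding tn' avL[symmetric] using b1 b2 b3 by (simp add: add_divide_distrib)
    also have "\<dots> \<le> 3 / 2 * t + ?e + ?e / (2 * t) + (D * lam / (2 * t * real M) + (1 + 1 / (2 * t)) * ?e)"
    proof -
      have "ex g / (2 * t) \<le> ?e / (2 * t)" using exg t by (intro divide_right_mono) auto
      thus ?thesis using exb main by linarith
    qed
    also have "\<dots> = 3 / 2 * t + D * lam / (2 * t * real M) + (2 + 1 / t) * ?e"
      by (simp add: algebra_simps)
    also have "D * lam = 2 powr (real n * (h - hc + 2 * \<delta>))"
      unfolding D_def lam_def by (simp add: algebra_simps flip: powr_add)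
    finally show ?thesis using q' unfolding \<rho>n \<sigma>_def by blast
  qed
  thus ?thesis using c by blast
qed

subsection \<open>Rates\<close>

lemma types_M_nonempty:
  assumes "0 < M"
  shows "(types_M n M :: ('x::finite list \<Rightarrow> real) set) \<noteq> {}"
proof -
  have "code_dist (replicate M (replicate n undefined)) \<in> (types_M n M :: ('x list \<Rightarrow> real) set)"
    by (rule code_dist_types_M) (use assms in \<open>auto simp: words_def\<close>)
  thus ?thesis by blast
qed

lemma trace_norm_diff_nonneg:
  fixes W :: "'x::finite \<Rightarrow> complex mat"
  assumes "cq_channel d W"
  shows "0 \<le> trace_norm (avg_state_n d n W q - avg_state_n d n W q')"
proof (rule trace_norm_nonneg)
  have D: "density d (W x)" for x using assms by (simp add: cq_channel_def)
  show c: "avg_state_n d n W q - avg_state_n d n W q' \<in> carrier_mat (d ^ n) (d ^ n)"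
    by (rule minus_carrier_mat[OF avg_state_n_carrier])
  show "hermitian (avg_state_n d n W q - avg_state_n d n W q')"
    by (rule hermitianI[OF c])
      (simp add: adj_minus[OF avg_state_n_carrier avg_state_n_carrier] hermitianD[OF hermitian_avg_state_n[of d W, OF D]])
qed

lemma eps_cov_le:
  assumes "cq_channel d W" "q \<in> types_M n M"
  shows "eps_cov d W p n M \<le> trace_norm (avg_state_n d n W (iid p n) - avg_state_n d n W q) / 2"
  unfolding eps_cov_def
  by (rule cInf_lower) (use assms trace_norm_diff_nonneg[OF assms(1)] in \<open>auto intro!: bdd_belowI[of _ 0]\<close>)

lemma eps_cov_ge:
  fixes W :: "'x::finite \<Rightarrow> complex mat"
  assumes "0 < M"
    and "\<And>q. q \<in> types_M n M \<Longrightarrow> c \<le> trace_norm (avg_state_n d n W (iid p n) - avg_state_n d n W q) / 2"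
  shows "c \<le> eps_cov d W p n M"
  unfolding eps_cov_def
  by (rule cInf_greatest) (use assms types_M_nonempty[OF assms(1), of n, where 'x = 'x] in auto)

lemma eps_cov_nonneg: "cq_channel d W \<Longrightarrow> 0 < M \<Longrightarrow> 0 \<le> eps_cov d W p n M"
  by (rule eps_cov_ge) (auto simp: trace_norm_diff_nonneg)

text \<open>For R >= 0 the power is at least 1, so rounding down leaves a positive codebook size and
  loses at most a factor 2.\<close>

lemma nat_floor_powr_bounds:
  assumes "0 \<le> R"
  shows "0 < nat \<lfloor>2 powr (real n * R)\<rfloor>" "real (nat \<lfloor>2 powr (real n * R)\<rfloor>) \<le> 2 powr (real n * R)"
    "2 powr (real n * R) \<le> 2 * real (nat \<lfloor>2 powr (real n * R)\<rfloor>)"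
proof -
  have 1: "1 \<le> (2::real) powr (real n * R)" using assms by (intro ge_one_powr_ge_zero) auto
  hence 2: "1 \<le> \<lfloor>(2::real) powr (real n * R)\<rfloor>" by (simp add: le_floor_iff)
  thus "0 < nat \<lfloor>2 powr (real n * R)\<rfloor>" by simp
  have e: "real (nat \<lfloor>2 powr (real n * R)\<rfloor>) = of_int \<lfloor>2 powr (real n * R)\<rfloor>" using 2 by simp
  show "real (nat \<lfloor>2 powr (real n * R)\<rfloor>) \<le> 2 powr (real n * R)" unfolding e by simp
  have "2 powr (real n * R) < of_int \<lfloor>2 powr (real n * R)\<rfloor> + 1" by linarith
  moreover have "1 \<le> real_of_int \<lfloor>2 powr (real n * R)\<rfloor>" using 2 by simp
  ultimately show "2 powr (real n * R) \<le> 2 * real (nat \<lfloor>2 powr (real n * R)\<rfloor>)" unfolding e by linarith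
qed

lemma exp_neg_tendsto_0: "0 < c \<Longrightarrow> (\<lambda>n. exp (- c * real n)) \<longlonglongrightarrow> 0"
  using LIMSEQ_realpow_zero[of "exp (- c)"] by (simp add: mult.commute flip: exp_of_nat_mult)

lemma powr_neg_tendsto_0: "0 < c \<Longrightarrow> (\<lambda>n. 2 powr (- c * real n)) \<longlonglongrightarrow> (0::real)"
  using exp_neg_tendsto_0[of "c * ln 2"] by (simp add: powr_def mult_ac)

section \<open>The optimal rate: achievability and strong converse\<close>

context
  fixes d :: nat and W :: "'x::finite \<Rightarrow> complex mat" and p :: "'x \<Rightarrow> real"
  assumes W: "cq_channel d W" and p: "prob_dist p"
begin

definition feasible :: "('x \<Rightarrow> real) set" where
  "feasible = {q. prob_dist q \<and> avg_state d W q = avg_state d W p}"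

text \<open>Formed with the entropy of W(p) rather than of W(q), hence affine in q; it is the mutual
  information on \<open>feasible\<close>.\<close>

definition info :: "('x \<Rightarrow> real) \<Rightarrow> real" where
  "info q = vn_entropy (avg_state d W p) - (\<Sum>x\<in>UNIV. q x * vn_entropy (W x))"

definition opt_rate :: real where
  "opt_rate = Inf (info ` feasible)"

lemma mutual_info_feasible: "q \<in> feasible \<Longrightarrow> mutual_info d W q = ereal (info q)"
  using mutual_info_eq_entropy[OF W, of q] by (auto simp: feasible_def info_def)

lemma p_feasible: "p \<in> feasible"
  using p by (simp add: feasible_def)

lemma info_nonneg: "q \<in> feasible \<Longrightarrow> 0 \<le> info q"
  using mutual_info_nonneg[OF W, of q] mutual_info_feasible[of q] by (auto simp: feasible_def)

lemma bdd_below_info: "bdd_below (info ` feasible)"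
  using info_nonneg by (auto intro!: bdd_belowI[of _ 0])

lemma opt_rate_le: "q \<in> feasible \<Longrightarrow> opt_rate \<le> info q"
  unfolding opt_rate_def using bdd_below_info by (intro cInf_lower) auto

lemma opt_rate_nonneg: "0 \<le> opt_rate"
  unfolding opt_rate_def using p_feasible info_nonneg by (intro cInf_greatest) auto

lemma INF_mutual_info: "(INF q \<in> feasible. mutual_info d W q) = ereal opt_rate"
proof -
  have "(INF q \<in> feasible. mutual_info d W q) = (INF q \<in> feasible. ereal (info q))"
    by (intro INF_cong refl mutual_info_feasible)
  also have "\<dots> = ereal opt_rate"
    unfolding opt_rate_def using ereal_Inf'[OF bdd_below_info] p_feasible by (force simp: image_image)
  finally show ?thesis .
qed

text \<open>Codewords are drawn from a nearly optimal feasible q instead of p.\<close>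

lemma achievability:
  assumes "opt_rate < R"
  shows "(\<lambda>n. eps_cov d W p n (nat \<lfloor>2 powr (real n * R)\<rfloor>)) \<longlonglongrightarrow> 0"
proof -
  have R: "0 \<le> R" using assms opt_rate_nonneg by linarith
  have "\<exists>x\<in>info ` feasible. x < R"
    using cInf_lessD[of "info ` feasible" R] p_feasible assms unfolding opt_rate_def by auto
  then obtain q where q: "prob_dist q" "avg_state d W q = avg_state d W p" "info q < R"
    by (auto simp: feasible_def)
  \<comment> \<open>Then info q + 2 \<open>\<delta>\<close> = R - 2 \<open>\<delta>\<close>, which
    leaves the factor 2^(-2 \<open>\<delta>\<close> n) after division by the codebook size.\<close>
  define \<delta> where "\<delta> = (R - info q) / 4"
  have \<delta>: "0 < \<delta>" using q(3) by (simp add: \<delta>_def)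
  have cW: "W x \<in> carrier_mat d d" for x using W by (simp add: cq_channel_def density_def)
  obtain c where c: "0 < c" and cov: "\<And>n M t. 0 < M \<Longrightarrow> 0 < t \<Longrightarrow> (\<exists>q'\<in>types_M n M.
     trace_norm (avg_state_n d n W (iid q n) - avg_state_n d n W q')
       \<le> 3 / 2 * t + 2 powr (real n * (vn_entropy (avg_state d W q) - (\<Sum>x\<in>UNIV. q x * vn_entropy (W x)) + 2 * \<delta>)) / (2 * t * real M)
         + (2 + 1 / t) * exp (- c * real n))"
    using covering_one_shot[OF W q(1) refl refl \<delta>] by blast
  have bound: "eps_cov d W p n (nat \<lfloor>2 powr (real n * R)\<rfloor>)
      \<le> 3 / 4 * t + 2 powr (- (2 * \<delta>) * real n) / (2 * t) + (1 + 1 / (2 * t)) * exp (- c * real n)" if t: "0 < t" for n t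
  proof -
    let ?M = "nat \<lfloor>2 powr (real n * R)\<rfloor>"
    note M = nat_floor_powr_bounds[OF R, of n]
    obtain q' where q': "q' \<in> types_M n ?M" and le: "trace_norm (avg_state_n d n W (iid q n) - avg_state_n d n W q')
       \<le> 3 / 2 * t + 2 powr (real n * (vn_entropy (avg_state d W q) - (\<Sum>x\<in>UNIV. q x * vn_entropy (W x)) + 2 * \<delta>)) / (2 * t * real ?M)
         + (2 + 1 / t) * exp (- c * real n)"
      using cov[OF M(1) t] by blast
    have same: "avg_state_n d n W (iid q n) = avg_state_n d n W (iid p n)"
      using avg_state_n_iid[where W = W and q = q, OF cW length_replicate[of n "undefined :: 'x"]]
        avg_state_n_iid[where W = W and q = p, OF cW length_replicate[of n "undefined :: 'x"]] q(2) by simp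
    have "real n * (vn_entropy (avg_state d W q) - (\<Sum>x\<in>UNIV. q x * vn_entropy (W x)) + 2 * \<delta>) = - (2 * \<delta>) * real n + real n * R"
    proof -
      have "vn_entropy (avg_state d W q) - (\<Sum>x\<in>UNIV. q x * vn_entropy (W x)) + 2 * \<delta> = R - 2 * \<delta>"
        unfolding q(2) by (simp add: \<delta>_def info_def field_simps)
      thus ?thesis by (simp only:) (simp add: algebra_simps)
    qed
    hence "2 powr (real n * (vn_entropy (avg_state d W q) - (\<Sum>x\<in>UNIV. q x * vn_entropy (W x)) + 2 * \<delta>)) / (2 * t * real ?M)
      = 2 powr (- (2 * \<delta>) * real n) * 2 powr (real n * R) / (2 * t * real ?M)" by (simp only: powr_add)
    also have "\<dots> \<le> 2 powr (- (2 * \<delta>) * real n) * (2 * real ?M) / (2 * t * real ?M)"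
      using t M by (intro divide_right_mono mult_left_mono) auto
    also have "\<dots> = 2 powr (- (2 * \<delta>) * real n) / t"
    proof -
      have "x * (2 * m) / (2 * t * m) = x / t" if "0 < m" for x m :: real using that by simp
      thus ?thesis using M(1) by (simp only: of_nat_0_less_iff)
    qed
    finally have "trace_norm (avg_state_n d n W (iid p n) - avg_state_n d n W q') / 2
       \<le> 3 / 4 * t + 2 powr (- (2 * \<delta>) * real n) / (2 * t) + (1 + 1 / (2 * t)) * exp (- c * real n)"
      using le unfolding same by (simp add: algebra_simps)
    thus ?thesis using eps_cov_le[OF W q', of p] by linarith
  qed
  show ?thesis
  proof (rule order_tendstoI)
    show "\<forall>\<^sub>F n in sequentially. a < eps_cov d W p n (nat \<lfloor>2 powr (real n * R)\<rfloor>)" if "a < 0" for a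
      using eps_cov_nonneg[OF W nat_floor_powr_bounds(1)[OF R]] that by (intro always_eventually allI) (rule less_le_trans)
    fix e :: real assume e: "0 < e"
    \<comment> \<open>The weight t is set to the target accuracy e and held fixed while n grows; the
      limit is 3e/4 < e.\<close>
    have "(\<lambda>n. 3 / 4 * e + 2 powr (- (2 * \<delta>) * real n) / (2 * e) + (1 + 1 / (2 * e)) * exp (- c * real n))
       \<longlonglongrightarrow> 3 / 4 * e + 0 / (2 * e) + (1 + 1 / (2 * e)) * 0"
      by (intro tendsto_intros powr_neg_tendsto_0 exp_neg_tendsto_0) (use \<delta> c e in auto)
    moreover have "3 / 4 * e + 0 / (2 * e) + (1 + 1 / (2 * e)) * 0 < e" using e by simp
    ultimately have "\<forall>\<^sub>F n in sequentially. 3 / 4 * e + 2 powr (- (2 * \<delta>) * real n) / (2 * e) + (1 + 1 / (2 * e)) * exp (- c * real n) < e"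
      by (rule order_tendstoD)
    thus "\<forall>\<^sub>F n in sequentially. eps_cov d W p n (nat \<lfloor>2 powr (real n * R)\<rfloor>) < e"
      by (rule eventually_mono) (use bound[OF e] in \<open>auto intro: le_less_trans\<close>)
  qed
qed

text \<open>One exponent and one threshold on n serve all codebook sizes up to 2^(nR). This
  uniformity is what \<open>rate_R_eps_eq\<close> needs, where the size \<open>M_eps\<close> is not
  known in advance.\<close>

lemma strong_converse:
  assumes "R < opt_rate"
  shows "\<exists>c>0. \<forall>\<^sub>F n in sequentially. \<forall>M. 0 < M \<and> real M \<le> 2 powr (real n * R) \<longrightarrow>
    1 - eps_cov d W p n M \<le> 2 powr (- c * real n)"
proof -
  \<comment> \<open>Four \<open>\<delta>\<close> are lost in \<open>converse_one_shot\<close> and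
    one in the duality gap; the sixth remains as the decay rate.\<close>
  define \<delta> where "\<delta> = (opt_rate - R) / 6"
  have \<delta>: "0 < \<delta>" using assms by (simp add: \<delta>_def)
  let ?h = "vn_entropy (avg_state d W p)"
  have "(\<Sum>x\<in>UNIV. q x * vn_entropy (W x)) \<le> ?h - opt_rate" if "prob_dist q" "avg_state d W q = avg_state d W p" for q
    using opt_rate_le[of q] that by (simp add: feasible_def info_def)
  from dual_observable[OF W p \<delta> this] obtain A where A: "A \<in> carrier_mat d d" "hermitian A"
    "\<And>x. vn_entropy (W x) + Re (ctrace (A * W x)) \<le> 0"
    and a: "- (?h - opt_rate) - \<delta> \<le> Re (ctrace (A * avg_state d W p))" by blast
  obtain c where c: "0 < c" and conv: "\<And>n M q. 0 < M \<Longrightarrow> q \<in> types_M n M \<Longrightarrow>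
     1 - trace_norm (avg_state_n d n W (iid p n) - avg_state_n d n W q) / 2
       \<le> 3 * exp (- c * real n) + real M * 2 powr (real n * (4 * \<delta> - Re (ctrace (A * avg_state d W p)) - ?h))"
    using converse_one_shot[OF W p A refl refl \<delta>] by blast
  \<comment> \<open>Division by ln 2 converts base e to base 2. Twice c' is the common decay rate,
    and the other half later absorbs the factor 4.\<close>
  define c' where "c' = min (c / ln 2) \<delta> / 2"
  have c': "0 < c'" using c \<delta> by (simp add: c'_def)
  have bound: "1 - eps_cov d W p n M \<le> 4 * 2 powr (- (2 * c') * real n)" if M: "0 < M" "real M \<le> 2 powr (real n * R)" for n M
  proof -
    have "1 - (3 * exp (- c * real n) + 2 powr (- \<delta> * real n)) \<le> eps_cov d W p n M"
    proof (rule eps_cov_ge[OF M(1)])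
      fix q :: "'x list \<Rightarrow> real" assume q: "q \<in> types_M n M"
      have "real M * 2 powr (real n * (4 * \<delta> - Re (ctrace (A * avg_state d W p)) - ?h))
         \<le> 2 powr (real n * R) * 2 powr (real n * (5 * \<delta> - opt_rate))"
        using a M by (intro mult_mono powr_mono mult_left_mono) auto
      also have "\<dots> = 2 powr (- \<delta> * real n)"
      proof -
        have "real n * R + real n * (5 * \<delta> - opt_rate) = real n * (R + 5 * \<delta> - opt_rate)" by (simp add: algebra_simps)
        also have "R + 5 * \<delta> - opt_rate = - \<delta>" by (simp add: \<delta>_def field_simps)
        finally show ?thesis unfolding powr_add[symmetric] by (simp add: mult.commute)
      qed
      finally show "1 - (3 * exp (- c * real n) + 2 powr (- \<delta> * real n))
         \<le> trace_norm (avg_state_n d n W (iid p n) - avg_state_n d n W q) / 2"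
        using conv[OF M(1) q] by linarith
    qed
    moreover have "exp (- c * real n) \<le> 2 powr (- (2 * c') * real n)"
    proof -
      have "2 * c' \<le> c / ln 2" by (simp add: c'_def)
      hence "2 * c' * ln 2 \<le> c" by (simp add: field_simps)
      hence "2 * c' * ln 2 * real n \<le> c * real n" by (intro mult_right_mono) auto
      thus ?thesis by (simp add: powr_def mult_ac)
    qed
    moreover have "2 powr (- \<delta> * real n) \<le> 2 powr (- (2 * c') * real n)"
    proof -
      have "2 * c' \<le> \<delta>" by (simp add: c'_def)
      thus ?thesis by (intro powr_mono mult_right_mono) auto
    qed
    ultimately show ?thesis by linarith
  qed
  have "\<forall>\<^sub>F n in sequentially. 2 powr (- c' * real n) < (1 / 4 :: real)"
    using order_tendstoD(2)[OF powr_neg_tendsto_0[OF c'], of "1/4"] by simp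
  hence "\<forall>\<^sub>F n in sequentially. \<forall>M. 0 < M \<and> real M \<le> 2 powr (real n * R) \<longrightarrow>
    1 - eps_cov d W p n M \<le> 2 powr (- c' * real n)"
  proof (rule eventually_mono, intro allI impI)
    fix n M assume n: "2 powr (- c' * real n) < (1 / 4 :: real)" and M: "0 < M \<and> real M \<le> 2 powr (real n * R)"
    have "(2::real) powr (- (2 * c') * real n) = 2 powr (- c' * real n) * 2 powr (- c' * real n)"
      unfolding powr_add[symmetric] by (simp add: algebra_simps)
    also have "\<dots> \<le> 1 / 4 * 2 powr (- c' * real n)" using n by (intro mult_right_mono) auto
    finally show "1 - eps_cov d W p n M \<le> 2 powr (- c' * real n)" using bound[of M n] M by linarith
  qed
  thus ?thesis using c' by blast
qed

text \<open>Above \<open>opt_rate\<close> the error tends to 0. Below it the strong converse keeps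
  the error at least 1/2 eventually, which contradicts even a vanishing
  \<open>liminf\<close>.\<close>

lemma rate_R_eq: "rate_R d W p = opt_rate"
proof -
  define S where "S = {R. R > 0 \<and> (\<forall>\<gamma>>0.
      liminf (\<lambda>n. ereal (eps_cov d W p n (nat \<lfloor>2 powr (real n * (R + \<gamma>))\<rfloor>))) = 0)}"
  have mem: "R \<in> S" if "opt_rate < R" for R
    unfolding S_def
  proof (intro CollectI conjI allI impI)
    show "0 < R" using that opt_rate_nonneg by linarith
    fix \<gamma> :: real assume "0 < \<gamma>"
    hence "(\<lambda>n. ereal (eps_cov d W p n (nat \<lfloor>2 powr (real n * (R + \<gamma>))\<rfloor>))) \<longlonglongrightarrow> ereal 0"
      using achievability[of "R + \<gamma>"] that by simp
    thus "liminf (\<lambda>n. ereal (eps_cov d W p n (nat \<lfloor>2 powr (real n * (R + \<gamma>))\<rfloor>))) = 0"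
      by (simp add: lim_imp_Liminf zero_ereal_def)
  qed
  have ge: "opt_rate \<le> R" if "R \<in> S" for R
  proof (rule ccontr)
    assume "\<not> opt_rate \<le> R"
    \<comment> \<open>Half the gap, so that R + \<open>\<gamma>\<close> is still below
      \<open>opt_rate\<close>.\<close>
    define \<gamma> where "\<gamma> = (opt_rate - R) / 2"
    have \<gamma>: "0 < \<gamma>" "R + \<gamma> < opt_rate" using \<open>\<not> opt_rate \<le> R\<close> by (auto simp: \<gamma>_def field_simps)
    have R: "0 \<le> R + \<gamma>" using that \<gamma> by (simp add: S_def)
    obtain c where c: "0 < c" and ev: "\<forall>\<^sub>F n in sequentially. \<forall>M. 0 < M \<and> real M \<le> 2 powr (real n * (R + \<gamma>)) \<longrightarrow>
      1 - eps_cov d W p n M \<le> 2 powr (- c * real n)" using strong_converse[OF \<gamma>(2)] by blast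
    have "\<forall>\<^sub>F n in sequentially. 2 powr (- c * real n) < (1 / 2 :: real)"
      using order_tendstoD(2)[OF powr_neg_tendsto_0[OF c], of "1/2"] by simp
    with ev have "\<forall>\<^sub>F n in sequentially. ereal (1 / 2) \<le> ereal (eps_cov d W p n (nat \<lfloor>2 powr (real n * (R + \<gamma>))\<rfloor>))"
    proof eventually_elim
      case (elim n)
      hence "1 - eps_cov d W p n (nat \<lfloor>2 powr (real n * (R + \<gamma>))\<rfloor>) \<le> 2 powr (- c * real n)"
        using nat_floor_powr_bounds[OF R, of n] by blast
      thus ?case using elim(2) by simp
    qed
    hence "ereal (1 / 2) \<le> liminf (\<lambda>n. ereal (eps_cov d W p n (nat \<lfloor>2 powr (real n * (R + \<gamma>))\<rfloor>)))"
      by (rule Liminf_bounded)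
    also have "\<dots> = 0" using that \<gamma>(1) by (simp add: S_def)
    finally show False by (simp add: zero_ereal_def)
  qed
  have "Inf S = opt_rate"
  proof (rule antisym)
    show "opt_rate \<le> Inf S" using mem[of "opt_rate + 1"] ge by (intro cInf_greatest) auto
    show "Inf S \<le> opt_rate"
    proof (rule dense_ge)
      show "Inf S \<le> R" if "opt_rate < R" for R
        using mem[OF that] ge by (intro cInf_lower bdd_belowI[of _ opt_rate]) auto
    qed
  qed
  thus ?thesis unfolding rate_R_def S_def .
qed

text \<open>The normalised logarithm of \<open>M_eps\<close> actually converges. Achievability
  bounds it from above; the strong converse bounds it from below for every error
  \<open>\<epsilon>\<close> < 1, because a smaller codebook has error close to 1.\<close>

lemma rate_R_eps_eq:
  assumes \<epsilon>: "0 < \<epsilon>" "\<epsilon> < 1"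
  shows "rate_R_eps d W p \<epsilon> = ereal opt_rate"
proof -
  have M_eps: "1 \<le> M_eps d W p \<epsilon> n" "eps_cov d W p n (M_eps d W p \<epsilon> n) \<le> \<epsilon>" "M_eps d W p \<epsilon> n \<le> M"
    if "0 < M" "eps_cov d W p n M \<le> \<epsilon>" for n M
    using LeastI[of "\<lambda>M. M \<ge> 1 \<and> eps_cov d W p n M \<le> \<epsilon>" M]
      Least_le[of "\<lambda>M. M \<ge> 1 \<and> eps_cov d W p n M \<le> \<epsilon>" M] that
    by (auto simp: M_eps_def)
  have ach: "\<forall>\<^sub>F n in sequentially. eps_cov d W p n (nat \<lfloor>2 powr (real n * R)\<rfloor>) \<le> \<epsilon>" if "opt_rate < R" for R
    using order_tendstoD(2)[OF achievability[OF that] \<epsilon>(1)] by (rule eventually_mono) simp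
  have "(\<lambda>n. log 2 (real (M_eps d W p \<epsilon> n)) / real n) \<longlonglongrightarrow> opt_rate"
  proof (rule order_tendstoI)
    fix a assume a: "opt_rate < a"
    define R where "R = (opt_rate + a) / 2"
    have R: "opt_rate < R" "R < a" using a by (auto simp: R_def field_simps)
    have R0: "0 \<le> R" using R opt_rate_nonneg by linarith
    show "\<forall>\<^sub>F n in sequentially. log 2 (real (M_eps d W p \<epsilon> n)) / real n < a"
      using ach[OF R(1)] eventually_gt_at_top[of 0]
    proof eventually_elim
      case (elim n)
      note b = nat_floor_powr_bounds[OF R0, of n]
      note m = M_eps[OF b(1) elim(1)]
      have "real (M_eps d W p \<epsilon> n) \<le> 2 powr (real n * R)" using m(3) b(2) by linarith
      hence "log 2 (real (M_eps d W p \<epsilon> n)) \<le> real n * R" using m(1) by (simp add: log_le_iff)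
      also have "\<dots> < real n * a" using R(2) elim(2) by simp
      finally show ?case using elim(2) by (simp add: divide_less_eq mult.commute)
    qed
  next
    fix a assume a: "a < opt_rate"
    define R where "R = (opt_rate + a) / 2"
    have R: "R < opt_rate" "a < R" using a by (auto simp: R_def field_simps)
    obtain c where c: "0 < c" and ev: "\<forall>\<^sub>F n in sequentially. \<forall>M. 0 < M \<and> real M \<le> 2 powr (real n * R) \<longrightarrow>
      1 - eps_cov d W p n M \<le> 2 powr (- c * real n)" using strong_converse[OF R(1)] by blast
    have "\<forall>\<^sub>F n in sequentially. 2 powr (- c * real n) < 1 - \<epsilon>"
      using order_tendstoD(2)[OF powr_neg_tendsto_0[OF c], of "1 - \<epsilon>"] \<epsilon> by simp
    \<comment> \<open>The rate \<open>opt_rate + 1\<close> only guarantees that some codebook size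
      meets the error bound, so that the \<open>LEAST\<close> in \<open>M_eps\<close> is
      attained.\<close>
    with ev show "\<forall>\<^sub>F n in sequentially. a < log 2 (real (M_eps d W p \<epsilon> n)) / real n"
      using ach[of "opt_rate + 1", simplified] eventually_gt_at_top[of 0]
    proof eventually_elim
      case (elim n)
      have R0: "0 \<le> opt_rate + 1" using opt_rate_nonneg by simp
      note m = M_eps[OF nat_floor_powr_bounds(1)[OF R0] elim(3)]
      have "2 powr (real n * R) < real (M_eps d W p \<epsilon> n)"
      proof (rule ccontr)
        assume "\<not> 2 powr (real n * R) < real (M_eps d W p \<epsilon> n)"
        hence "0 < M_eps d W p \<epsilon> n \<and> real (M_eps d W p \<epsilon> n) \<le> 2 powr (real n * R)" using m(1) by auto
        hence "1 - eps_cov d W p n (M_eps d W p \<epsilon> n) \<le> 2 powr (- c * real n)" using elim(1) by blast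
        thus False using m(2) elim(2) by linarith
      qed
      hence "real n * R < log 2 (real (M_eps d W p \<epsilon> n))" using m(1) by (simp add: less_log_iff)
      moreover have "real n * a < real n * R" using R(2) elim(4) by simp
      ultimately have "real n * a < log 2 (real (M_eps d W p \<epsilon> n))" by linarith
      thus ?case using elim(4) by (simp add: less_divide_eq mult.commute)
    qed
  qed
  hence "(\<lambda>n. ereal (log 2 (real (M_eps d W p \<epsilon> n)) / real n)) \<longlonglongrightarrow> ereal opt_rate" by simp
  thus ?thesis unfolding rate_R_eps_def by (rule lim_imp_Liminf[OF sequentially_bot])
qed

text \<open>The range starts at R = 0 because for R < 0 and n >= 1 the size floor(2^(nR)) is 0, and
  \<open>types_M n 0\<close> contains the target distribution itself, which makes the error
  0.\<close>

lemma exponential_strong_converse: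
  assumes "0 \<le> R" "R < rate_R d W p"
  shows "\<exists>c>0. \<forall>\<^sub>F n in sequentially.
    1 - eps_cov d W p n (nat \<lfloor>2 powr (real n * R)\<rfloor>) \<le> 2 powr (- c * real n)"
proof -
  obtain c where c: "0 < c" and ev: "\<forall>\<^sub>F n in sequentially. \<forall>M. 0 < M \<and> real M \<le> 2 powr (real n * R) \<longrightarrow>
      1 - eps_cov d W p n M \<le> 2 powr (- c * real n)"
    using strong_converse[of R] assms(2) unfolding rate_R_eq by blast
  from ev have "\<forall>\<^sub>F n in sequentially. 1 - eps_cov d W p n (nat \<lfloor>2 powr (real n * R)\<rfloor>) \<le> 2 powr (- c * real n)"
    by (rule eventually_mono) (use nat_floor_powr_bounds[OF assms(1)] in blast)
  thus ?thesis using c by blast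
qed

end

theorem theorem2:
  fixes d :: nat and W :: "'x::finite \<Rightarrow> complex mat" and p :: "'x \<Rightarrow> real"
  assumes "d \<ge> 1" and "cq_channel d W" and "prob_dist p"
  shows "(\<forall>\<epsilon>. 0 < \<epsilon> \<and> \<epsilon> < 1 \<longrightarrow>
            ereal (rate_R d W p) = rate_R_eps d W p \<epsilon> \<and>
            rate_R_eps d W p \<epsilon> =
              (INF q \<in> {q. prob_dist q \<and> avg_state d W q = avg_state d W p}. mutual_info d W q))
       \<and> (\<forall>R. 0 \<le> R \<and> R < rate_R d W p \<longrightarrow>
            (\<exists>c>0. \<forall>\<^sub>F n in sequentially.
               1 - eps_cov d W p n (nat \<lfloor>2 powr (real n * R)\<rfloor>) \<le> 2 powr (- c * real n)))"
  using rate_R_eq[OF assms(2,3)] rate_R_eps_eq[OF assms(2,3)] INF_mutual_info[OF assms(2,3)]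
    exponential_strong_converse[OF assms(2,3)]
  unfolding feasible_def[OF assms(2,3)] by simp

end
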